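(* For every integer $q$ there exists an exact functor $s_q\colon\mathbf{SH}^{\ast}\to\mathbf{SH}^{\ast}$ and there exist natural transformations $f_q\to s_q$ and $s_q\to\Sigma_{S^1}f_{q+1}$ such that the following hold: (1) For every $\mathcal{E}$ there exists a distinguished triangle in $\mathbf{SH}^{\ast}$ $$f_{q+1}\mathcal{E}\to f_q\mathcal{E}\to s_q\mathcal{E}\to\Sigma_{S^1}f_{q+1}\mathcal{E}.$$ (2) The functor $s_q$ takes values in the full subcategory $\Sigma_C^q\mathbf{SH}^{\ast,\mathsf{eff}}$ of $\mathbf{SH}^{\ast}$. (3) Every map in $\mathbf{SH}^{\ast}$ from an object of $\Sigma_C^{q+1}\mathbf{SH}^{\ast,\mathsf{eff}}$ to $s_q\mathcal{E}$ is trivial. (4) The following properties characterize the exact functor $s_q$ up to canonical isomorphism: there are natural transformations $f_q\to s_q$ and $s_q\to\Sigma_{S^1}f_{q+1}$ giving for every $\mathcal{E}$ a distinguished triangle $f_{q+1}\mathcal{E}\to f_q\mathcal{E}\to s_q\mathcal{E}\to\Sigma_{S^1}f_{q+1}\mathcal{E}$ in $\mathbf{SH}^{\ast}$; $s_q$ takes values in $\Sigma_C^q\mathbf{SH}^{\ast,\mathsf{eff}}$; and every map in $\mathbf{SH}^{\ast}$ from an object of $\Sigma_C^{q+1}\mathbf{SH}^{\ast,\mathsf{eff}}$ to $s_q\mathcal{E}$ is trivial.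
   Context: $\mathrm{C}^*\mathrm{Alg}$ is the category of separable $C^*$-algebras and $*$-homomorphisms (small skeleton), with a fixed tensor product $\otimes$, maximal or minimal. "Short exact sequence" means: all short exact sequences in the maximal case, those with a completely positive splitting in the minimal case. $\mathcal{K}$: compact operators on a separable infinite dimensional Hilbert space; $C(I,A)$: continuous functions $[0,1]\to A$. Cubical sets are presheaves of sets on the box category (objects $1^n=\{0,1\}^n$, maps generated by cofaces and codegeneracies), with $\Box^n$ represented by $1^n$, with the model structure whose cofibrations are the monomorphisms and weak equivalences the maps with triangulation a weak equivalence of simplicial sets, and with the closed monoidal product with $\Box^m\otimes\Box^n=\Box^{m+n}$. A pointed cubical $C^*$-space is a functor from $\mathrm{C}^*\mathrm{Alg}$ to pointed cubical sets; the category is $\Box\mathrm{C}^*\mathrm{Spc}_0$, with closed monoidal structure $(\otimes,\underline{\mathrm{Hom}})$ by Day convolution and function complexes $\hom(\mathcal{X},\mathcal{Y})$ with $n$-cells the maps $\mathcal{X}\otimes\Box^n_+\to\mathcal{Y}$. $C^*$-algebras are identified with the pointed functors they represent. Homotopy invariant projective model structure on $\Box\mathrm{C}^*\mathrm{Spc}_0$: cofibrations are the maps with the left lifting property against pointwise acyclic Kan fibrations; $\mathcal{Z}$ is fibrant if each $\mathcal{Z}(A)$ is fibrant, $\mathcal{Z}(0)$ is contractible, every short exact sequence $0\to A\to E\to B\to 0$ yields a homotopy fiber sequence $\mathcal{Z}(A)\to\mathcal{Z}(E)\to\mathcal{Z}(B)$, and $\mathcal{Z}(A)\to\mathcal{Z}(A\otimes\mathcal{K})$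 (induced by a rank one projection) and $\mathcal{Z}(A)\to\mathcal{Z}(C(I,A))$ (constant functions) are weak equivalences; weak equivalences are the maps inducing, after cofibrant replacement, weak equivalences of function complexes into all fibrant $\mathcal{Z}$. With $S^1=\Box^1/\partial\Box^1$, $S^s$ its $s$-fold product, and $C=S^1\otimes C_0(\mathbb{R})$, a cubical $C^*$-spectrum is a sequence $(\mathcal{E}_n)_{n\ge0}$ in $\Box\mathrm{C}^*\mathrm{Spc}_0$ with structure maps $C\otimes\mathcal{E}_n\to\mathcal{E}_{n+1}$. In the stable model structure, cofibrations are the maps with left lifting property against levelwise acyclic fibrations, fibrant objects are the levelwise fibrant $\mathcal{Z}$ with all $\mathcal{Z}_n\to\underline{\mathrm{Hom}}(C,\mathcal{Z}_{n+1})$ weak equivalences, and weak equivalences are the maps inducing, after cofibrant replacement, weak equivalences of function complexes into these. $\mathbf{SH}^{\ast}$ is its homotopy category, a triangulated category with shift $\Sigma_{S^1}=S^1\wedge-$ and with arbitrary coproducts (direct sums). $\mathrm{Fr}_m$ is the left adjoint of $\mathcal{E}\mapsto\mathcal{E}_m$. For an integer $q$, $\Sigma_C^q\mathbf{SH}^{\ast,\mathsf{eff}}$ is the smallest full triangulated subcategory of $\mathbf{SH}^{\ast}$ that is closed under direct sums and contains the spectra $\mathrm{Fr}_m(S^s\otimes C_0(\mathbb{R}^t)\otimes\mathcal{X})$ for all integers $s,t,m\ge0$ with $t-m\ge q$ and all pointed cubical $C^*$-spaces $\mathcal{X}$ (tensor products and $\mathrm{Fr}_m$ being derived, i.e. $\mathcal{X}$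 may be taken cofibrant). The inclusion $i_q\colon\Sigma_C^q\mathbf{SH}^{\ast,\mathsf{eff}}\to\mathbf{SH}^{\ast}$ has an exact right adjoint $r_q$, $f_q=i_q\circ r_q$, and $f_{q+1}\to f_q$ is the natural transformation induced by the inclusion $\Sigma_C^{q+1}\mathbf{SH}^{\ast,\mathsf{eff}}\subseteq\Sigma_C^q\mathbf{SH}^{\ast,\mathsf{eff}}$ (first map of the triangle in (1)). *)

theory Defs
  imports "HOL-Analysis.Analysis" "HOL-Homology.Homology" "HOL-Algebra.Group"
begin

section \<open>Universes of small sets, quotients\<close>

text \<open>
  ``Set'' means: member of a fixed universe \<open>U\<close> of subsets of a type.  The closure properties
  below hold in every Grothendieck universe containing the reals (up to bijection), and also for
  \<open>U = UNIV\<close> over the type \<open>real set\<close>.  The third condition makes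
  the category of separable C*-algebras essentially small relative to \<open>U\<close>.
\<close>

definition set_universe :: "'u set set \<Rightarrow> bool" where
  "set_universe U \<longleftrightarrow>
     (\<forall>S\<in>U. \<forall>T::'u set. T \<lesssim> S \<longrightarrow> T \<in> U) \<and>
     (\<forall>S\<in>U. \<forall>F::'u \<Rightarrow> 'u set. (\<forall>x\<in>S. F x \<in> U) \<longrightarrow> (\<exists>T\<in>U. Sigma S F \<lesssim> T)) \<and>
     (\<forall>S\<in>U. \<exists>T\<in>U. {f::real \<Rightarrow> 'u. range f \<subseteq> S} \<lesssim> T) \<and>
     (\<exists>S\<in>U. \<exists>x\<in>S. \<exists>y\<in>S. x \<noteq> y)"

text \<open>Colimits of sets are formed as quotients by generated equivalence relations, and then
  replaced, where necessary, by an isomorphic copy \<open>enc U S ` S\<close> inside the universe.\<close>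

definition eqv_cl :: "'a set \<Rightarrow> 'a rel \<Rightarrow> 'a rel" where
  "eqv_cl S R = {(a, b). a \<in> S \<and> b \<in> S \<and> (a, b) \<in> ((R \<union> R\<inverse>) \<inter> S \<times> S)\<^sup>*}"

definition cls :: "'a set \<Rightarrow> 'a rel \<Rightarrow> 'a \<Rightarrow> 'a set" where
  "cls S R a = eqv_cl S R `` {a}"

definition quo :: "'a set \<Rightarrow> 'a rel \<Rightarrow> 'a set set" where
  "quo S R = S // eqv_cl S R"

definition rep :: "'a set \<Rightarrow> 'a" where
  "rep c = (SOME a. a \<in> c)"

definition enc :: "'u set set \<Rightarrow> 'a set \<Rightarrow> 'a \<Rightarrow> 'u" where
  "enc U S = (SOME f. inj_on f S \<and> f ` S \<in> U)"

definition dec :: "'u set set \<Rightarrow> 'a set \<Rightarrow> 'u \<Rightarrow> 'a" where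
  "dec U S = inv_into S (enc U S)"

section \<open>C*-algebras\<close>

record 'a cstar =
  car :: "'a set"
  zer :: 'a
  plu :: "'a \<Rightarrow> 'a \<Rightarrow> 'a"
  scl :: "complex \<Rightarrow> 'a \<Rightarrow> 'a"
  mul :: "'a \<Rightarrow> 'a \<Rightarrow> 'a"
  sta :: "'a \<Rightarrow> 'a"
  nrm :: "'a \<Rightarrow> real"

definition cs_dist :: "'a cstar \<Rightarrow> 'a \<Rightarrow> 'a \<Rightarrow> real" where
  "cs_dist A x y = nrm A (plu A x (scl A (- 1) y))"

definition cstar_algebra :: "'a cstar \<Rightarrow> bool" where
  "cstar_algebra A \<longleftrightarrow>
     comm_group \<lparr>carrier = car A, monoid.mult = plu A, one = zer A\<rparr> \<and>
     (\<forall>c. \<forall>x\<in>car A. scl A c x \<in> car A) \<and>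
     (\<forall>x\<in>car A. scl A 1 x = x) \<and>
     (\<forall>c d. \<forall>x\<in>car A. scl A c (scl A d x) = scl A (c * d) x \<and>
        scl A (c + d) x = plu A (scl A c x) (scl A d x)) \<and>
     (\<forall>c. \<forall>x\<in>car A. \<forall>y\<in>car A. scl A c (plu A x y) = plu A (scl A c x) (scl A c y)) \<and>
     (\<forall>x\<in>car A. \<forall>y\<in>car A. mul A x y \<in> car A) \<and>
     (\<forall>x\<in>car A. \<forall>y\<in>car A. \<forall>z\<in>car A. mul A (mul A x y) z = mul A x (mul A y z) \<and>
        mul A x (plu A y z) = plu A (mul A x y) (mul A x z) \<and>
        mul A (plu A x y) z = plu A (mul A x z) (mul A y z)) \<and>
     (\<forall>c. \<forall>x\<in>car A. \<forall>y\<in>car A. mul A (scl A c x) y = scl A c (mul A x y) \<and>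
        mul A x (scl A c y) = scl A c (mul A x y)) \<and>
     (\<forall>x\<in>car A. sta A x \<in> car A \<and> sta A (sta A x) = x) \<and>
     (\<forall>c. \<forall>x\<in>car A. sta A (scl A c x) = scl A (cnj c) (sta A x)) \<and>
     (\<forall>x\<in>car A. \<forall>y\<in>car A. sta A (plu A x y) = plu A (sta A x) (sta A y) \<and>
        sta A (mul A x y) = mul A (sta A y) (sta A x)) \<and>
     (\<forall>x\<in>car A. 0 \<le> nrm A x \<and> (nrm A x = 0 \<longleftrightarrow> x = zer A)) \<and>
     (\<forall>c. \<forall>x\<in>car A. nrm A (scl A c x) = cmod c * nrm A x) \<and>
     (\<forall>x\<in>car A. \<forall>y\<in>car A. nrm A (plu A x y) \<le> nrm A x + nrm A y \<and>
        nrm A (mul A x y) \<le> nrm A x * nrm A y) \<and>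
     (\<forall>x\<in>car A. nrm A (mul A (sta A x) x) = (nrm A x)\<^sup>2) \<and>
     (\<forall>x::nat \<Rightarrow> 'a. (\<forall>n. x n \<in> car A) \<and>
        (\<forall>e>0. \<exists>N. \<forall>m\<ge>N. \<forall>n\<ge>N. cs_dist A (x m) (x n) < e) \<longrightarrow>
        (\<exists>l\<in>car A. (\<lambda>n. cs_dist A (x n) l) \<longlonglongrightarrow> 0))"

definition cs_separable :: "'a cstar \<Rightarrow> bool" where
  "cs_separable A \<longleftrightarrow> (\<exists>D. countable D \<and> D \<subseteq> car A \<and> (\<forall>x\<in>car A. \<forall>e>0. \<exists>d\<in>D. cs_dist A x d < e))"

definition star_hom :: "'a cstar \<Rightarrow> 'b cstar \<Rightarrow> ('a \<Rightarrow> 'b) set" where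
  "star_hom A B = {f \<in> car A \<rightarrow>\<^sub>E car B.
     (\<forall>x\<in>car A. \<forall>y\<in>car A. f (plu A x y) = plu B (f x) (f y) \<and> f (mul A x y) = mul B (f x) (f y)) \<and>
     (\<forall>c. \<forall>x\<in>car A. f (scl A c x) = scl B c (f x)) \<and>
     (\<forall>x\<in>car A. f (sta A x) = sta B (f x))}"

definition star_iso :: "'a cstar \<Rightarrow> 'b cstar \<Rightarrow> ('a \<Rightarrow> 'b) \<Rightarrow> bool" where
  "star_iso A B f \<longleftrightarrow> f \<in> star_hom A B \<and> bij_betw f (car A) (car B)"

definition cs_id :: "'a cstar \<Rightarrow> 'a \<Rightarrow> 'a" where
  "cs_id A = (\<lambda>x\<in>car A. x)"

definition zero_hom :: "'a cstar \<Rightarrow> 'b cstar \<Rightarrow> 'a \<Rightarrow> 'b" where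
  "zero_hom A B = (\<lambda>x\<in>car A. zer B)"

text \<open>A separable C*-algebra has at most continuum many elements, so the C*-algebras carried by
  sets of reals form a small category equivalent to that of all separable C*-algebras.\<close>

type_synonym calg = "real cstar"

definition CAlg :: "calg set" where
  "CAlg = {A. cstar_algebra A \<and> cs_separable A}"

definition zero_alg :: calg where
  "zero_alg = \<lparr>car = {0}, zer = 0, plu = \<lambda>_ _. 0, scl = \<lambda>_ _. 0, mul = \<lambda>_ _. 0, sta = \<lambda>_. 0, nrm = \<lambda>_. 0\<rparr>"

definition real_copy :: "'a cstar \<Rightarrow> calg" where
  "real_copy A = (SOME B. B \<in> CAlg \<and> (\<exists>f. star_iso A B f))"

definition copy_iso :: "'a cstar \<Rightarrow> 'a \<Rightarrow> real" where
  "copy_iso A = (SOME f. star_iso A (real_copy A) f)"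

subsection \<open>Function algebras and operators on Hilbert space\<close>

definition C0 :: "'x::topological_space set \<Rightarrow> ('x \<Rightarrow> complex) cstar" where
  "C0 X = \<lparr>car = {f. continuous_on X f \<and> (\<forall>x. x \<notin> X \<longrightarrow> f x = 0) \<and>
                    (\<forall>e>0. \<exists>K. compact K \<and> K \<subseteq> X \<and> (\<forall>x\<in>X - K. cmod (f x) < e))},
           zer = \<lambda>_. 0, plu = \<lambda>f g x. f x + g x, scl = \<lambda>c f x. c * f x, mul = \<lambda>f g x. f x * g x,
           sta = \<lambda>f x. cnj (f x), nrm = \<lambda>f. SUP x\<in>X. cmod (f x)\<rparr>"

text \<open>\<open>\<real>\<^sup>t\<close> as a subspace of the product \<open>nat \<Rightarrow> real\<close>.\<close>

definition euc :: "nat \<Rightarrow> (nat \<Rightarrow> real) set" where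
  "euc t = {x. \<forall>i\<ge>t. x i = 0}"

definition CI :: "'a cstar \<Rightarrow> (real \<Rightarrow> 'a) cstar" where
  "CI A = \<lparr>car = {f \<in> {0..1} \<rightarrow>\<^sub>E car A. \<forall>t\<in>{0..1}. \<forall>e>0. \<exists>d>0. \<forall>u\<in>{0..1}.
                    \<bar>u - t\<bar> < d \<longrightarrow> cs_dist A (f u) (f t) < e},
           zer = (\<lambda>t\<in>{0..1}. zer A), plu = (\<lambda>f g. \<lambda>t\<in>{0..1}. plu A (f t) (g t)),
           scl = (\<lambda>c f. \<lambda>t\<in>{0..1}. scl A c (f t)), mul = (\<lambda>f g. \<lambda>t\<in>{0..1}. mul A (f t) (g t)),
           sta = (\<lambda>f. \<lambda>t\<in>{0..1}. sta A (f t)), nrm = (\<lambda>f. SUP t\<in>{0..1}. nrm A (f t))\<rparr>"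

definition ell2 :: "('i \<Rightarrow> complex) set" where
  "ell2 = {x. (\<lambda>i. (cmod (x i))\<^sup>2) summable_on UNIV}"

definition l2norm :: "('i \<Rightarrow> complex) \<Rightarrow> real" where
  "l2norm x = sqrt (infsum (\<lambda>i. (cmod (x i))\<^sup>2) UNIV)"

definition l2inner :: "('i \<Rightarrow> complex) \<Rightarrow> ('i \<Rightarrow> complex) \<Rightarrow> complex" where
  "l2inner x y = infsum (\<lambda>i. cnj (x i) * y i) UNIV"

definition bounded_op :: "(('i \<Rightarrow> complex) \<Rightarrow> 'i \<Rightarrow> complex) set" where
  "bounded_op = {T \<in> ell2 \<rightarrow>\<^sub>E ell2.
     (\<forall>x\<in>ell2. \<forall>y\<in>ell2. T (\<lambda>i. x i + y i) = (\<lambda>i. T x i + T y i)) \<and>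
     (\<forall>c. \<forall>x\<in>ell2. T (\<lambda>i. c * x i) = (\<lambda>i. c * T x i)) \<and>
     (\<exists>M. \<forall>x\<in>ell2. l2norm (T x) \<le> M * l2norm x)}"

definition Bl2 :: "(('i \<Rightarrow> complex) \<Rightarrow> 'i \<Rightarrow> complex) cstar" where
  "Bl2 = \<lparr>car = bounded_op,
          zer = (\<lambda>x\<in>ell2. \<lambda>_. 0), plu = (\<lambda>S T. \<lambda>x\<in>ell2. \<lambda>i. S x i + T x i),
          scl = (\<lambda>c T. \<lambda>x\<in>ell2. \<lambda>i. c * T x i), mul = (\<lambda>S T. compose ell2 S T),
          sta = (\<lambda>T. THE S. S \<in> bounded_op \<and> (\<forall>x\<in>ell2. \<forall>y\<in>ell2. l2inner (S x) y = l2inner x (T y))),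
          nrm = (\<lambda>T. SUP x\<in>{x\<in>ell2. l2norm x \<le> 1}. l2norm (T x))\<rparr>"

definition compact_op :: "(('i \<Rightarrow> complex) \<Rightarrow> 'i \<Rightarrow> complex) set" where
  "compact_op = {T \<in> bounded_op. \<forall>x::nat \<Rightarrow> 'i \<Rightarrow> complex. (\<forall>n. x n \<in> ell2 \<and> l2norm (x n) \<le> 1) \<longrightarrow>
     (\<exists>r y. strict_mono r \<and> y \<in> ell2 \<and> (\<lambda>n. l2norm (\<lambda>i. T (x (r n)) i - y i)) \<longlonglongrightarrow> 0)}"

definition compact_ops :: "((nat \<Rightarrow> complex) \<Rightarrow> nat \<Rightarrow> complex) cstar" where
  "compact_ops = Bl2\<lparr>car := compact_op\<rparr>"

definition rank_one_proj :: "(nat \<Rightarrow> complex) \<Rightarrow> nat \<Rightarrow> complex" where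
  "rank_one_proj = (\<lambda>x\<in>ell2. \<lambda>i. if i = 0 then x 0 else 0)"

definition op_tensor ::
  "(('i \<Rightarrow> complex) \<Rightarrow> 'i \<Rightarrow> complex) \<Rightarrow> (('j \<Rightarrow> complex) \<Rightarrow> 'j \<Rightarrow> complex) \<Rightarrow>
   (('i \<times> 'j) \<Rightarrow> complex) \<Rightarrow> 'i \<times> 'j \<Rightarrow> complex" where
  "op_tensor S T = (THE R. R \<in> bounded_op \<and> (\<forall>x\<in>ell2. \<forall>y\<in>ell2.
     R (\<lambda>(i, k). x i * y k) = (\<lambda>(i, k). S x i * T y k)))"

subsection \<open>Tensor products, completely positive maps, short exact sequences\<close>

datatype tensor_kind = Maximal | Minimal

text \<open>The *-homomorphisms from the algebraic tensor product of \<open>A\<close> and \<open>B\<close> to \<open>D\<close>, given as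
  bilinear maps.\<close>

definition tensor_map :: "'a cstar \<Rightarrow> 'b cstar \<Rightarrow> 'd cstar \<Rightarrow> ('a \<Rightarrow> 'b \<Rightarrow> 'd) \<Rightarrow> bool" where
  "tensor_map A B D j \<longleftrightarrow>
     (\<forall>a\<in>car A. \<forall>b\<in>car B. j a b \<in> car D \<and> sta D (j a b) = j (sta A a) (sta B b) \<and>
        (\<forall>c. j (scl A c a) b = scl D c (j a b) \<and> j a (scl B c b) = scl D c (j a b)) \<and>
        (\<forall>a'\<in>car A. j (plu A a a') b = plu D (j a b) (j a' b)) \<and>
        (\<forall>b'\<in>car B. j a (plu B b b') = plu D (j a b) (j a b')) \<and>
        (\<forall>a'\<in>car A. \<forall>b'\<in>car B. j (mul A a a') (mul B b b') = mul D (j a b) (j a' b')))"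

text \<open>Lists of pairs represent the elements \<open>\<Sum> a\<^sub>i \<otimes> b\<^sub>i\<close> of the algebraic tensor product.\<close>

definition tsum :: "'d cstar \<Rightarrow> ('a \<Rightarrow> 'b \<Rightarrow> 'd) \<Rightarrow> ('a \<times> 'b) list \<Rightarrow> 'd" where
  "tsum D j ps = foldr (\<lambda>(a, b) s. plu D (j a b) s) ps (zer D)"

definition tensor_norm :: "tensor_kind \<Rightarrow> 'a cstar \<Rightarrow> 'b cstar \<Rightarrow> ('a \<times> 'b) list \<Rightarrow> real" where
  "tensor_norm kd A B ps = (case kd of
      Maximal \<Rightarrow> Sup {nrm Bl2 (tsum Bl2 k ps) | k :: 'a \<Rightarrow> 'b \<Rightarrow> (nat \<Rightarrow> complex) \<Rightarrow> nat \<Rightarrow> complex.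
                        tensor_map A B Bl2 k}
    | Minimal \<Rightarrow> Sup {nrm Bl2 (tsum Bl2 (\<lambda>a b. op_tensor (\<pi> a) (\<rho> b)) ps)
                      | (\<pi> :: 'a \<Rightarrow> (nat \<Rightarrow> complex) \<Rightarrow> nat \<Rightarrow> complex)
                        (\<rho> :: 'b \<Rightarrow> (nat \<Rightarrow> complex) \<Rightarrow> nat \<Rightarrow> complex).
                        \<pi> \<in> star_hom A Bl2 \<and> \<rho> \<in> star_hom B Bl2})"

definition is_tensor :: "tensor_kind \<Rightarrow> 'a cstar \<Rightarrow> 'b cstar \<Rightarrow> 'd cstar \<Rightarrow> ('a \<Rightarrow> 'b \<Rightarrow> 'd) \<Rightarrow> bool" where
  "is_tensor kd A B D j \<longleftrightarrow> cstar_algebra D \<and> tensor_map A B D j \<and>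
     (\<forall>d\<in>car D. \<forall>e>0. \<exists>ps. set ps \<subseteq> car A \<times> car B \<and> cs_dist D d (tsum D j ps) < e) \<and>
     (\<forall>ps. set ps \<subseteq> car A \<times> car B \<longrightarrow> nrm D (tsum D j ps) = tensor_norm kd A B ps)"

definition tens :: "tensor_kind \<Rightarrow> calg \<Rightarrow> calg \<Rightarrow> calg \<times> (real \<Rightarrow> real \<Rightarrow> real)" where
  "tens kd A B = (SOME (D, j). D \<in> CAlg \<and> is_tensor kd A B D j)"

definition tob :: "tensor_kind \<Rightarrow> calg \<Rightarrow> calg \<Rightarrow> calg" where
  "tob kd A B = fst (tens kd A B)"

definition tel :: "tensor_kind \<Rightarrow> calg \<Rightarrow> calg \<Rightarrow> real \<Rightarrow> real \<Rightarrow> real" where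
  "tel kd A B = snd (tens kd A B)"

definition thom :: "tensor_kind \<Rightarrow> calg \<Rightarrow> calg \<Rightarrow> calg \<Rightarrow> calg \<Rightarrow> (real \<Rightarrow> real) \<Rightarrow> (real \<Rightarrow> real) \<Rightarrow> real \<Rightarrow> real" where
  "thom kd A B A' B' f g = (THE h. h \<in> star_hom (tob kd A B) (tob kd A' B') \<and>
     (\<forall>a\<in>car A. \<forall>b\<in>car B. h (tel kd A B a b) = tel kd A' B' (f a) (g b)))"

text \<open>\<open>pos_mat A n a\<close>: the matrix \<open>a\<close> is a positive element \<open>x\<^sup>* x\<close> of \<open>M\<^sub>n(A)\<close>.\<close>

definition pos_mat :: "'a cstar \<Rightarrow> nat \<Rightarrow> (nat \<Rightarrow> nat \<Rightarrow> 'a) \<Rightarrow> bool" where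
  "pos_mat A n a \<longleftrightarrow> (\<exists>x. (\<forall>k<n. \<forall>i<n. x k i \<in> car A) \<and> (\<forall>i<n. \<forall>j<n.
     a i j = foldr (\<lambda>k s. plu A (mul A (sta A (x k i)) (x k j)) s) [0..<n] (zer A)))"

definition completely_positive :: "'a cstar \<Rightarrow> 'b cstar \<Rightarrow> ('a \<Rightarrow> 'b) \<Rightarrow> bool" where
  "completely_positive A B \<sigma> \<longleftrightarrow> \<sigma> \<in> car A \<rightarrow> car B \<and>
     (\<forall>x\<in>car A. \<forall>y\<in>car A. \<sigma> (plu A x y) = plu B (\<sigma> x) (\<sigma> y)) \<and>
     (\<forall>c. \<forall>x\<in>car A. \<sigma> (scl A c x) = scl B c (\<sigma> x)) \<and>
     (\<forall>n a. pos_mat A n a \<longrightarrow> pos_mat B n (\<lambda>i j. \<sigma> (a i j)))"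

definition short_exact :: "tensor_kind \<Rightarrow> calg \<Rightarrow> calg \<Rightarrow> calg \<Rightarrow> (real \<Rightarrow> real) \<Rightarrow> (real \<Rightarrow> real) \<Rightarrow> bool" where
  "short_exact kd A E B i p \<longleftrightarrow> A \<in> CAlg \<and> E \<in> CAlg \<and> B \<in> CAlg \<and>
     i \<in> star_hom A E \<and> p \<in> star_hom E B \<and> inj_on i (car A) \<and> p ` car E = car B \<and>
     i ` car A = {x\<in>car E. p x = zer B} \<and>
     (kd = Minimal \<longrightarrow> (\<exists>\<sigma>. completely_positive B E \<sigma> \<and> (\<forall>b\<in>car B. p (\<sigma> b) = b)))"

section \<open>Cubical sets\<close>

type_synonym box = "bool list \<Rightarrow> bool list"

definition cube :: "nat \<Rightarrow> bool list set" where
  "cube n = {xs. length xs = n}"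

definition box_id :: "nat \<Rightarrow> box" where
  "box_id n = (\<lambda>xs\<in>cube n. xs)"

definition coface :: "nat \<Rightarrow> bool \<Rightarrow> nat \<Rightarrow> box" where
  "coface i e n = (\<lambda>xs\<in>cube n. take i xs @ e # drop i xs)"

definition codegen :: "nat \<Rightarrow> nat \<Rightarrow> box" where
  "codegen i n = (\<lambda>xs\<in>cube (Suc n). take i xs @ drop (Suc i) xs)"

inductive box_map :: "nat \<Rightarrow> nat \<Rightarrow> box \<Rightarrow> bool" where
  "box_map n n (box_id n)"
| "i \<le> n \<Longrightarrow> box_map n (Suc n) (coface i e n)"
| "i \<le> n \<Longrightarrow> box_map (Suc n) n (codegen i n)"
| "box_map k m \<phi> \<Longrightarrow> box_map m n \<theta> \<Longrightarrow> box_map k n (compose (cube k) \<theta> \<phi>)"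

definition box_hom :: "nat \<Rightarrow> nat \<Rightarrow> box set" where
  "box_hom m n = {\<theta>. box_map m n \<theta>}"

definition box_tensor :: "nat \<Rightarrow> nat \<Rightarrow> box \<Rightarrow> box \<Rightarrow> box" where
  "box_tensor m m' \<phi> \<psi> = (\<lambda>xs\<in>cube (m + m'). \<phi> (take m xs) @ \<psi> (drop m xs))"

text \<open>\<open>res K m n \<theta> : K\<^sub>n \<rightarrow> K\<^sub>m\<close> is the action of \<open>\<theta> : 1\<^sup>m \<rightarrow> 1\<^sup>n\<close>.\<close>

record 'a cset =
  cell :: "nat \<Rightarrow> 'a set"
  res :: "nat \<Rightarrow> nat \<Rightarrow> box \<Rightarrow> 'a \<Rightarrow> 'a"

record 'a pcset = "'a cset" +
  pt :: "nat \<Rightarrow> 'a"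

definition cubical_set :: "('a, 'z) cset_scheme \<Rightarrow> bool" where
  "cubical_set K \<longleftrightarrow>
     (\<forall>m n. \<forall>\<theta>\<in>box_hom m n. \<forall>x\<in>cell K n. res K m n \<theta> x \<in> cell K m) \<and>
     (\<forall>n. \<forall>x\<in>cell K n. res K n n (box_id n) x = x) \<and>
     (\<forall>k m n. \<forall>\<phi>\<in>box_hom k m. \<forall>\<theta>\<in>box_hom m n. \<forall>x\<in>cell K n.
        res K k m \<phi> (res K m n \<theta> x) = res K k n (compose (cube k) \<theta> \<phi>) x)"

definition pointed_cubical_set :: "'a pcset \<Rightarrow> bool" where
  "pointed_cubical_set K \<longleftrightarrow> cubical_set K \<and> (\<forall>n. pt K n \<in> cell K n) \<and>
     (\<forall>m n. \<forall>\<theta>\<in>box_hom m n. res K m n \<theta> (pt K n) = pt K m)"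

definition cub_map :: "('a, 'z) cset_scheme \<Rightarrow> ('b, 'y) cset_scheme \<Rightarrow> (nat \<Rightarrow> 'a \<Rightarrow> 'b) \<Rightarrow> bool" where
  "cub_map K L f \<longleftrightarrow> (\<forall>n. \<forall>x\<in>cell K n. f n x \<in> cell L n) \<and>
     (\<forall>m n. \<forall>\<theta>\<in>box_hom m n. \<forall>x\<in>cell K n. f m (res K m n \<theta> x) = res L m n \<theta> (f n x))"

definition std_cube :: "nat \<Rightarrow> box cset" where
  "std_cube n = \<lparr>cell = (\<lambda>m. box_hom m n), res = (\<lambda>k m \<phi> \<theta>. compose (cube k) \<theta> \<phi>)\<rparr>"

definition cube_boundary :: "nat \<Rightarrow> nat \<Rightarrow> box set" where
  "cube_boundary n m =
     {compose (cube m) (coface i e k) \<phi> | i e k \<phi>. n = Suc k \<and> i \<le> k \<and> \<phi> \<in> box_hom m k}"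

text \<open>\<open>K/L\<close> for a cubical subset \<open>L\<close>, pointed by \<open>None\<close>; for empty \<open>L\<close> this is \<open>K\<^sub>+\<close>.\<close>

definition collapse :: "('a, 'z) cset_scheme \<Rightarrow> (nat \<Rightarrow> 'a set) \<Rightarrow> 'a option pcset" where
  "collapse K L =
     \<lparr>cell = (\<lambda>n. insert None (Some ` (cell K n - L n))),
      res = (\<lambda>m n \<theta> u. case u of None \<Rightarrow> None
               | Some x \<Rightarrow> if res K m n \<theta> x \<in> L m then None else Some (res K m n \<theta> x)),
      pt = (\<lambda>_. None)\<rparr>"

definition cube_plus :: "nat \<Rightarrow> box option pcset" where
  "cube_plus n = collapse (std_cube n) (\<lambda>_. {})"

definition cube_plus_map :: "box \<Rightarrow> nat \<Rightarrow> box option \<Rightarrow> box option" where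
  "cube_plus_map \<theta> k = map_option (\<lambda>\<phi>. compose (cube k) \<theta> \<phi>)"

definition circle :: "box option pcset" where
  "circle = collapse (std_cube 1) (cube_boundary 1)"

definition const_cell :: "nat \<Rightarrow> bool \<Rightarrow> box" where
  "const_cell m e = (\<lambda>xs\<in>cube m. [e])"

text \<open>The interval \<open>\<box>\<^sup>1\<close> pointed by its vertex 1.\<close>

definition interval :: "box option pcset" where
  "interval = collapse (std_cube 1) (\<lambda>m. {const_cell m True})"

definition interval_to_circle :: "nat \<Rightarrow> box option \<Rightarrow> box option" where
  "interval_to_circle n u = (case u of None \<Rightarrow> None
     | Some x \<Rightarrow> if x \<in> cube_boundary 1 n then None else Some x)"

text \<open>The product of pointed cubical sets, \<open>K \<otimes> L / (K \<otimes> * \<union> * \<otimes> L)\<close>, where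
  \<open>(K \<otimes> L)\<^sub>n\<close> is the coend of \<open>\<box>(1\<^sup>n, 1\<^sup>p\<^sup>+\<^sup>q) \<times> K\<^sub>p \<times> L\<^sub>q\<close>.\<close>

definition smash_pts :: "'a pcset \<Rightarrow> 'b pcset \<Rightarrow> nat \<Rightarrow> (nat \<times> nat \<times> box \<times> 'a \<times> 'b) set" where
  "smash_pts K L n = {(p, q, \<theta>, x, y). \<theta> \<in> box_hom n (p + q) \<and> x \<in> cell K p \<and> y \<in> cell L q}"

definition smash_rel :: "'a pcset \<Rightarrow> 'b pcset \<Rightarrow> nat \<Rightarrow> (nat \<times> nat \<times> box \<times> 'a \<times> 'b) rel" where
  "smash_rel K L n =
     {((p', q', compose (cube n) (box_tensor p q \<alpha> \<beta>) \<theta>, x, y),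
       (p, q, \<theta>, res K p p' \<alpha> x, res L q q' \<beta> y)) | p p' q q' \<alpha> \<beta> \<theta> x y.
       \<alpha> \<in> box_hom p p' \<and> \<beta> \<in> box_hom q q' \<and> \<theta> \<in> box_hom n (p + q) \<and> x \<in> cell K p' \<and> y \<in> cell L q'}
     \<union> {((p, q, \<theta>, x, y), (p', q', \<theta>', x', y')) | p q \<theta> x y p' q' \<theta>' x' y'.
         (x = pt K p \<or> y = pt L q) \<and> (x' = pt K p' \<or> y' = pt L q')}"

definition smash_cls :: "'a pcset \<Rightarrow> 'b pcset \<Rightarrow> nat \<Rightarrow> (nat \<times> nat \<times> box \<times> 'a \<times> 'b) \<Rightarrow> (nat \<times> nat \<times> box \<times> 'a \<times> 'b) set" where
  "smash_cls K L n = cls (smash_pts K L n) (smash_rel K L n)"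

definition smash :: "'a pcset \<Rightarrow> 'b pcset \<Rightarrow> (nat \<times> nat \<times> box \<times> 'a \<times> 'b) set pcset" where
  "smash K L =
     \<lparr>cell = (\<lambda>n. quo (smash_pts K L n) (smash_rel K L n)),
      res = (\<lambda>m n \<phi> c. case rep c of (p, q, \<theta>, x, y) \<Rightarrow>
               smash_cls K L m (p, q, compose (cube m) \<theta> \<phi>, x, y)),
      pt = (\<lambda>n. smash_cls K L n (n, 0, box_id n, pt K n, pt L 0))\<rparr>"

definition smash_map ::
  "'a pcset \<Rightarrow> 'b pcset \<Rightarrow> (nat \<Rightarrow> 'c \<Rightarrow> 'a) \<Rightarrow> (nat \<Rightarrow> 'd \<Rightarrow> 'b) \<Rightarrow>
   nat \<Rightarrow> (nat \<times> nat \<times> box \<times> 'c \<times> 'd) set \<Rightarrow> (nat \<times> nat \<times> box \<times> 'a \<times> 'b) set" where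
  "smash_map K' L' f g n c = (case rep c of (p, q, \<theta>, x, y) \<Rightarrow> smash_cls K' L' n (p, q, \<theta>, f p x, g q y))"

definition pcode :: "'u set set \<Rightarrow> 'a pcset \<Rightarrow> 'u pcset" where
  "pcode U K =
     \<lparr>cell = (\<lambda>n. enc U (cell K n) ` cell K n),
      res = (\<lambda>m n \<theta> y. enc U (cell K m) (res K m n \<theta> (dec U (cell K n) y))),
      pt = (\<lambda>n. enc U (cell K n) (pt K n))\<rparr>"

text \<open>The \<open>s\<close>-fold product of the circle, with cells coded by natural numbers.\<close>

primrec sphere :: "nat \<Rightarrow> nat pcset" where
  "sphere 0 = pcode UNIV (cube_plus 0)"
| "sphere (Suc s) = pcode UNIV (smash circle (sphere s))"

section \<open>Weak equivalences and fibrations of cubical sets\<close>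

text \<open>\<open>sact S m n \<theta> : S\<^sub>n \<rightarrow> S\<^sub>m\<close> is the action of a monotone map \<open>\<theta> : [m] \<rightarrow> [n]\<close>.\<close>

record 's sset =
  sx :: "nat \<Rightarrow> 's set"
  sact :: "nat \<Rightarrow> nat \<Rightarrow> (nat \<Rightarrow> nat) \<Rightarrow> 's \<Rightarrow> 's"

definition simplex_hom :: "nat \<Rightarrow> nat \<Rightarrow> (nat \<Rightarrow> nat) set" where
  "simplex_hom m n = {\<theta> \<in> {..m} \<rightarrow>\<^sub>E {..n}. mono_on {..m} \<theta>}"

text \<open>The triangulation is the coend of \<open>K\<^sub>n \<times> (\<Delta>\<^sup>1)\<^sup>n\<close>.\<close>

definition cube_simplices :: "nat \<Rightarrow> nat \<Rightarrow> (nat \<Rightarrow> bool list) set" where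
  "cube_simplices n m = {\<sigma> \<in> {..m} \<rightarrow>\<^sub>E cube n. \<forall>i j. i \<le> j \<and> j \<le> m \<longrightarrow> list_all2 (\<le>) (\<sigma> i) (\<sigma> j)}"

definition triang_pts :: "('a, 'z) cset_scheme \<Rightarrow> nat \<Rightarrow> (nat \<times> 'a \<times> (nat \<Rightarrow> bool list)) set" where
  "triang_pts K m = {(n, x, \<sigma>). x \<in> cell K n \<and> \<sigma> \<in> cube_simplices n m}"

definition triang_rel :: "('a, 'z) cset_scheme \<Rightarrow> nat \<Rightarrow> (nat \<times> 'a \<times> (nat \<Rightarrow> bool list)) rel" where
  "triang_rel K m =
     {((n', x, compose {..m} \<theta> \<sigma>), (n, res K n n' \<theta> x, \<sigma>)) | n n' \<theta> x \<sigma>.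
       \<theta> \<in> box_hom n n' \<and> x \<in> cell K n' \<and> \<sigma> \<in> cube_simplices n m}"

definition triang :: "('a, 'z) cset_scheme \<Rightarrow> (nat \<times> 'a \<times> (nat \<Rightarrow> bool list)) set sset" where
  "triang K =
     \<lparr>sx = (\<lambda>m. quo (triang_pts K m) (triang_rel K m)),
      sact = (\<lambda>k m \<theta> c. case rep c of (n, x, \<sigma>) \<Rightarrow>
                cls (triang_pts K k) (triang_rel K k) (n, x, compose {..k} \<sigma> \<theta>))\<rparr>"

definition triang_map ::
  "('b, 'z) cset_scheme \<Rightarrow> (nat \<Rightarrow> 'a \<Rightarrow> 'b) \<Rightarrow>
   nat \<Rightarrow> (nat \<times> 'a \<times> (nat \<Rightarrow> bool list)) set \<Rightarrow> (nat \<times> 'b \<times> (nat \<Rightarrow> bool list)) set" where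
  "triang_map L f m c = (case rep c of (n, x, \<sigma>) \<Rightarrow> cls (triang_pts L m) (triang_rel L m) (n, f n x, \<sigma>))"

definition quotient_topology :: "'a topology \<Rightarrow> ('a \<Rightarrow> 'b) \<Rightarrow> 'b topology" where
  "quotient_topology X r = topology (\<lambda>W. W \<subseteq> r ` topspace X \<and> openin X {x \<in> topspace X. r x \<in> W})"

lemma openin_quotient_topology:
  "openin (quotient_topology X r) W \<longleftrightarrow> W \<subseteq> r ` topspace X \<and> openin X {x \<in> topspace X. r x \<in> W}"
proof -
  have "istopology (\<lambda>W. W \<subseteq> r ` topspace X \<and> openin X {x \<in> topspace X. r x \<in> W})"
    unfolding istopology_def
  proof (intro conjI allI impI)
    fix S T
    assume "S \<subseteq> r ` topspace X \<and> openin X {x \<in> topspace X. r x \<in> S}"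
      and "T \<subseteq> r ` topspace X \<and> openin X {x \<in> topspace X. r x \<in> T}"
    moreover have "{x \<in> topspace X. r x \<in> S \<inter> T} = {x \<in> topspace X. r x \<in> S} \<inter> {x \<in> topspace X. r x \<in> T}"
      by auto
    ultimately show "S \<inter> T \<subseteq> r ` topspace X" "openin X {x \<in> topspace X. r x \<in> S \<inter> T}"
      by auto
  next
    fix \<K>
    assume *: "\<forall>K\<in>\<K>. K \<subseteq> r ` topspace X \<and> openin X {x \<in> topspace X. r x \<in> K}"
    then show "\<Union>\<K> \<subseteq> r ` topspace X" by auto
    have "{x \<in> topspace X. r x \<in> \<Union>\<K>} = (\<Union>K\<in>\<K>. {x \<in> topspace X. r x \<in> K})" by auto
    then show "openin X {x \<in> topspace X. r x \<in> \<Union>\<K>}" using * by auto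
  qed
  then show ?thesis unfolding quotient_topology_def by (simp add: topology_inverse')
qed

subsection \<open>Geometric realization and weak homotopy equivalences\<close>

definition real_sum :: "'s sset \<Rightarrow> ((nat \<times> 's) \<times> (nat \<Rightarrow> real)) topology" where
  "real_sum S = sum_topology (\<lambda>(m, s). subtopology (powertop_real UNIV) (standard_simplex m))
                  {(m, s). s \<in> sx S m}"

definition simplex_push :: "nat \<Rightarrow> (nat \<Rightarrow> nat) \<Rightarrow> (nat \<Rightarrow> real) \<Rightarrow> nat \<Rightarrow> real" where
  "simplex_push m \<theta> t = (\<lambda>j. \<Sum>i | i \<le> m \<and> \<theta> i = j. t i)"

definition real_rel :: "'s sset \<Rightarrow> ((nat \<times> 's) \<times> (nat \<Rightarrow> real)) rel" where
  "real_rel S = {(((m, sact S m n \<theta> s), t), ((n, s), simplex_push m \<theta> t)) | m n \<theta> s t.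
     \<theta> \<in> simplex_hom m n \<and> s \<in> sx S n \<and> t \<in> standard_simplex m}"

definition real_cls :: "'s sset \<Rightarrow> (nat \<times> 's) \<times> (nat \<Rightarrow> real) \<Rightarrow> ((nat \<times> 's) \<times> (nat \<Rightarrow> real)) set" where
  "real_cls S = cls (topspace (real_sum S)) (real_rel S)"

definition realization :: "'s sset \<Rightarrow> ((nat \<times> 's) \<times> (nat \<Rightarrow> real)) set topology" where
  "realization S = quotient_topology (real_sum S) (real_cls S)"

definition realization_map ::
  "'t sset \<Rightarrow> (nat \<Rightarrow> 's \<Rightarrow> 't) \<Rightarrow>
   ((nat \<times> 's) \<times> (nat \<Rightarrow> real)) set \<Rightarrow> ((nat \<times> 't) \<times> (nat \<Rightarrow> real)) set" where
  "realization_map T g c = (case rep c of ((m, s), t) \<Rightarrow> real_cls T ((m, g m s), t))"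

definition top_cube :: "nat \<Rightarrow> (nat \<Rightarrow> real) topology" where
  "top_cube n = subtopology (powertop_real UNIV) {x. (\<forall>i<n. 0 \<le> x i \<and> x i \<le> 1) \<and> (\<forall>i\<ge>n. x i = 0)}"

definition const_on_boundary :: "nat \<Rightarrow> 'a \<Rightarrow> ((nat \<Rightarrow> real) \<Rightarrow> 'a) \<Rightarrow> bool" where
  "const_on_boundary n x h \<longleftrightarrow> (\<forall>u\<in>topspace (top_cube n). (\<exists>i<n. u i = 0 \<or> u i = 1) \<longrightarrow> h u = x)"

text \<open>\<open>\<pi>\<^sub>n(f, x) : \<pi>\<^sub>n(X, x) \<rightarrow> \<pi>\<^sub>n(Y, f x)\<close> is bijective.\<close>

definition pi_bij :: "nat \<Rightarrow> 'a topology \<Rightarrow> 'b topology \<Rightarrow> ('a \<Rightarrow> 'b) \<Rightarrow> 'a \<Rightarrow> bool" where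
  "pi_bij n X Y f x \<longleftrightarrow>
     (\<forall>g. continuous_map (top_cube n) Y g \<and> const_on_boundary n (f x) g \<longrightarrow>
        (\<exists>h. continuous_map (top_cube n) X h \<and> const_on_boundary n x h \<and>
             homotopic_with (const_on_boundary n (f x)) (top_cube n) Y (f \<circ> h) g)) \<and>
     (\<forall>h h'. continuous_map (top_cube n) X h \<and> const_on_boundary n x h \<and>
        continuous_map (top_cube n) X h' \<and> const_on_boundary n x h' \<and>
        homotopic_with (const_on_boundary n (f x)) (top_cube n) Y (f \<circ> h) (f \<circ> h') \<longrightarrow>
        homotopic_with (const_on_boundary n x) (top_cube n) X h h')"

definition weak_homotopy_equivalence :: "'a topology \<Rightarrow> 'b topology \<Rightarrow> ('a \<Rightarrow> 'b) \<Rightarrow> bool" where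
  "weak_homotopy_equivalence X Y f \<longleftrightarrow> continuous_map X Y f \<and>
     (\<forall>y\<in>topspace Y. \<exists>x\<in>topspace X. path_component_of Y (f x) y) \<and>
     (\<forall>x\<in>topspace X. \<forall>x'\<in>topspace X. path_component_of Y (f x) (f x') \<longrightarrow> path_component_of X x x') \<and>
     (\<forall>x\<in>topspace X. \<forall>n\<ge>1. pi_bij n X Y f x)"

definition sset_weq :: "'s sset \<Rightarrow> 't sset \<Rightarrow> (nat \<Rightarrow> 's \<Rightarrow> 't) \<Rightarrow> bool" where
  "sset_weq S T g \<longleftrightarrow> weak_homotopy_equivalence (realization S) (realization T) (realization_map T g)"

definition cub_weq :: "('a, 'z) cset_scheme \<Rightarrow> ('b, 'y) cset_scheme \<Rightarrow> (nat \<Rightarrow> 'a \<Rightarrow> 'b) \<Rightarrow> bool" where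
  "cub_weq K L f \<longleftrightarrow> cub_map K L f \<and> sset_weq (triang K) (triang L) (triang_map L f)"

definition contractible_cset :: "('a, 'z) cset_scheme \<Rightarrow> bool" where
  "contractible_cset K \<longleftrightarrow> cub_weq K (std_cube 0) (\<lambda>n _. (\<lambda>_\<in>cube n. []))"

definition acyclic_mono :: "'u set set \<Rightarrow> 'u cset \<Rightarrow> 'u cset \<Rightarrow> (nat \<Rightarrow> 'u \<Rightarrow> 'u) \<Rightarrow> bool" where
  "acyclic_mono U M N j \<longleftrightarrow> cubical_set M \<and> cubical_set N \<and>
     (\<forall>n. cell M n \<in> U \<and> cell N n \<in> U \<and> inj_on (j n) (cell M n)) \<and> cub_weq M N j"

text \<open>The (Kan) fibrations of the model structure: the right lifting property against acyclic
  cofibrations.\<close>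

definition cub_fibration :: "'u set set \<Rightarrow> ('a, 'z) cset_scheme \<Rightarrow> ('b, 'y) cset_scheme \<Rightarrow> (nat \<Rightarrow> 'a \<Rightarrow> 'b) \<Rightarrow> bool" where
  "cub_fibration U K L p \<longleftrightarrow> cub_map K L p \<and>
     (\<forall>M N j u v. acyclic_mono U M N j \<and> cub_map M K u \<and> cub_map N L v \<and>
        (\<forall>n. \<forall>x\<in>cell M n. p n (u n x) = v n (j n x)) \<longrightarrow>
        (\<exists>l. cub_map N K l \<and> (\<forall>n. \<forall>x\<in>cell M n. l n (j n x) = u n x) \<and>
             (\<forall>n. \<forall>x\<in>cell N n. p n (l n x) = v n x)))"

definition cub_fibrant :: "'u set set \<Rightarrow> ('a, 'z) cset_scheme \<Rightarrow> bool" where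
  "cub_fibrant U K \<longleftrightarrow> cub_fibration U K (std_cube 0) (\<lambda>n _. (\<lambda>_\<in>cube n. []))"

text \<open>The homotopy pullback of \<open>g : K \<rightarrow> B\<close> and \<open>p : E \<rightarrow> B\<close>; a path in \<open>B\<close> is an
  \<open>(n+1)\<close>-cell, with the last coordinate as parameter.\<close>

definition ho_pullback ::
  "('k, 'x) cset_scheme \<Rightarrow> ('b, 'y) cset_scheme \<Rightarrow> ('e, 'z) cset_scheme \<Rightarrow>
   (nat \<Rightarrow> 'k \<Rightarrow> 'b) \<Rightarrow> (nat \<Rightarrow> 'e \<Rightarrow> 'b) \<Rightarrow> ('k \<times> 'b \<times> 'e) cset" where
  "ho_pullback K B E g p =
     \<lparr>cell = (\<lambda>n. {(z, w, e). z \<in> cell K n \<and> w \<in> cell B (Suc n) \<and> e \<in> cell E n \<and>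
                res B n (Suc n) (coface n False n) w = g n z \<and>
                res B n (Suc n) (coface n True n) w = p n e}),
      res = (\<lambda>m n \<theta> (z, w, e). (res K m n \<theta> z,
                res B (Suc m) (Suc n) (box_tensor m 1 \<theta> (box_id 1)) w, res E m n \<theta> e))\<rparr>"

section \<open>Pointed cubical C*-spaces\<close>

record 'a cspace =
  val :: "calg \<Rightarrow> 'a pcset"
  amap :: "calg \<Rightarrow> calg \<Rightarrow> (real \<Rightarrow> real) \<Rightarrow> nat \<Rightarrow> 'a \<Rightarrow> 'a"

definition cspace :: "'a cspace \<Rightarrow> bool" where
  "cspace X \<longleftrightarrow> (\<forall>A\<in>CAlg. pointed_cubical_set (val X A)) \<and>
     (\<forall>A\<in>CAlg. \<forall>B\<in>CAlg. \<forall>f\<in>star_hom A B. cub_map (val X A) (val X B) (amap X A B f) \<and>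
        (\<forall>n. amap X A B f n (pt (val X A) n) = pt (val X B) n)) \<and>
     (\<forall>A\<in>CAlg. \<forall>n. \<forall>x\<in>cell (val X A) n. amap X A A (cs_id A) n x = x) \<and>
     (\<forall>A\<in>CAlg. \<forall>B\<in>CAlg. \<forall>D\<in>CAlg. \<forall>f\<in>star_hom A B. \<forall>g\<in>star_hom B D. \<forall>n. \<forall>x\<in>cell (val X A) n.
        amap X B D g n (amap X A B f n x) = amap X A D (compose (car A) g f) n x)"

definition small_cspace :: "'u set set \<Rightarrow> 'u cspace \<Rightarrow> bool" where
  "small_cspace U X \<longleftrightarrow> cspace X \<and> (\<forall>A\<in>CAlg. \<forall>n. cell (val X A) n \<in> U)"

text \<open>Maps are normalized to \<open>undefined\<close> outside the cells, so that equal maps are equal functions.\<close>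

definition cs_restrict :: "'a cspace \<Rightarrow> (calg \<Rightarrow> nat \<Rightarrow> 'a \<Rightarrow> 'b) \<Rightarrow> calg \<Rightarrow> nat \<Rightarrow> 'a \<Rightarrow> 'b" where
  "cs_restrict X g = (\<lambda>A n x. if A \<in> CAlg \<and> x \<in> cell (val X A) n then g A n x else undefined)"

definition cs_map :: "'a cspace \<Rightarrow> 'b cspace \<Rightarrow> (calg \<Rightarrow> nat \<Rightarrow> 'a \<Rightarrow> 'b) \<Rightarrow> bool" where
  "cs_map X Y g \<longleftrightarrow> cs_restrict X g = g \<and>
     (\<forall>A\<in>CAlg. cub_map (val X A) (val Y A) (g A) \<and> (\<forall>n. g A n (pt (val X A) n) = pt (val Y A) n)) \<and>
     (\<forall>A\<in>CAlg. \<forall>B\<in>CAlg. \<forall>f\<in>star_hom A B. \<forall>n. \<forall>x\<in>cell (val X A) n.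
        g B n (amap X A B f n x) = amap Y A B f n (g A n x))"

definition cs_smash :: "'a cspace \<Rightarrow> 'k pcset \<Rightarrow> (nat \<times> nat \<times> box \<times> 'a \<times> 'k) set cspace" where
  "cs_smash X K =
     \<lparr>val = (\<lambda>A. smash (val X A) K),
      amap = (\<lambda>A B f. smash_map (val X B) K (amap X A B f) (\<lambda>_ y. y))\<rparr>"

definition cs_lsmash :: "'k pcset \<Rightarrow> 'a cspace \<Rightarrow> (nat \<times> nat \<times> box \<times> 'k \<times> 'a) set cspace" where
  "cs_lsmash K X =
     \<lparr>val = (\<lambda>A. smash K (val X A)),
      amap = (\<lambda>A B f. smash_map K (val X B) (\<lambda>_ y. y) (amap X A B f))\<rparr>"

text \<open>The pointed functor represented by a C*-algebra: \<open>Hom(A, -)\<close>, discrete, pointed by the zero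
  maps.\<close>

definition repr :: "calg \<Rightarrow> (real \<Rightarrow> real) cspace" where
  "repr A =
     \<lparr>val = (\<lambda>B. \<lparr>cell = (\<lambda>_. star_hom A B), res = (\<lambda>_ _ _ f. f), pt = (\<lambda>_. zero_hom A B)\<rparr>),
      amap = (\<lambda>B D g n f. compose (car A) g f)\<rparr>"

text \<open>\<open>Hom(A, -)\<^sub>+ \<otimes> \<box>\<^sup>n\<^sub>+\<close>, which represents the evaluation \<open>X \<mapsto> X(A)\<^sub>n\<close>.\<close>

definition free_cell :: "calg \<Rightarrow> nat \<Rightarrow> ((real \<Rightarrow> real) \<times> box) option cspace" where
  "free_cell A n =
     \<lparr>val = (\<lambda>B. \<lparr>cell = (\<lambda>m. insert None (Some ` (star_hom A B \<times> box_hom m n))),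
                  res = (\<lambda>k m \<phi>. map_option (\<lambda>(h, \<theta>). (h, compose (cube k) \<theta> \<phi>))),
                  pt = (\<lambda>_. None)\<rparr>),
      amap = (\<lambda>B D g m. map_option (\<lambda>(h, \<theta>). (compose (car A) g h, \<theta>)))\<rparr>"

subsection \<open>Day convolution and internal function objects\<close>

text \<open>\<open>(X \<otimes> Y)(A)\<^sub>n\<close> is the coend over \<open>B, D, p, q\<close> of
  \<open>Hom(B \<otimes> D, A) \<times> \<box>(1\<^sup>n, 1\<^sup>p\<^sup>+\<^sup>q) \<times> X(B)\<^sub>p \<times> Y(D)\<^sub>q\<close>, with all tuples containing a basepoint of
  \<open>X\<close> or \<open>Y\<close> identified.\<close>

type_synonym ('x, 'y) day_tuple = "calg \<times> calg \<times> (real \<Rightarrow> real) \<times> nat \<times> nat \<times> box \<times> 'x \<times> 'y"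

definition day_pts :: "tensor_kind \<Rightarrow> 'x cspace \<Rightarrow> 'y cspace \<Rightarrow> calg \<Rightarrow> nat \<Rightarrow> ('x, 'y) day_tuple set" where
  "day_pts kd X Y A n = {(B, D, h, p, q, \<theta>, x, y). B \<in> CAlg \<and> D \<in> CAlg \<and> h \<in> star_hom (tob kd B D) A \<and>
     \<theta> \<in> box_hom n (p + q) \<and> x \<in> cell (val X B) p \<and> y \<in> cell (val Y D) q}"

definition day_rel :: "tensor_kind \<Rightarrow> 'x cspace \<Rightarrow> 'y cspace \<Rightarrow> calg \<Rightarrow> nat \<Rightarrow> ('x, 'y) day_tuple rel" where
  "day_rel kd X Y A n =
     {((B, D, compose (car (tob kd B D)) h (thom kd B D B' D' f g), p', q',
          compose (cube n) (box_tensor p q \<alpha> \<beta>) \<theta>, x, y),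
       (B', D', h, p, q, \<theta>, amap X B B' f p (res (val X B) p p' \<alpha> x),
          amap Y D D' g q (res (val Y D) q q' \<beta> y))) | B D B' D' f g h p p' q q' \<alpha> \<beta> \<theta> x y.
       B \<in> CAlg \<and> D \<in> CAlg \<and> B' \<in> CAlg \<and> D' \<in> CAlg \<and> f \<in> star_hom B B' \<and> g \<in> star_hom D D' \<and>
       h \<in> star_hom (tob kd B' D') A \<and> \<alpha> \<in> box_hom p p' \<and> \<beta> \<in> box_hom q q' \<and>
       \<theta> \<in> box_hom n (p + q) \<and> x \<in> cell (val X B) p' \<and> y \<in> cell (val Y D) q'}
     \<union> {((B, D, h, p, q, \<theta>, x, y), (B', D', h', p', q', \<theta>', x', y')) |
          B D h p q \<theta> x y B' D' h' p' q' \<theta>' x' y'.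
          (x = pt (val X B) p \<or> y = pt (val Y D) q) \<and> (x' = pt (val X B') p' \<or> y' = pt (val Y D') q')}"

definition day_cls :: "tensor_kind \<Rightarrow> 'x cspace \<Rightarrow> 'y cspace \<Rightarrow> calg \<Rightarrow> nat \<Rightarrow> ('x, 'y) day_tuple \<Rightarrow> ('x, 'y) day_tuple set" where
  "day_cls kd X Y A n = cls (day_pts kd X Y A n) (day_rel kd X Y A n)"

definition day :: "tensor_kind \<Rightarrow> 'x cspace \<Rightarrow> 'y cspace \<Rightarrow> ('x, 'y) day_tuple set cspace" where
  "day kd X Y =
     \<lparr>val = (\<lambda>A. \<lparr>cell = (\<lambda>n. quo (day_pts kd X Y A n) (day_rel kd X Y A n)),
                  res = (\<lambda>m n \<phi> c. case rep c of (B, D, h, p, q, \<theta>, x, y) \<Rightarrow>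
                           day_cls kd X Y A m (B, D, h, p, q, compose (cube m) \<theta> \<phi>, x, y)),
                  pt = (\<lambda>n. day_cls kd X Y A n (A, A, zero_hom (tob kd A A) A, n, 0, box_id n,
                           pt (val X A) n, pt (val Y A) 0))\<rparr>),
      amap = (\<lambda>A A' f n c. case rep c of (B, D, h, p, q, \<theta>, x, y) \<Rightarrow>
                day_cls kd X Y A' n (B, D, compose (car (tob kd B D)) f h, p, q, \<theta>, x, y))\<rparr>"

text \<open>The map \<open>X \<otimes> g : X \<otimes> Y \<rightarrow> X \<otimes> Y'\<close>.\<close>

definition day_rmap ::
  "tensor_kind \<Rightarrow> 'x cspace \<Rightarrow> 'z cspace \<Rightarrow> (calg \<Rightarrow> nat \<Rightarrow> 'y \<Rightarrow> 'z) \<Rightarrow>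
   calg \<Rightarrow> nat \<Rightarrow> ('x, 'y) day_tuple set \<Rightarrow> ('x, 'z) day_tuple set" where
  "day_rmap kd X Y' g A n c = (case rep c of (B, D, h, p, q, \<theta>, x, y) \<Rightarrow>
     day_cls kd X Y' A n (B, D, h, p, q, \<theta>, x, g D q y))"

text \<open>The right adjoint of \<open>X \<otimes> -\<close>, with
  \<open>\<underline>Hom(X, Y)(A)\<^sub>n\<close> the set of maps \<open>X \<otimes> (Hom(A, -)\<^sub>+ \<otimes> \<box>\<^sup>n\<^sub>+) \<rightarrow> Y\<close>.\<close>

definition ihom :: "tensor_kind \<Rightarrow> 'x cspace \<Rightarrow> 'y cspace \<Rightarrow>
    (calg \<Rightarrow> nat \<Rightarrow> ('x, ((real \<Rightarrow> real) \<times> box) option) day_tuple set \<Rightarrow> 'y) cspace" where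
  "ihom kd X Y =
     \<lparr>val = (\<lambda>A. \<lparr>cell = (\<lambda>n. {g. cs_map (day kd X (free_cell A n)) Y g}),
                  res = (\<lambda>m n \<theta> g. cs_restrict (day kd X (free_cell A m)) (\<lambda>B k c.
                           g B k (day_rmap kd X (free_cell A n)
                                    (\<lambda>_ l. map_option (\<lambda>(h, \<phi>). (h, compose (cube l) \<theta> \<phi>))) B k c))),
                  pt = (\<lambda>n. cs_restrict (day kd X (free_cell A n)) (\<lambda>B k c. pt (val Y B) k))\<rparr>),
      amap = (\<lambda>A A' f n g. cs_restrict (day kd X (free_cell A' n)) (\<lambda>B k c.
                g B k (day_rmap kd X (free_cell A n)
                         (\<lambda>_ _. map_option (\<lambda>(h, \<phi>). (compose (car A) h f, \<phi>))) B k c)))\<rparr>"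

subsection \<open>The homotopy invariant projective model structure\<close>

definition cs_acyclic_fibration :: "'u set set \<Rightarrow> 'x cspace \<Rightarrow> 'y cspace \<Rightarrow> (calg \<Rightarrow> nat \<Rightarrow> 'x \<Rightarrow> 'y) \<Rightarrow> bool" where
  "cs_acyclic_fibration U X Y p \<longleftrightarrow> cs_map X Y p \<and>
     (\<forall>A\<in>CAlg. cub_fibration U (val X A) (val Y A) (p A) \<and> cub_weq (val X A) (val Y A) (p A))"

text \<open>The left lifting property of \<open>* \<rightarrow> X\<close>.\<close>

definition cs_cofibrant :: "'u set set \<Rightarrow> 'u cspace \<Rightarrow> bool" where
  "cs_cofibrant U X \<longleftrightarrow> (\<forall>(Z::'u cspace) (W::'u cspace) p g.
     small_cspace U Z \<and> small_cspace U W \<and> cs_acyclic_fibration U Z W p \<and> cs_map X W g \<longrightarrow>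
     (\<exists>l. cs_map X Z l \<and> (\<forall>A\<in>CAlg. \<forall>n. \<forall>x\<in>cell (val X A) n. p A n (l A n x) = g A n x)))"

definition hom_cx :: "'x cspace \<Rightarrow> 'y cspace \<Rightarrow>
    (calg \<Rightarrow> nat \<Rightarrow> (nat \<times> nat \<times> box \<times> 'x \<times> box option) set \<Rightarrow> 'y) cset" where
  "hom_cx X Y =
     \<lparr>cell = (\<lambda>n. {g. cs_map (cs_smash X (cube_plus n)) Y g}),
      res = (\<lambda>m n \<theta> g. cs_restrict (cs_smash X (cube_plus m)) (\<lambda>A k c.
               g A k (smash_map (val X A) (cube_plus n) (\<lambda>_ x. x) (cube_plus_map \<theta>) k c)))\<rparr>"

definition hom_cx_pull :: "'w cspace \<Rightarrow> 'x cspace \<Rightarrow> (calg \<Rightarrow> nat \<Rightarrow> 'w \<Rightarrow> 'x) \<Rightarrow> nat \<Rightarrow>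
    (calg \<Rightarrow> nat \<Rightarrow> (nat \<times> nat \<times> box \<times> 'x \<times> box option) set \<Rightarrow> 'y) \<Rightarrow>
    (calg \<Rightarrow> nat \<Rightarrow> (nat \<times> nat \<times> box \<times> 'w \<times> box option) set \<Rightarrow> 'y)" where
  "hom_cx_pull W X f n g = cs_restrict (cs_smash W (cube_plus n)) (\<lambda>A k c.
     g A k (smash_map (val X A) (cube_plus n) (f A) (\<lambda>_ y. y) k c))"

definition exact_cspace :: "tensor_kind \<Rightarrow> 'u cspace \<Rightarrow> bool" where
  "exact_cspace kd Z \<longleftrightarrow> contractible_cset (val Z zero_alg) \<and>
     (\<forall>A E B i p. short_exact kd A E B i p \<longrightarrow>
        cub_weq (val Z A)
          (ho_pullback (val Z zero_alg) (val Z B) (val Z E)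
             (amap Z zero_alg B (zero_hom zero_alg B)) (amap Z E B p))
          (\<lambda>n a. (amap Z A zero_alg (zero_hom A zero_alg) n a,
                  res (val Z B) (Suc n) n (codegen n n) (amap Z A B (zero_hom A B) n a),
                  amap Z A E i n a)))"

definition corner :: "tensor_kind \<Rightarrow> calg \<Rightarrow> real \<Rightarrow> real" where
  "corner kd A = (\<lambda>a\<in>car A. tel kd A (real_copy compact_ops) a (copy_iso compact_ops rank_one_proj))"

definition const_paths :: "calg \<Rightarrow> real \<Rightarrow> real" where
  "const_paths A = (\<lambda>a\<in>car A. copy_iso (CI A) (\<lambda>t\<in>{0..1}. a))"

definition cs_fibrant :: "tensor_kind \<Rightarrow> 'u set set \<Rightarrow> 'u cspace \<Rightarrow> bool" where
  "cs_fibrant kd U Z \<longleftrightarrow> small_cspace U Z \<and> (\<forall>A\<in>CAlg. cub_fibrant U (val Z A)) \<and> exact_cspace kd Z \<and>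
     (\<forall>A\<in>CAlg.
        cub_weq (val Z A) (val Z (tob kd A (real_copy compact_ops)))
          (amap Z A (tob kd A (real_copy compact_ops)) (corner kd A)) \<and>
        cub_weq (val Z A) (val Z (real_copy (CI A))) (amap Z A (real_copy (CI A)) (const_paths A)))"

definition cs_weq :: "tensor_kind \<Rightarrow> 'u set set \<Rightarrow> 'x cspace \<Rightarrow> 'y cspace \<Rightarrow> (calg \<Rightarrow> nat \<Rightarrow> 'x \<Rightarrow> 'y) \<Rightarrow> bool" where
  "cs_weq kd U X Y f \<longleftrightarrow> cs_map X Y f \<and> (\<exists>(QX::'u cspace) (QY::'u cspace) u v g.
     small_cspace U QX \<and> small_cspace U QY \<and> cs_cofibrant U QX \<and> cs_cofibrant U QY \<and>
     cs_acyclic_fibration U QX X u \<and> cs_acyclic_fibration U QY Y v \<and> cs_map QX QY g \<and>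
     (\<forall>A\<in>CAlg. \<forall>n. \<forall>x\<in>cell (val QX A) n. v A n (g A n x) = f A n (u A n x)) \<and>
     (\<forall>Z::'u cspace. cs_fibrant kd U Z \<longrightarrow>
        cub_weq (hom_cx QY Z) (hom_cx QX Z) (hom_cx_pull QX QY g)))"

section \<open>Cubical C*-spectra\<close>

type_synonym ccell = "(nat \<times> nat \<times> box \<times> box option \<times> (real \<Rightarrow> real)) set"

definition Ccirc :: "ccell cspace" where
  "Ccirc = cs_lsmash circle (repr (real_copy (C0 (UNIV::real set))))"

record 'x spec =
  lev :: "nat \<Rightarrow> 'x cspace"
  str :: "nat \<Rightarrow> calg \<Rightarrow> nat \<Rightarrow> (ccell, 'x) day_tuple set \<Rightarrow> 'x"

definition spectrum :: "tensor_kind \<Rightarrow> 'u set set \<Rightarrow> 'u spec \<Rightarrow> bool" where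
  "spectrum kd U E \<longleftrightarrow> (\<forall>n. small_cspace U (lev E n) \<and>
     cs_map (day kd Ccirc (lev E n)) (lev E (Suc n)) (str E n))"

definition sp_map :: "tensor_kind \<Rightarrow> 'x spec \<Rightarrow> 'y spec \<Rightarrow> (nat \<Rightarrow> calg \<Rightarrow> nat \<Rightarrow> 'x \<Rightarrow> 'y) \<Rightarrow> bool" where
  "sp_map kd E F f \<longleftrightarrow> (\<forall>n. cs_map (lev E n) (lev F n) (f n)) \<and>
     (\<forall>n. \<forall>A\<in>CAlg. \<forall>k. \<forall>c\<in>cell (val (day kd Ccirc (lev E n)) A) k.
        f (Suc n) A k (str E n A k c) = str F n A k (day_rmap kd Ccirc (lev F n) (f n) A k c))"

text \<open>The levelwise product \<open>E \<otimes> K\<close> with a pointed cubical set, with structure maps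
  \<open>C \<otimes> (E\<^sub>n \<otimes> K) \<cong> (C \<otimes> E\<^sub>n) \<otimes> K \<rightarrow> E\<^sub>n\<^sub>+\<^sub>1 \<otimes> K\<close>.  The product of cubical sets not being symmetric,
  cubical sets act on the side that is used in the function complexes.\<close>

definition sp_smash :: "tensor_kind \<Rightarrow> 'x spec \<Rightarrow> 'k pcset \<Rightarrow> (nat \<times> nat \<times> box \<times> 'x \<times> 'k) set spec" where
  "sp_smash kd E K =
     \<lparr>lev = (\<lambda>n. cs_smash (lev E n) K),
      str = (\<lambda>n. cs_restrict (day kd Ccirc (cs_smash (lev E n) K)) (\<lambda>A k t.
        case rep t of (B, D, h, p, q, \<theta>, c, y) \<Rightarrow>
        case rep y of (a, b, \<psi>, x, l) \<Rightarrow>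
          smash_cls (val (lev E (Suc n)) A) K k
            (p + a, b, compose (cube k) (box_tensor p q (box_id p) \<psi>) \<theta>,
             str E n A (p + a) (day_cls kd Ccirc (lev E n) A (p + a) (B, D, h, p, a, box_id (p + a), c, x)),
             l)))\<rparr>"

subsection \<open>The stable model structure\<close>

text \<open>Acyclic fibrations of cubical C*-spaces are the maps with the right lifting property against
  cofibrations, i.e. the pointwise acyclic Kan fibrations.\<close>

definition sp_acyclic_fibration :: "tensor_kind \<Rightarrow> 'u set set \<Rightarrow> 'u spec \<Rightarrow> 'u spec \<Rightarrow> (nat \<Rightarrow> calg \<Rightarrow> nat \<Rightarrow> 'u \<Rightarrow> 'u) \<Rightarrow> bool" where
  "sp_acyclic_fibration kd U E F p \<longleftrightarrow> sp_map kd E F p \<and> (\<forall>n. cs_acyclic_fibration U (lev E n) (lev F n) (p n))"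

definition sp_cofibrant :: "tensor_kind \<Rightarrow> 'u set set \<Rightarrow> 'u spec \<Rightarrow> bool" where
  "sp_cofibrant kd U E \<longleftrightarrow> (\<forall>(Z::'u spec) (W::'u spec) p g.
     spectrum kd U Z \<and> spectrum kd U W \<and> sp_acyclic_fibration kd U Z W p \<and> sp_map kd E W g \<longrightarrow>
     (\<exists>l. sp_map kd E Z l \<and>
        (\<forall>n. \<forall>A\<in>CAlg. \<forall>k. \<forall>x\<in>cell (val (lev E n) A) k. p n A k (l n A k x) = g n A k x)))"

definition sp_hom_cx :: "tensor_kind \<Rightarrow> 'x spec \<Rightarrow> 'y spec \<Rightarrow>
    (nat \<Rightarrow> calg \<Rightarrow> nat \<Rightarrow> (nat \<times> nat \<times> box \<times> 'x \<times> box option) set \<Rightarrow> 'y) cset" where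
  "sp_hom_cx kd E F =
     \<lparr>cell = (\<lambda>n. {g. sp_map kd (sp_smash kd E (cube_plus n)) F g}),
      res = (\<lambda>m n \<theta> g k. res (hom_cx (lev E k) (lev F k)) m n \<theta> (g k))\<rparr>"

text \<open>The adjoint \<open>Z\<^sub>n \<rightarrow> \<underline>Hom(C, Z\<^sub>n\<^sub>+\<^sub>1)\<close> of a structure map: a cell \<open>z\<close> of \<open>Z\<^sub>n\<close> goes to the
  composite of the structure map with \<open>C \<otimes> -\<close> of the Yoneda map of \<open>z\<close>.\<close>

definition yoneda :: "'x cspace \<Rightarrow> calg \<Rightarrow> nat \<Rightarrow> 'x \<Rightarrow> calg \<Rightarrow> nat \<Rightarrow> ((real \<Rightarrow> real) \<times> box) option \<Rightarrow> 'x" where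
  "yoneda X A k z B m u = (case u of None \<Rightarrow> pt (val X B) m
     | Some (h, \<theta>) \<Rightarrow> amap X A B h m (res (val X A) m k \<theta> z))"

definition adj_str :: "tensor_kind \<Rightarrow> 'x spec \<Rightarrow> nat \<Rightarrow> calg \<Rightarrow> nat \<Rightarrow> 'x \<Rightarrow>
    (calg \<Rightarrow> nat \<Rightarrow> (ccell, ((real \<Rightarrow> real) \<times> box) option) day_tuple set \<Rightarrow> 'x)" where
  "adj_str kd Z n = cs_restrict (lev Z n) (\<lambda>A k z. cs_restrict (day kd Ccirc (free_cell A k)) (\<lambda>B m c.
     str Z n B m (day_rmap kd Ccirc (lev Z n) (yoneda (lev Z n) A k z) B m c)))"

definition sp_fibrant :: "tensor_kind \<Rightarrow> 'u set set \<Rightarrow> 'u spec \<Rightarrow> bool" where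
  "sp_fibrant kd U Z \<longleftrightarrow> spectrum kd U Z \<and> (\<forall>n. cs_fibrant kd U (lev Z n) \<and>
     cs_weq kd U (lev Z n) (ihom kd Ccirc (lev Z (Suc n))) (adj_str kd Z n))"

definition sp_weq :: "tensor_kind \<Rightarrow> 'u set set \<Rightarrow> 'u spec \<Rightarrow> 'u spec \<Rightarrow> (nat \<Rightarrow> calg \<Rightarrow> nat \<Rightarrow> 'u \<Rightarrow> 'u) \<Rightarrow> bool" where
  "sp_weq kd U E F f \<longleftrightarrow> sp_map kd E F f \<and> (\<exists>QE QF u v g.
     spectrum kd U QE \<and> spectrum kd U QF \<and> sp_cofibrant kd U QE \<and> sp_cofibrant kd U QF \<and>
     sp_acyclic_fibration kd U QE E u \<and> sp_acyclic_fibration kd U QF F v \<and> sp_map kd QE QF g \<and>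
     (\<forall>n. \<forall>A\<in>CAlg. \<forall>k. \<forall>x\<in>cell (val (lev QE n) A) k. v n A k (g n A k x) = f n A k (u n A k x)) \<and>
     (\<forall>Z. sp_fibrant kd U Z \<longrightarrow>
        cub_weq (sp_hom_cx kd QF Z) (sp_hom_cx kd QE Z)
          (\<lambda>n h k. hom_cx_pull (lev QE k) (lev QF k) (g k) n (h k))))"

text \<open>\<open>G\<close> is \<open>Fr\<^sub>m W\<close>, by the universal property of the left adjoint of \<open>E \<mapsto> E\<^sub>m\<close>.\<close>

definition is_free_spec :: "tensor_kind \<Rightarrow> 'u set set \<Rightarrow> nat \<Rightarrow> 'w cspace \<Rightarrow> 'u spec \<Rightarrow> bool" where
  "is_free_spec kd U m W G \<longleftrightarrow> spectrum kd U G \<and> (\<exists>\<eta>. cs_map W (lev G m) \<eta> \<and>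
     (\<forall>E g. spectrum kd U E \<and> cs_map W (lev E m) g \<longrightarrow>
        (\<exists>!f. sp_map kd G E f \<and>
           (\<forall>A\<in>CAlg. \<forall>n. \<forall>x\<in>cell (val W A) n. f m A n (\<eta> A n x) = g A n x))))"

subsection \<open>Isomorphic copies in the universe\<close>

definition cs_enc :: "'u set set \<Rightarrow> 'a cspace \<Rightarrow> calg \<Rightarrow> nat \<Rightarrow> 'a \<Rightarrow> 'u" where
  "cs_enc U X A n = enc U (cell (val X A) n)"

definition cs_dec :: "'u set set \<Rightarrow> 'a cspace \<Rightarrow> calg \<Rightarrow> nat \<Rightarrow> 'u \<Rightarrow> 'a" where
  "cs_dec U X A n = dec U (cell (val X A) n)"

definition cs_code :: "'u set set \<Rightarrow> 'a cspace \<Rightarrow> 'u cspace" where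
  "cs_code U X =
     \<lparr>val = (\<lambda>A. pcode U (val X A)),
      amap = (\<lambda>A B f n y. cs_enc U X B n (amap X A B f n (cs_dec U X A n y)))\<rparr>"

definition sp_code :: "tensor_kind \<Rightarrow> 'u set set \<Rightarrow> 'a spec \<Rightarrow> 'u spec" where
  "sp_code kd U E =
     \<lparr>lev = (\<lambda>n. cs_code U (lev E n)),
      str = (\<lambda>n. cs_restrict (day kd Ccirc (cs_code U (lev E n))) (\<lambda>A k c.
        cs_enc U (lev E (Suc n)) A k
          (str E n A k (day_rmap kd Ccirc (lev E n) (cs_dec U (lev E n)) A k c))))\<rparr>"

section \<open>Categories\<close>

record ('o, 'm) cat =
  Obj :: "'o set"
  Arr :: "'m set"
  Dom :: "'m \<Rightarrow> 'o"
  Cod :: "'m \<Rightarrow> 'o"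
  Idn :: "'o \<Rightarrow> 'm"
  Cmp :: "'m \<Rightarrow> 'm \<Rightarrow> 'm"

definition Hom :: "('o, 'm, 'z) cat_scheme \<Rightarrow> 'o \<Rightarrow> 'o \<Rightarrow> 'm set" where
  "Hom C a b = {f \<in> Arr C. Dom C f = a \<and> Cod C f = b}"

definition is_category :: "('o, 'm, 'z) cat_scheme \<Rightarrow> bool" where
  "is_category C \<longleftrightarrow> (\<forall>f\<in>Arr C. Dom C f \<in> Obj C \<and> Cod C f \<in> Obj C) \<and>
     (\<forall>a\<in>Obj C. Idn C a \<in> Hom C a a) \<and>
     (\<forall>f\<in>Arr C. \<forall>g\<in>Arr C. Cod C f = Dom C g \<longrightarrow> Cmp C g f \<in> Hom C (Dom C f) (Cod C g)) \<and>
     (\<forall>f\<in>Arr C. Cmp C f (Idn C (Dom C f)) = f \<and> Cmp C (Idn C (Cod C f)) f = f) \<and>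
     (\<forall>f\<in>Arr C. \<forall>g\<in>Arr C. \<forall>h\<in>Arr C. Cod C f = Dom C g \<and> Cod C g = Dom C h \<longrightarrow>
        Cmp C h (Cmp C g f) = Cmp C (Cmp C h g) f)"

definition is_iso :: "('o, 'm, 'z) cat_scheme \<Rightarrow> 'm \<Rightarrow> bool" where
  "is_iso C f \<longleftrightarrow> f \<in> Arr C \<and> (\<exists>g\<in>Hom C (Cod C f) (Dom C f).
     Cmp C g f = Idn C (Dom C f) \<and> Cmp C f g = Idn C (Cod C f))"

definition zero_obj :: "('o, 'm, 'z) cat_scheme \<Rightarrow> 'o \<Rightarrow> bool" where
  "zero_obj C z \<longleftrightarrow> z \<in> Obj C \<and> (\<forall>a\<in>Obj C. (\<exists>!f. f \<in> Hom C a z) \<and> (\<exists>!f. f \<in> Hom C z a))"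

definition zero_arr :: "('o, 'm, 'z) cat_scheme \<Rightarrow> 'm \<Rightarrow> bool" where
  "zero_arr C f \<longleftrightarrow> f \<in> Arr C \<and> (\<exists>z g h. zero_obj C z \<and> g \<in> Hom C (Dom C f) z \<and>
     h \<in> Hom C z (Cod C f) \<and> f = Cmp C h g)"

definition is_pushout :: "('o, 'm, 'z) cat_scheme \<Rightarrow> 'm \<Rightarrow> 'm \<Rightarrow> 'm \<Rightarrow> 'm \<Rightarrow> bool" where
  "is_pushout C f g i k \<longleftrightarrow> f \<in> Arr C \<and> g \<in> Hom C (Dom C f) (Cod C g) \<and> i \<in> Hom C (Cod C f) (Cod C i) \<and>
     k \<in> Hom C (Cod C g) (Cod C i) \<and> Cmp C i f = Cmp C k g \<and>
     (\<forall>u v. u \<in> Arr C \<and> v \<in> Arr C \<and> Dom C u = Cod C f \<and> Dom C v = Cod C g \<and> Cod C u = Cod C v \<and>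
        Cmp C u f = Cmp C v g \<longrightarrow>
        (\<exists>!w. w \<in> Hom C (Cod C i) (Cod C u) \<and> Cmp C w i = u \<and> Cmp C w k = v))"

definition is_coproduct :: "('o, 'm, 'z) cat_scheme \<Rightarrow> 'i set \<Rightarrow> ('i \<Rightarrow> 'o) \<Rightarrow> 'o \<Rightarrow> bool" where
  "is_coproduct C I x c \<longleftrightarrow> c \<in> Obj C \<and> (\<exists>j. (\<forall>i\<in>I. j i \<in> Hom C (x i) c) \<and>
     (\<forall>d\<in>Obj C. \<forall>g. (\<forall>i\<in>I. g i \<in> Hom C (x i) d) \<longrightarrow>
        (\<exists>!h. h \<in> Hom C c d \<and> (\<forall>i\<in>I. Cmp C h (j i) = g i))))"

text \<open>A functor is given by its values on objects and on arrows.\<close>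

type_synonym ('o, 'm, 'p, 'n) func = "('o \<Rightarrow> 'p) \<times> ('m \<Rightarrow> 'n)"

definition is_functor :: "('o, 'm, 'z) cat_scheme \<Rightarrow> ('p, 'n, 'y) cat_scheme \<Rightarrow> ('o, 'm, 'p, 'n) func \<Rightarrow> bool" where
  "is_functor C D F \<longleftrightarrow> is_category C \<and> is_category D \<and> (\<forall>a\<in>Obj C. fst F a \<in> Obj D) \<and>
     (\<forall>f\<in>Arr C. snd F f \<in> Hom D (fst F (Dom C f)) (fst F (Cod C f))) \<and>
     (\<forall>a\<in>Obj C. snd F (Idn C a) = Idn D (fst F a)) \<and>
     (\<forall>f\<in>Arr C. \<forall>g\<in>Arr C. Cod C f = Dom C g \<longrightarrow> snd F (Cmp C g f) = Cmp D (snd F g) (snd F f))"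

definition fcomp :: "('p, 'n, 'q, 'l) func \<Rightarrow> ('o, 'm, 'p, 'n) func \<Rightarrow> ('o, 'm, 'q, 'l) func" where
  "fcomp G F = (fst G \<circ> fst F, snd G \<circ> snd F)"

definition incl :: "('o, 'm, 'o, 'm) func" where
  "incl = (\<lambda>a. a, \<lambda>f. f)"

definition nat_trans :: "('o, 'm, 'z) cat_scheme \<Rightarrow> ('p, 'n, 'y) cat_scheme \<Rightarrow>
    ('o, 'm, 'p, 'n) func \<Rightarrow> ('o, 'm, 'p, 'n) func \<Rightarrow> ('o \<Rightarrow> 'n) \<Rightarrow> bool" where
  "nat_trans C D F G \<eta> \<longleftrightarrow> (\<forall>a\<in>Obj C. \<eta> a \<in> Hom D (fst F a) (fst G a)) \<and>
     (\<forall>f\<in>Arr C. Cmp D (\<eta> (Cod C f)) (snd F f) = Cmp D (snd G f) (\<eta> (Dom C f)))"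

definition nat_iso :: "('o, 'm, 'z) cat_scheme \<Rightarrow> ('p, 'n, 'y) cat_scheme \<Rightarrow>
    ('o, 'm, 'p, 'n) func \<Rightarrow> ('o, 'm, 'p, 'n) func \<Rightarrow> ('o \<Rightarrow> 'n) \<Rightarrow> bool" where
  "nat_iso C D F G \<eta> \<longleftrightarrow> nat_trans C D F G \<eta> \<and> (\<forall>a\<in>Obj C. is_iso D (\<eta> a))"

text \<open>\<open>G\<close> is right adjoint to \<open>F : D \<rightarrow> C\<close> with counit \<open>\<epsilon>\<close>.\<close>

definition right_adjoint :: "('o, 'm, 'z) cat_scheme \<Rightarrow> ('p, 'n, 'y) cat_scheme \<Rightarrow>
    ('o, 'm, 'p, 'n) func \<Rightarrow> ('p, 'n, 'o, 'm) func \<Rightarrow> ('p \<Rightarrow> 'n) \<Rightarrow> bool" where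
  "right_adjoint D C F G \<epsilon> \<longleftrightarrow> is_functor D C F \<and> is_functor C D G \<and>
     nat_trans C C (fcomp F G) incl \<epsilon> \<and>
     (\<forall>a\<in>Obj D. \<forall>b\<in>Obj C. \<forall>f\<in>Hom C (fst F a) b.
        \<exists>!g. g \<in> Hom D a (fst G b) \<and> Cmp C (\<epsilon> b) (snd F g) = f)"

subsection \<open>Localization of a category\<close>

text \<open>Arrows of the localization are classes of zigzags of composable arrows and formally inverted
  members of \<open>W\<close>; lists are read from the source to the target.\<close>

datatype 'm step = Fwd 'm | Bwd 'm

fun zigzag :: "('o, 'm, 'z) cat_scheme \<Rightarrow> 'm set \<Rightarrow> 'o \<Rightarrow> 'm step list \<Rightarrow> 'o \<Rightarrow> bool" where
  "zigzag C W a [] b \<longleftrightarrow> a \<in> Obj C \<and> a = b"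
| "zigzag C W a (Fwd f # l) b \<longleftrightarrow> f \<in> Arr C \<and> Dom C f = a \<and> zigzag C W (Cod C f) l b"
| "zigzag C W a (Bwd w # l) b \<longleftrightarrow> w \<in> W \<and> Cod C w = a \<and> zigzag C W (Dom C w) l b"

definition zz_basic :: "('o, 'm, 'z) cat_scheme \<Rightarrow> 'm set \<Rightarrow> 'm step list rel" where
  "zz_basic C W =
     {([Fwd f, Fwd g], [Fwd (Cmp C g f)]) | f g. f \<in> Arr C \<and> g \<in> Arr C \<and> Cod C f = Dom C g} \<union>
     {([Fwd (Idn C a)], []) | a. a \<in> Obj C} \<union>
     {([Fwd w, Bwd w], []) | w. w \<in> W} \<union>
     {([Bwd w, Fwd w], []) | w. w \<in> W}"

definition zz_cls :: "('o, 'm, 'z) cat_scheme \<Rightarrow> 'm set \<Rightarrow> 'o \<Rightarrow> 'o \<Rightarrow> 'm step list \<Rightarrow> 'm step list set" where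
  "zz_cls C W a b = cls {l. zigzag C W a l b} {(u @ x @ v, u @ y @ v) | u v x y. (x, y) \<in> zz_basic C W}"

type_synonym ('o, 'm) larr = "'o \<times> 'm step list set \<times> 'o"

definition localization :: "('o, 'm, 'z) cat_scheme \<Rightarrow> 'm set \<Rightarrow> ('o, ('o, 'm) larr) cat" where
  "localization C W =
     \<lparr>Obj = Obj C,
      Arr = {(a, zz_cls C W a b l, b) | a b l. zigzag C W a l b},
      Dom = fst,
      Cod = (\<lambda>f. snd (snd f)),
      Idn = (\<lambda>a. (a, zz_cls C W a a [], a)),
      Cmp = (\<lambda>(b, t, d) (a, s, b'). (a, zz_cls C W a d (rep s @ rep t), d))\<rparr>"

definition loc_arr :: "('o, 'm, 'z) cat_scheme \<Rightarrow> 'm set \<Rightarrow> 'm \<Rightarrow> ('o, 'm) larr" where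
  "loc_arr C W f = (Dom C f, zz_cls C W (Dom C f) (Cod C f) [Fwd f], Cod C f)"

text \<open>The functor induced on the localization by an endofunctor preserving \<open>W\<close>.\<close>

definition loc_functor :: "('o, 'm, 'z) cat_scheme \<Rightarrow> 'm set \<Rightarrow> ('o, 'm, 'o, 'm) func \<Rightarrow>
    ('o, ('o, 'm) larr, 'o, ('o, 'm) larr) func" where
  "loc_functor C W F = (fst F, \<lambda>(a, s, b).
     (fst F a, zz_cls C W (fst F a) (fst F b) (map (map_step (snd F)) (rep s)), fst F b))"

subsection \<open>Triangulated categories\<close>

definition hom_group :: "('o, 'm, 'z) cat_scheme \<Rightarrow> ('m \<Rightarrow> 'm \<Rightarrow> 'm) \<Rightarrow> 'o \<Rightarrow> 'o \<Rightarrow> 'm monoid" where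
  "hom_group C pl a b = \<lparr>carrier = Hom C a b, monoid.mult = pl, one = (THE f. f \<in> Hom C a b \<and> zero_arr C f)\<rparr>"

definition preadditive :: "('o, 'm, 'z) cat_scheme \<Rightarrow> ('m \<Rightarrow> 'm \<Rightarrow> 'm) \<Rightarrow> bool" where
  "preadditive C pl \<longleftrightarrow> is_category C \<and> (\<forall>a\<in>Obj C. \<forall>b\<in>Obj C. comm_group (hom_group C pl a b)) \<and>
     (\<forall>a\<in>Obj C. \<forall>b\<in>Obj C. \<forall>c\<in>Obj C. \<forall>f\<in>Hom C a b. \<forall>f'\<in>Hom C a b. \<forall>g\<in>Hom C b c. \<forall>g'\<in>Hom C b c.
        Cmp C g (pl f f') = pl (Cmp C g f) (Cmp C g f') \<and>
        Cmp C (pl g g') f = pl (Cmp C g f) (Cmp C g' f))"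

definition additive_category :: "('o, 'm, 'z) cat_scheme \<Rightarrow> bool" where
  "additive_category C \<longleftrightarrow> (\<exists>z. zero_obj C z) \<and> (\<exists>pl. preadditive C pl \<and>
     (\<forall>a\<in>Obj C. \<forall>b\<in>Obj C. \<exists>c\<in>Obj C. \<exists>i1\<in>Hom C a c. \<exists>i2\<in>Hom C b c. \<exists>p1\<in>Hom C c a. \<exists>p2\<in>Hom C c b.
        Cmp C p1 i1 = Idn C a \<and> Cmp C p2 i2 = Idn C b \<and>
        zero_arr C (Cmp C p1 i2) \<and> zero_arr C (Cmp C p2 i1) \<and>
        pl (Cmp C i1 p1) (Cmp C i2 p2) = Idn C c))"

text \<open>The addition of parallel arrows of an additive category is unique.\<close>

definition hom_plus :: "('o, 'm, 'z) cat_scheme \<Rightarrow> 'm \<Rightarrow> 'm \<Rightarrow> 'm" where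
  "hom_plus C = (SOME pl. preadditive C pl)"

definition hom_neg :: "('o, 'm, 'z) cat_scheme \<Rightarrow> 'm \<Rightarrow> 'm" where
  "hom_neg C f = m_inv (hom_group C (hom_plus C) (Dom C f) (Cod C f)) f"

definition additive_functor :: "('o, 'm, 'z) cat_scheme \<Rightarrow> ('p, 'n, 'y) cat_scheme \<Rightarrow> ('o, 'm, 'p, 'n) func \<Rightarrow> bool" where
  "additive_functor C D F \<longleftrightarrow> is_functor C D F \<and>
     (\<forall>f\<in>Arr C. \<forall>g\<in>Arr C. Dom C f = Dom C g \<and> Cod C f = Cod C g \<longrightarrow>
        snd F (hom_plus C f g) = hom_plus D (snd F f) (snd F g))"

record ('o, 'm) tcat = "('o, 'm) cat" +
  Shift :: "('o, 'm, 'o, 'm) func"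
  Dist :: "('m \<times> 'm \<times> 'm) set"

definition is_triangle :: "('o, 'm, 'z) cat_scheme \<Rightarrow> ('o, 'm, 'o, 'm) func \<Rightarrow> 'm \<times> 'm \<times> 'm \<Rightarrow> bool" where
  "is_triangle C S = (\<lambda>(f, g, h). f \<in> Arr C \<and> g \<in> Arr C \<and> h \<in> Arr C \<and>
     Cod C f = Dom C g \<and> Cod C g = Dom C h \<and> Cod C h = fst S (Dom C f))"

definition triangle_map :: "('o, 'm, 'z) cat_scheme \<Rightarrow> ('o, 'm, 'o, 'm) func \<Rightarrow>
    'm \<times> 'm \<times> 'm \<Rightarrow> 'm \<times> 'm \<times> 'm \<Rightarrow> 'm \<times> 'm \<times> 'm \<Rightarrow> bool" where
  "triangle_map C S = (\<lambda>(f, g, h) (f', g', h') (a, b, c).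
     a \<in> Hom C (Dom C f) (Dom C f') \<and> b \<in> Hom C (Dom C g) (Dom C g') \<and> c \<in> Hom C (Dom C h) (Dom C h') \<and>
     Cmp C b f = Cmp C f' a \<and> Cmp C c g = Cmp C g' b \<and> Cmp C (snd S a) h = Cmp C h' c)"

definition triangle_isomorphic :: "('o, 'm, 'z) cat_scheme \<Rightarrow> ('o, 'm, 'o, 'm) func \<Rightarrow>
    'm \<times> 'm \<times> 'm \<Rightarrow> 'm \<times> 'm \<times> 'm \<Rightarrow> bool" where
  "triangle_isomorphic C S t t' \<longleftrightarrow>
     (\<exists>a b c. triangle_map C S t t' (a, b, c) \<and> is_iso C a \<and> is_iso C b \<and> is_iso C c)"

text \<open>The last conjunct is the octahedral axiom; the shift is a self-equivalence.\<close>

definition triangulated :: "('o, 'm) tcat \<Rightarrow> bool" where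
  "triangulated T \<longleftrightarrow> additive_category T \<and> additive_functor T T (Shift T) \<and>
     (\<forall>a\<in>Obj T. \<forall>b\<in>Obj T. bij_betw (snd (Shift T)) (Hom T a b) (Hom T (fst (Shift T) a) (fst (Shift T) b))) \<and>
     (\<forall>b\<in>Obj T. \<exists>a\<in>Obj T. \<exists>f\<in>Hom T (fst (Shift T) a) b. is_iso T f) \<and>
     (\<forall>t\<in>Dist T. is_triangle T (Shift T) t) \<and>
     (\<forall>t\<in>Dist T. \<forall>t'. is_triangle T (Shift T) t' \<and> triangle_isomorphic T (Shift T) t t' \<longrightarrow> t' \<in> Dist T) \<and>
     (\<forall>a\<in>Obj T. \<forall>z g h. zero_obj T z \<and> g \<in> Hom T a z \<and> h \<in> Hom T z (fst (Shift T) a) \<longrightarrow>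
        (Idn T a, g, h) \<in> Dist T) \<and>
     (\<forall>f\<in>Arr T. \<exists>g h. (f, g, h) \<in> Dist T) \<and>
     (\<forall>f g h. is_triangle T (Shift T) (f, g, h) \<longrightarrow>
        ((f, g, h) \<in> Dist T \<longleftrightarrow> (g, h, hom_neg T (snd (Shift T) f)) \<in> Dist T)) \<and>
     (\<forall>f g h f' g' h' a b. (f, g, h) \<in> Dist T \<and> (f', g', h') \<in> Dist T \<and>
        a \<in> Hom T (Dom T f) (Dom T f') \<and> b \<in> Hom T (Dom T g) (Dom T g') \<and> Cmp T b f = Cmp T f' a \<longrightarrow>
        (\<exists>c. triangle_map T (Shift T) (f, g, h) (f', g', h') (a, b, c))) \<and>
     (\<forall>f g f1 f2 g1 g2 h1 h2. (f, f1, f2) \<in> Dist T \<and> (g, g1, g2) \<in> Dist T \<and> Cod T f = Dom T g \<and>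
        (Cmp T g f, h1, h2) \<in> Dist T \<longrightarrow>
        (\<exists>u v. u \<in> Hom T (Cod T f1) (Cod T h1) \<and> v \<in> Hom T (Cod T h1) (Cod T g1) \<and>
           (u, v, Cmp T (snd (Shift T) f1) g2) \<in> Dist T \<and>
           Cmp T u f1 = Cmp T h1 g \<and> Cmp T h2 u = f2 \<and> Cmp T v h1 = g1 \<and>
           Cmp T g2 v = Cmp T (snd (Shift T) f) h2))"

definition exact_functor :: "('o, 'm) tcat \<Rightarrow> ('p, 'n) tcat \<Rightarrow> ('o, 'm, 'p, 'n) func \<Rightarrow> bool" where
  "exact_functor T T' F \<longleftrightarrow> additive_functor T T' F \<and>
     (\<exists>\<phi>. nat_iso T T' (fcomp F (Shift T)) (fcomp (Shift T') F) \<phi> \<and>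
        (\<forall>f g h. (f, g, h) \<in> Dist T \<longrightarrow> (snd F f, snd F g, Cmp T' (\<phi> (Dom T f)) (snd F h)) \<in> Dist T'))"

definition full_sub :: "('o, 'm) tcat \<Rightarrow> 'o set \<Rightarrow> ('o, 'm) tcat" where
  "full_sub T S = T\<lparr>Obj := Obj T \<inter> S,
     Arr := {f \<in> Arr T. Dom T f \<in> S \<and> Cod T f \<in> S},
     Dist := {(f, g, h) \<in> Dist T. Dom T f \<in> S \<and> Cod T f \<in> S \<and> Cod T g \<in> S}\<rparr>"

text \<open>Full triangulated subcategories are taken to be closed under isomorphism.\<close>

definition triangulated_subcat :: "('o, 'm) tcat \<Rightarrow> 'o set \<Rightarrow> bool" where
  "triangulated_subcat T S \<longleftrightarrow> S \<subseteq> Obj T \<and> (\<forall>z. zero_obj T z \<longrightarrow> z \<in> S) \<and>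
     (\<forall>f. is_iso T f \<and> Dom T f \<in> S \<longrightarrow> Cod T f \<in> S) \<and>
     (\<forall>a\<in>Obj T. a \<in> S \<longleftrightarrow> fst (Shift T) a \<in> S) \<and>
     (\<forall>f g h. (f, g, h) \<in> Dist T \<and> Dom T f \<in> S \<and> Cod T f \<in> S \<longrightarrow> Cod T g \<in> S)"

definition closed_under_sums :: "'i set set \<Rightarrow> ('o, 'm, 'z) cat_scheme \<Rightarrow> 'o set \<Rightarrow> bool" where
  "closed_under_sums U C S \<longleftrightarrow> (\<forall>I\<in>U. \<forall>x c. (\<forall>i\<in>I. x i \<in> S) \<and> is_coproduct C I x c \<longrightarrow> c \<in> S)"

section \<open>The stable homotopy category of C*-algebras\<close>

type_synonym 'u sarr = "'u spec \<times> (nat \<Rightarrow> calg \<Rightarrow> nat \<Rightarrow> 'u \<Rightarrow> 'u) \<times> 'u spec"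
type_synonym 'u harr = "('u spec, 'u sarr) larr"

definition Spt :: "tensor_kind \<Rightarrow> 'u set set \<Rightarrow> ('u spec, 'u sarr) cat" where
  "Spt kd U =
     \<lparr>Obj = {E. spectrum kd U E},
      Arr = {(E, f, F). spectrum kd U E \<and> spectrum kd U F \<and> sp_map kd E F f},
      Dom = fst,
      Cod = (\<lambda>f. snd (snd f)),
      Idn = (\<lambda>E. (E, \<lambda>n. cs_restrict (lev E n) (\<lambda>A k x. x), E)),
      Cmp = (\<lambda>(F, g, G) (E, f, F'). (E, \<lambda>n. cs_restrict (lev E n) (\<lambda>A k x. g n A k (f n A k x)), G))\<rparr>"

definition Weq :: "tensor_kind \<Rightarrow> 'u set set \<Rightarrow> 'u sarr set" where
  "Weq kd U = {(E, f, F). (E, f, F) \<in> Arr (Spt kd U) \<and> sp_weq kd U E F f}"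

text \<open>The functor \<open>- \<otimes> K\<close> on spectra, landing in the universe.\<close>

definition tensor_spec :: "tensor_kind \<Rightarrow> 'u set set \<Rightarrow> 'k pcset \<Rightarrow> 'u spec \<Rightarrow> 'u spec" where
  "tensor_spec kd U K E = sp_code kd U (sp_smash kd E K)"

definition tensor_spec_map :: "tensor_kind \<Rightarrow> 'u set set \<Rightarrow> 'k pcset \<Rightarrow> 'l pcset \<Rightarrow>
    (nat \<Rightarrow> 'k \<Rightarrow> 'l) \<Rightarrow> 'u sarr \<Rightarrow> 'u sarr" where
  "tensor_spec_map kd U K L r = (\<lambda>(E, f, F). (tensor_spec kd U K E,
     \<lambda>n. cs_restrict (lev (tensor_spec kd U K E) n) (\<lambda>A k y.
       cs_enc U (cs_smash (lev F n) L) A k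
         (smash_map (val (lev F n) A) L (f n A) r k (cs_dec U (cs_smash (lev E n) K) A k y))),
     tensor_spec kd U L F))"

definition suspension :: "tensor_kind \<Rightarrow> 'u set set \<Rightarrow> ('u spec, 'u sarr, 'u spec, 'u sarr) func" where
  "suspension kd U = (tensor_spec kd U circle, tensor_spec_map kd U circle circle (\<lambda>_ y. y))"

text \<open>The inclusion \<open>E \<rightarrow> E \<otimes> \<box>\<^sup>1\<close> at the vertex 0 of the cone.\<close>

definition cone_base :: "tensor_kind \<Rightarrow> 'u set set \<Rightarrow> 'u spec \<Rightarrow> 'u sarr" where
  "cone_base kd U E = (E, \<lambda>n. cs_restrict (lev E n) (\<lambda>A k x.
     cs_enc U (cs_smash (lev E n) interval) A k
       (smash_cls (val (lev E n) A) interval k (k, 0, box_id k, x, Some (const_cell 0 False)))),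
     tensor_spec kd U interval E)"

text \<open>\<open>X \<rightarrow> Y \<rightarrow> Z \<rightarrow> X \<otimes> S\<^sup>1\<close> is the mapping cone sequence of a map \<open>f\<close> of cofibrant spectra; the
  last map collapses \<open>Y\<close>.\<close>

definition cone_sequence :: "tensor_kind \<Rightarrow> 'u set set \<Rightarrow> 'u sarr \<times> 'u sarr \<times> 'u sarr \<Rightarrow> bool" where
  "cone_sequence kd U = (\<lambda>(f, i, d). f \<in> Arr (Spt kd U) \<and>
     sp_cofibrant kd U (Dom (Spt kd U) f) \<and> sp_cofibrant kd U (Cod (Spt kd U) f) \<and>
     (\<exists>k. is_pushout (Spt kd U) f (cone_base kd U (Dom (Spt kd U) f)) i k \<and>
        d \<in> Hom (Spt kd U) (Cod (Spt kd U) i) (tensor_spec kd U circle (Dom (Spt kd U) f)) \<and>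
        zero_arr (Spt kd U) (Cmp (Spt kd U) d i) \<and>
        Cmp (Spt kd U) d k = tensor_spec_map kd U interval circle interval_to_circle
                               (Idn (Spt kd U) (Dom (Spt kd U) f))))"

definition SH :: "tensor_kind \<Rightarrow> 'u set set \<Rightarrow> ('u spec, 'u harr) tcat" where
  "SH kd U = cat.extend (localization (Spt kd U) (Weq kd U))
     (let S = loc_functor (Spt kd U) (Weq kd U) (suspension kd U);
          \<gamma> = loc_arr (Spt kd U) (Weq kd U);
          C = localization (Spt kd U) (Weq kd U)
      in tcat.fields S {t. is_triangle C S t \<and>
           (\<exists>f i d. cone_sequence kd U (f, i, d) \<and> triangle_isomorphic C S (\<gamma> f, \<gamma> i, \<gamma> d) t)})"

subsection \<open>The effective subcategories\<close>

definition eff_generators :: "tensor_kind \<Rightarrow> 'u set set \<Rightarrow> int \<Rightarrow> 'u spec set" where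
  "eff_generators kd U q = {G. \<exists>m s t (X::'u cspace). int t - int m \<ge> q \<and>
     small_cspace U X \<and> cs_cofibrant U X \<and>
     is_free_spec kd U m (day kd (cs_lsmash (sphere s) (repr (real_copy (C0 (euc t))))) X) G}"

definition eff_objects :: "tensor_kind \<Rightarrow> 'u set set \<Rightarrow> int \<Rightarrow> 'u spec set" where
  "eff_objects kd U q = \<Inter>{S. triangulated_subcat (SH kd U) S \<and> closed_under_sums U (SH kd U) S \<and>
                              eff_generators kd U q \<subseteq> S}"

definition SH_eff :: "tensor_kind \<Rightarrow> 'u set set \<Rightarrow> int \<Rightarrow> ('u spec, 'u harr) tcat" where
  "SH_eff kd U q = full_sub (SH kd U) (eff_objects kd U q)"

type_synonym 'u hfunc = "('u spec, 'u harr, 'u spec, 'u harr) func"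

definition eff_cover :: "(int \<Rightarrow> 'u hfunc) \<Rightarrow> int \<Rightarrow> 'u hfunc" where
  "eff_cover r q = fcomp incl (r q)"

text \<open>The component at \<open>E\<close> of \<open>f\<^sub>q\<^sub>+\<^sub>1 \<rightarrow> f\<^sub>q\<close>: the map through which the counit
  \<open>f\<^sub>q\<^sub>+\<^sub>1 E \<rightarrow> E\<close> factors over the counit \<open>f\<^sub>q E \<rightarrow> E\<close>.\<close>

definition eff_transition :: "tensor_kind \<Rightarrow> 'u set set \<Rightarrow> (int \<Rightarrow> 'u hfunc) \<Rightarrow> (int \<Rightarrow> 'u spec \<Rightarrow> 'u harr) \<Rightarrow>
    int \<Rightarrow> 'u spec \<Rightarrow> 'u harr" where
  "eff_transition kd U r \<epsilon> q E = (THE a.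
     a \<in> Hom (SH kd U) (fst (eff_cover r (q + 1)) E) (fst (eff_cover r q) E) \<and>
     Cmp (SH kd U) (\<epsilon> q E) a = \<epsilon> (q + 1) E)"

definition slice_data :: "tensor_kind \<Rightarrow> 'u set set \<Rightarrow> (int \<Rightarrow> 'u hfunc) \<Rightarrow> (int \<Rightarrow> 'u spec \<Rightarrow> 'u harr) \<Rightarrow>
    int \<Rightarrow> 'u hfunc \<Rightarrow> ('u spec \<Rightarrow> 'u harr) \<Rightarrow> ('u spec \<Rightarrow> 'u harr) \<Rightarrow> bool" where
  "slice_data kd U r \<epsilon> q s \<pi> \<delta> \<longleftrightarrow>
     exact_functor (SH kd U) (SH kd U) s \<and>
     nat_trans (SH kd U) (SH kd U) (eff_cover r q) s \<pi> \<and>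
     nat_trans (SH kd U) (SH kd U) s (fcomp (Shift (SH kd U)) (eff_cover r (q + 1))) \<delta> \<and>
     (\<forall>E\<in>Obj (SH kd U). (eff_transition kd U r \<epsilon> q E, \<pi> E, \<delta> E) \<in> Dist (SH kd U)) \<and>
     (\<forall>E\<in>Obj (SH kd U). fst s E \<in> Obj (SH_eff kd U q)) \<and>
     (\<forall>E\<in>Obj (SH kd U). \<forall>F\<in>Obj (SH_eff kd U (q + 1)). \<forall>a\<in>Hom (SH kd U) F (fst s E).
        zero_arr (SH kd U) a)"

end

theory Submission
  imports Defs
begin

text \<open>
  Write \<open>S\<^sub>q\<close> for the \<open>q\<close>-th effective subcategory.
  The slice \<open>s E\<close> is a cone of \<open>f\<^sub>q\<^sub>+\<^sub>1 E \<rightarrow> f\<^sub>q E\<close>.  Maps from \<open>S\<^sub>q\<^sub>+\<^sub>1\<close> into \<open>f\<^sub>q\<^sub>+\<^sub>1 E\<close> and into \<open>f\<^sub>q E\<close>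
  both agree with maps into \<open>E\<close>, so the long exact sequence shows that \<open>s E\<close> is right orthogonal to
  \<open>S\<^sub>q\<^sub>+\<^sub>1\<close>.  Since \<open>\<Sigma> f\<^sub>q\<^sub>+\<^sub>1 E\<close> lies in \<open>S\<^sub>q\<^sub>+\<^sub>1\<close>, every map from \<open>f\<^sub>q E\<close> to an orthogonal object
  factors uniquely through \<open>f\<^sub>q E \<rightarrow> s E\<close>.  This universal property makes \<open>s\<close> an additive functor,
  gives its uniqueness, and, since cones of maps between orthogonal objects are orthogonal, its
  exactness by way of the five lemma.
\<close>

subsection \<open>Triangulated categories\<close>

text \<open>The obstacle is that cones are not functorial: the fill-in axiom supplies maps between
  cones without uniqueness, so identities, composites and boundary squares need not match a priori.
  Every such ambiguity is settled by comparing two maps into an orthogonal object after restriction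
  to f_q E. For the boundary square this is turned around: an arbitrary fill-in already satisfies
  it, and the fill-in must coincide with the map given by the universal property. Exactness of s
  also requires a shift isomorphism, which is manufactured from the one of r_q. The cone of s f is
  compared with the slice of the third vertex only through maps into orthogonal objects, where the
  five lemma is diagram chasing in exact sequences of abelian groups. All of this takes place in an
  arbitrary triangulated category with two nested coreflective triangulated subcategories; the
  spectra enter only at the end, to supply such a pair.\<close>

locale tri_cat =
  fixes T :: "('o, 'm) tcat"
  assumes tri: "triangulated T"
begin

abbreviation hom :: "'o \<Rightarrow> 'o \<Rightarrow> 'm set" where "hom \<equiv> Hom T"
abbreviation comp :: "'m \<Rightarrow> 'm \<Rightarrow> 'm" (infixl "\<cdot>" 70) where "g \<cdot> f \<equiv> Cmp T g f"
abbreviation \<Sigma>\<^sub>o :: "'o \<Rightarrow> 'o" where "\<Sigma>\<^sub>o \<equiv> fst (Shift T)"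
abbreviation \<Sigma> :: "'m \<Rightarrow> 'm" where "\<Sigma> \<equiv> snd (Shift T)"
abbreviation add :: "'m \<Rightarrow> 'm \<Rightarrow> 'm" where "add \<equiv> hom_plus T"
abbreviation neg :: "'m \<Rightarrow> 'm" where "neg \<equiv> hom_neg T"

text \<open>Spelled exactly like the unit of \<open>hom_group\<close>, so that the group laws on
  arrows speak about \<open>zr\<close> after one unfolding.\<close>

definition zr :: "'o \<Rightarrow> 'o \<Rightarrow> 'm" where
  "zr a b = (THE f. f \<in> hom a b \<and> zero_arr T f)"

definition mns :: "'m \<Rightarrow> 'm \<Rightarrow> 'm" where
  "mns f g = add f (neg g)"

lemma hom_iff: "f \<in> hom a b \<longleftrightarrow> f \<in> Arr T \<and> Dom T f = a \<and> Cod T f = b"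
  by (simp add: Hom_def)

lemma
  shows shift_additive: "additive_functor T T (Shift T)"
    and shift_bij: "\<And>a b. a \<in> Obj T \<Longrightarrow> b \<in> Obj T \<Longrightarrow>
      bij_betw \<Sigma> (hom a b) (hom (\<Sigma>\<^sub>o a) (\<Sigma>\<^sub>o b))"
    and shift_ess: "\<And>b. b \<in> Obj T \<Longrightarrow> \<exists>a\<in>Obj T. \<exists>f\<in>hom (\<Sigma>\<^sub>o a) b. is_iso T f"
    and dist_triangle: "\<And>t. t \<in> Dist T \<Longrightarrow> is_triangle T (Shift T) t"
    and dist_iso: "\<And>t t'. \<lbrakk>t \<in> Dist T; is_triangle T (Shift T) t';
      triangle_isomorphic T (Shift T) t t'\<rbrakk> \<Longrightarrow> t' \<in> Dist T"
    and dist_idn: "\<And>a z g h. \<lbrakk>a \<in> Obj T; zero_obj T z; g \<in> hom a z; h \<in> hom z (\<Sigma>\<^sub>o a)\<rbrakk> \<Longrightarrow>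
      (Idn T a, g, h) \<in> Dist T"
    and dist_ex: "\<And>f. f \<in> Arr T \<Longrightarrow> \<exists>g h. (f, g, h) \<in> Dist T"
    and dist_rot: "\<And>f g h. is_triangle T (Shift T) (f, g, h) \<Longrightarrow>
      (f, g, h) \<in> Dist T \<longleftrightarrow> (g, h, neg (\<Sigma> f)) \<in> Dist T"
    and dist_fill: "\<And>f g h f' g' h' a b. \<lbrakk>(f, g, h) \<in> Dist T; (f', g', h') \<in> Dist T;
        a \<in> hom (Dom T f) (Dom T f'); b \<in> hom (Dom T g) (Dom T g'); b \<cdot> f = f' \<cdot> a\<rbrakk> \<Longrightarrow>
      \<exists>c. triangle_map T (Shift T) (f, g, h) (f', g', h') (a, b, c)"
    and additive: "additive_category T"
proof -
  note t = tri[unfolded triangulated_def]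
  note c0 = t[THEN conjunct1]
  note c1 = t[THEN conjunct2, THEN conjunct1]
  note c2 = t[THEN conjunct2, THEN conjunct2, THEN conjunct1]
  note c3 = t[THEN conjunct2, THEN conjunct2, THEN conjunct2, THEN conjunct1]
  note c4 = t[THEN conjunct2, THEN conjunct2, THEN conjunct2, THEN conjunct2, THEN conjunct1]
  note c5 = t[THEN conjunct2, THEN conjunct2, THEN conjunct2, THEN conjunct2, THEN conjunct2, THEN conjunct1]
  note c6 = t[THEN conjunct2, THEN conjunct2, THEN conjunct2, THEN conjunct2, THEN conjunct2, THEN conjunct2, THEN conjunct1]
  note c7 = t[THEN conjunct2, THEN conjunct2, THEN conjunct2, THEN conjunct2, THEN conjunct2, THEN conjunct2, THEN conjunct2, THEN conjunct1]
  note c8 = t[THEN conjunct2, THEN conjunct2, THEN conjunct2, THEN conjunct2, THEN conjunct2, THEN conjunct2, THEN conjunct2, THEN conjunct2, THEN conjunct1]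
  note c9 = t[THEN conjunct2, THEN conjunct2, THEN conjunct2, THEN conjunct2, THEN conjunct2, THEN conjunct2, THEN conjunct2, THEN conjunct2, THEN conjunct2, THEN conjunct1]
  show "additive_category T" by (rule c0)
  show "additive_functor T T (Shift T)" by (rule c1)
  show "bij_betw \<Sigma> (hom a b) (hom (\<Sigma>\<^sub>o a) (\<Sigma>\<^sub>o b))" if "a \<in> Obj T" "b \<in> Obj T" for a b
    using c2 that by blast
  show "\<exists>a\<in>Obj T. \<exists>f\<in>hom (\<Sigma>\<^sub>o a) b. is_iso T f" if "b \<in> Obj T" for b
    using c3 that by (rule bspec)
  show "is_triangle T (Shift T) t" if "t \<in> Dist T" for t
    using c4 that by blast
  show "t' \<in> Dist T" if "t \<in> Dist T" "is_triangle T (Shift T) t'" "triangle_isomorphic T (Shift T) t t'" for t t'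
    using c5 that by blast
  show "(Idn T a, g, h) \<in> Dist T" if "a \<in> Obj T" "zero_obj T z" "g \<in> hom a z" "h \<in> hom z (\<Sigma>\<^sub>o a)" for a z g h
    using c6 that by blast
  show "\<exists>g h. (f, g, h) \<in> Dist T" if "f \<in> Arr T" for f
    using c7 that by blast
  show "(f, g, h) \<in> Dist T \<longleftrightarrow> (g, h, neg (\<Sigma> f)) \<in> Dist T" if "is_triangle T (Shift T) (f, g, h)" for f g h
    using c8 that by blast
  show "\<exists>c. triangle_map T (Shift T) (f, g, h) (f', g', h') (a, b, c)"
    if "(f, g, h) \<in> Dist T" "(f', g', h') \<in> Dist T" "a \<in> hom (Dom T f) (Dom T f')"
      "b \<in> hom (Dom T g) (Dom T g')" "b \<cdot> f = f' \<cdot> a" for f g h f' g' h' a b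
    by (rule c9[rule_format]) (intro conjI that)
qed

section \<open>Category laws and the shift functor\<close>

lemma cat: "is_category T"
  using shift_additive by (simp add: additive_functor_def is_functor_def)

lemma dom_obj [simp, intro]: "f \<in> Arr T \<Longrightarrow> Dom T f \<in> Obj T"
  and cod_obj [simp, intro]: "f \<in> Arr T \<Longrightarrow> Cod T f \<in> Obj T"
  and idn [simp]: "a \<in> Obj T \<Longrightarrow> Idn T a \<in> Arr T"
    "a \<in> Obj T \<Longrightarrow> Dom T (Idn T a) = a" "a \<in> Obj T \<Longrightarrow> Cod T (Idn T a) = a"
  and comp [simp]: "\<lbrakk>f \<in> Arr T; g \<in> Arr T; Cod T f = Dom T g\<rbrakk> \<Longrightarrow> g \<cdot> f \<in> Arr T"
    "\<lbrakk>f \<in> Arr T; g \<in> Arr T; Cod T f = Dom T g\<rbrakk> \<Longrightarrow> Dom T (g \<cdot> f) = Dom T f"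
    "\<lbrakk>f \<in> Arr T; g \<in> Arr T; Cod T f = Dom T g\<rbrakk> \<Longrightarrow> Cod T (g \<cdot> f) = Cod T g"
  and comp_idn [simp]: "\<lbrakk>f \<in> Arr T; Dom T f = a\<rbrakk> \<Longrightarrow> f \<cdot> Idn T a = f"
    "\<lbrakk>f \<in> Arr T; Cod T f = b\<rbrakk> \<Longrightarrow> Idn T b \<cdot> f = f"
  and assoc: "\<lbrakk>f \<in> Arr T; g \<in> Arr T; h \<in> Arr T; Cod T f = Dom T g; Cod T g = Dom T h\<rbrakk> \<Longrightarrow>
    h \<cdot> g \<cdot> f = h \<cdot> (g \<cdot> f)"
  using cat unfolding is_category_def hom_iff by auto

lemma shift_obj [simp]: "a \<in> Obj T \<Longrightarrow> \<Sigma>\<^sub>o a \<in> Obj T"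
  and shift [simp]: "f \<in> Arr T \<Longrightarrow> \<Sigma> f \<in> Arr T"
    "f \<in> Arr T \<Longrightarrow> Dom T (\<Sigma> f) = \<Sigma>\<^sub>o (Dom T f)" "f \<in> Arr T \<Longrightarrow> Cod T (\<Sigma> f) = \<Sigma>\<^sub>o (Cod T f)"
  and shift_idn [simp]: "a \<in> Obj T \<Longrightarrow> \<Sigma> (Idn T a) = Idn T (\<Sigma>\<^sub>o a)"
  and shift_comp: "\<lbrakk>f \<in> Arr T; g \<in> Arr T; Cod T f = Dom T g\<rbrakk> \<Longrightarrow> \<Sigma> (g \<cdot> f) = \<Sigma> g \<cdot> \<Sigma> f"
  and shift_add: "\<lbrakk>f \<in> Arr T; g \<in> Arr T; Dom T f = Dom T g; Cod T f = Cod T g\<rbrakk> \<Longrightarrow>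
    \<Sigma> (add f g) = add (\<Sigma> f) (\<Sigma> g)"
  using shift_additive unfolding additive_functor_def is_functor_def hom_iff by auto

lemma shift_inj:
  assumes "f \<in> Arr T" "g \<in> Arr T" "Dom T f = Dom T g" "Cod T f = Cod T g" "\<Sigma> f = \<Sigma> g"
  shows "f = g"
  using shift_bij[of "Dom T f" "Cod T f"] assms by (auto simp: bij_betw_def inj_on_def hom_iff)

lemma shift_surj:
  assumes "f \<in> Arr T" "Dom T f = \<Sigma>\<^sub>o a" "Cod T f = \<Sigma>\<^sub>o b" "a \<in> Obj T" "b \<in> Obj T"
  obtains g where "g \<in> hom a b" "f = \<Sigma> g"
  using shift_bij[of a b] assms by (force simp: bij_betw_def hom_iff)

lemma isoE:
  assumes "is_iso T f"
  obtains g where "f \<in> Arr T" "g \<in> hom (Cod T f) (Dom T f)" "g \<cdot> f = Idn T (Dom T f)"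
    "f \<cdot> g = Idn T (Cod T f)"
  using assms unfolding is_iso_def by blast

lemma isoI:
  assumes "f \<in> hom a b" "g \<in> hom b a" "g \<cdot> f = Idn T a" "f \<cdot> g = Idn T b"
  shows "is_iso T f"
  using assms unfolding is_iso_def by (auto simp: hom_iff)

section \<open>Zero objects and zero maps\<close>

lemma zero_exists: "\<exists>z. zero_obj T z"
  using additive by (simp add: additive_category_def)

lemma pre: "preadditive T add"
  using additive unfolding additive_category_def hom_plus_def by (metis someI_ex)

lemma zero_objD:
  assumes "zero_obj T z"
  shows "z \<in> Obj T" "\<And>f g. f \<in> Arr T \<Longrightarrow> g \<in> Arr T \<Longrightarrow> Dom T f = Dom T g \<Longrightarrow> Cod T f = z \<Longrightarrow> Cod T g = z \<Longrightarrow> f = g"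
    "\<And>f g. f \<in> Arr T \<Longrightarrow> g \<in> Arr T \<Longrightarrow> Cod T f = Cod T g \<Longrightarrow> Dom T f = z \<Longrightarrow> Dom T g = z \<Longrightarrow> f = g"
    "\<And>a. a \<in> Obj T \<Longrightarrow> \<exists>f. f \<in> hom a z" "\<And>a. a \<in> Obj T \<Longrightarrow> \<exists>f. f \<in> hom z a"
proof -
  have z: "z \<in> Obj T" and u: "\<And>a. a \<in> Obj T \<Longrightarrow> \<exists>!f. f \<in> hom a z" "\<And>a. a \<in> Obj T \<Longrightarrow> \<exists>!f. f \<in> hom z a"
    using assms by (simp_all add: zero_obj_def)
  show "z \<in> Obj T" by (rule z)
  show "\<And>a. a \<in> Obj T \<Longrightarrow> \<exists>f. f \<in> hom a z" "\<And>a. a \<in> Obj T \<Longrightarrow> \<exists>f. f \<in> hom z a"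
    by (rule ex1_implies_ex, rule u, assumption)+
  show "f = g" if "f \<in> Arr T" "g \<in> Arr T" "Dom T f = Dom T g" "Cod T f = z" "Cod T g = z" for f g
    using u(1)[of "Dom T f"] that by (auto simp: hom_iff)
  show "f = g" if "f \<in> Arr T" "g \<in> Arr T" "Cod T f = Cod T g" "Dom T f = z" "Dom T g = z" for f g
    using u(2)[of "Cod T f"] that by (auto simp: hom_iff)
qed

lemma zero_arrE:
  assumes "zero_arr T f" "f \<in> hom a b"
  obtains z u v where "zero_obj T z" "u \<in> hom a z" "v \<in> hom z b" "f = v \<cdot> u"
  using assms unfolding zero_arr_def hom_iff by blast

text \<open>The two maps may factor through different zero objects z and z'. A map w from z to z'
  carries one factorization to the other, because maps into z' and maps out of z are unique.\<close>

lemma zero_arr_unique: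
  assumes "zero_arr T f" "zero_arr T g" "f \<in> hom a b" "g \<in> hom a b"
  shows "f = g"
proof -
  obtain z u v where z: "zero_obj T z" "u \<in> hom a z" "v \<in> hom z b" "f = v \<cdot> u"
    using zero_arrE[OF assms(1,3)] .
  obtain z' u' v' where z': "zero_obj T z'" "u' \<in> hom a z'" "v' \<in> hom z' b" "g = v' \<cdot> u'"
    using zero_arrE[OF assms(2,4)] .
  obtain w where w: "w \<in> hom z z'" using zero_objD(4)[OF z'(1) zero_objD(1)[OF z(1)]] by blast
  have "w \<cdot> u = u'"
    by (rule zero_objD(2)[OF z'(1)]) (use z(2) z'(2) w in \<open>simp_all add: hom_iff\<close>)
  moreover have "v' \<cdot> w = v"
    by (rule zero_objD(3)[OF z(1)]) (use z(3) z'(3) w in \<open>simp_all add: hom_iff\<close>)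
  ultimately show ?thesis using z(2,4) z'(3,4) w assoc[of u w v'] by (auto simp: hom_iff)
qed

lemma zr_zero_arr:
  assumes "a \<in> Obj T" "b \<in> Obj T"
  shows "zr a b \<in> hom a b \<and> zero_arr T (zr a b)"
proof -
  obtain z where z: "zero_obj T z" using zero_exists by blast
  obtain u v where "u \<in> hom a z" "v \<in> hom z b" using zero_objD(4,5)[OF z] assms by metis
  then have "v \<cdot> u \<in> hom a b \<and> zero_arr T (v \<cdot> u)"
    unfolding zero_arr_def using z by (auto simp: hom_iff)
  then have "\<exists>!f. f \<in> hom a b \<and> zero_arr T f"
    using zero_arr_unique by blast
  then show ?thesis
    unfolding zr_def by (rule theI')
qed

lemma zr [simp]:
  assumes "a \<in> Obj T" "b \<in> Obj T"
  shows "zr a b \<in> Arr T" "Dom T (zr a b) = a" "Cod T (zr a b) = b"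
  using zr_zero_arr[OF assms] by (auto simp: hom_iff)

lemma zero_arr_iff: "zero_arr T f \<longleftrightarrow> f \<in> Arr T \<and> f = zr (Dom T f) (Cod T f)"
proof
  assume f: "zero_arr T f"
  then have "f \<in> Arr T" by (simp add: zero_arr_def)
  then show "f \<in> Arr T \<and> f = zr (Dom T f) (Cod T f)"
    using zero_arr_unique[OF f, of "zr (Dom T f) (Cod T f)"] zr_zero_arr by (simp add: hom_iff)
next
  assume "f \<in> Arr T \<and> f = zr (Dom T f) (Cod T f)"
  then show "zero_arr T f" using zr_zero_arr by (metis cod_obj dom_obj)
qed

section \<open>The abelian group structure on parallel arrows\<close>

lemma hom_comm_group: "a \<in> Obj T \<Longrightarrow> b \<in> Obj T \<Longrightarrow> comm_group (hom_group T add a b)"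
  using pre by (simp add: preadditive_def)

lemma hom_group_simps [simp]: "carrier (hom_group T add a b) = hom a b"
  "monoid.mult (hom_group T add a b) = add" "one (hom_group T add a b) = zr a b"
  by (simp_all add: hom_group_def zr_def)

lemma add [simp]:
  assumes "f \<in> Arr T" "g \<in> Arr T" "Dom T f = Dom T g" "Cod T f = Cod T g"
  shows "add f g \<in> Arr T" "Dom T (add f g) = Dom T f" "Cod T (add f g) = Cod T f"
proof -
  interpret comm_group "hom_group T add (Dom T f) (Cod T f)" using hom_comm_group assms by simp
  have "add f g \<in> hom (Dom T f) (Cod T f)" using m_closed[of f g] assms by (simp add: hom_iff)
  then show "add f g \<in> Arr T" "Dom T (add f g) = Dom T f" "Cod T (add f g) = Cod T f"
    by (auto simp: hom_iff)
qed

lemma neg [simp]: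
  assumes "f \<in> Arr T"
  shows "neg f \<in> Arr T" "Dom T (neg f) = Dom T f" "Cod T (neg f) = Cod T f"
    "add (neg f) f = zr (Dom T f) (Cod T f)" "add f (neg f) = zr (Dom T f) (Cod T f)"
    "add (zr (Dom T f) (Cod T f)) f = f"  "add f (zr (Dom T f) (Cod T f)) = f" "neg (neg f) = f"
proof -
  interpret comm_group "hom_group T add (Dom T f) (Cod T f)" using hom_comm_group assms by simp
  have f: "f \<in> carrier (hom_group T add (Dom T f) (Cod T f))" using assms by (simp add: hom_iff)
  have n: "neg f \<in> hom (Dom T f) (Cod T f)" using inv_closed[OF f] by (simp add: hom_neg_def)
  then show n3: "neg f \<in> Arr T" "Dom T (neg f) = Dom T f" "Cod T (neg f) = Cod T f"
    by (auto simp: hom_iff)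
  show "add (neg f) f = zr (Dom T f) (Cod T f)" "add f (neg f) = zr (Dom T f) (Cod T f)"
    using l_inv[OF f] r_inv[OF f] by (simp_all add: hom_neg_def)
  show "add (zr (Dom T f) (Cod T f)) f = f"  "add f (zr (Dom T f) (Cod T f)) = f"
    using l_one[OF f] r_one[OF f] by simp_all
  show "neg (neg f) = f" using inv_inv[OF f] n3 by (simp add: hom_neg_def)
qed

lemma add_assoc:
  assumes "f \<in> Arr T" "g \<in> Arr T" "h \<in> Arr T" "Dom T f = Dom T g" "Cod T f = Cod T g"
    "Dom T h = Dom T g" "Cod T h = Cod T g"
  shows "add (add f g) h = add f (add g h)"
proof -
  interpret comm_group "hom_group T add (Dom T f) (Cod T f)" using hom_comm_group assms by simp
  show ?thesis using m_assoc[of f g h] assms by (simp add: hom_iff)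
qed

lemma add_comm:
  assumes "f \<in> Arr T" "g \<in> Arr T" "Dom T f = Dom T g" "Cod T f = Cod T g"
  shows "add f g = add g f"
proof -
  interpret comm_group "hom_group T add (Dom T f) (Cod T f)" using hom_comm_group assms by simp
  show ?thesis using m_comm[of f g] assms by (simp add: hom_iff)
qed

lemma comp_add:
  "\<lbrakk>f \<in> Arr T; f' \<in> Arr T; g \<in> Arr T; Dom T f = Dom T f'; Cod T f = Dom T g; Cod T f' = Dom T g\<rbrakk> \<Longrightarrow>
    g \<cdot> add f f' = add (g \<cdot> f) (g \<cdot> f')"
  and add_comp:
  "\<lbrakk>f \<in> Arr T; g \<in> Arr T; g' \<in> Arr T; Cod T f = Dom T g; Cod T f = Dom T g'; Cod T g = Cod T g'\<rbrakk> \<Longrightarrow>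
    add g g' \<cdot> f = add (g \<cdot> f) (g' \<cdot> f)"
  using pre[unfolded preadditive_def, THEN conjunct2, THEN conjunct2, rule_format,
      of "Dom T f" "Cod T f" "Cod T g" f f' g g]
    pre[unfolded preadditive_def, THEN conjunct2, THEN conjunct2, rule_format,
      of "Dom T f" "Cod T f" "Cod T g" f f g g']
  by (simp_all add: hom_iff)

lemma comp_zr [simp]:
  assumes "g \<in> Arr T" "a \<in> Obj T" "Dom T g = b"
  shows "g \<cdot> zr a b = zr a (Cod T g)"
proof -
  have b: "b \<in> Obj T" using assms by auto
  obtain z u v where z: "zero_obj T z" "u \<in> hom a z" "v \<in> hom z b" "zr a b = v \<cdot> u"
    using zr_zero_arr[OF assms(2) b] zero_arrE by blast
  then have "zero_arr T (g \<cdot> zr a b)"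
    unfolding zero_arr_def using assms b
    by (intro conjI exI[of _ z] exI[of _ u] exI[of _ "g \<cdot> v"]) (auto simp: hom_iff assoc)
  then show ?thesis using assms b by (simp add: zero_arr_iff)
qed

lemma zr_comp [simp]:
  assumes "f \<in> Arr T" "c \<in> Obj T" "Cod T f = b"
  shows "zr b c \<cdot> f = zr (Dom T f) c"
proof -
  have b: "b \<in> Obj T" using assms by auto
  obtain z u v where z: "zero_obj T z" "u \<in> hom b z" "v \<in> hom z c" "zr b c = v \<cdot> u"
    using zr_zero_arr[OF b assms(2)] zero_arrE by blast
  then have "zero_arr T (zr b c \<cdot> f)"
    unfolding zero_arr_def using assms b
    by (intro conjI exI[of _ z] exI[of _ "u \<cdot> f"] exI[of _ v]) (auto simp: hom_iff assoc)
  then show ?thesis using assms b by (simp add: zero_arr_iff)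
qed

lemma neg_unique:
  assumes "f \<in> Arr T" "g \<in> Arr T" "Dom T f = Dom T g" "Cod T f = Cod T g"
    "add f g = zr (Dom T f) (Cod T f)"
  shows "g = neg f"
proof -
  have "g = add (add (neg f) f) g" using assms neg(6)[of g] by simp
  also have "\<dots> = add (neg f) (add f g)" using assms by (subst add_assoc) auto
  also have "\<dots> = neg f" using assms neg(7)[of "neg f"] by simp
  finally show ?thesis .
qed

lemma comp_neg:
  assumes "f \<in> Arr T" "g \<in> Arr T" "Cod T f = Dom T g"
  shows "g \<cdot> neg f = neg (g \<cdot> f)"
  by (rule neg_unique) (use assms comp_add[of f "neg f" g] in auto)

lemma neg_comp:
  assumes "f \<in> Arr T" "g \<in> Arr T" "Cod T f = Dom T g"
  shows "neg g \<cdot> f = neg (g \<cdot> f)"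
  by (rule neg_unique) (use assms add_comp[of f g "neg g"] in auto)

lemma neg_zr [simp]: "a \<in> Obj T \<Longrightarrow> b \<in> Obj T \<Longrightarrow> neg (zr a b) = zr a b"
  by (metis neg(6) neg(7) neg_unique zr)

lemma mns [simp]:
  assumes "f \<in> Arr T" "g \<in> Arr T" "Dom T f = Dom T g" "Cod T f = Cod T g"
  shows "mns f g \<in> Arr T" "Dom T (mns f g) = Dom T f" "Cod T (mns f g) = Cod T f"
  using assms by (simp_all add: mns_def)

lemma add_mns:
  assumes "f \<in> Arr T" "g \<in> Arr T" "Dom T f = Dom T g" "Cod T f = Cod T g"
  shows "add g (mns f g) = f"
proof -
  have "add g (mns f g) = add g (add (neg g) f)" using assms by (simp add: mns_def add_comm)
  also have "\<dots> = add (add g (neg g)) f" using assms by (subst add_assoc) auto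
  also have "\<dots> = f" using assms neg(6)[of f] by simp
  finally show ?thesis .
qed

lemma mns_zr_iff:
  assumes "f \<in> Arr T" "g \<in> Arr T" "Dom T f = Dom T g" "Cod T f = Cod T g"
  shows "mns f g = zr (Dom T f) (Cod T f) \<longleftrightarrow> f = g"
  using add_mns[OF assms] neg(7)[of g] assms by (auto simp: mns_def)

lemma mns_comp:
  assumes "f \<in> Arr T" "g \<in> Arr T" "g' \<in> Arr T" "Cod T f = Dom T g" "Cod T f = Dom T g'" "Cod T g = Cod T g'"
  shows "mns g g' \<cdot> f = mns (g \<cdot> f) (g' \<cdot> f)"
  using assms by (simp add: mns_def add_comp neg_comp)

text \<open>\<open>additive_functor\<close> only asks for compatibility with sums. Applying
  \<open>\<Sigma>\<close> to 0 + 0 = 0 gives x + x = x, and subtracting x yields the claim.\<close>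

lemma shift_zr [simp]:
  assumes "a \<in> Obj T" "b \<in> Obj T"
  shows "\<Sigma> (zr a b) = zr (\<Sigma>\<^sub>o a) (\<Sigma>\<^sub>o b)"
proof -
  have "add (\<Sigma> (zr a b)) (\<Sigma> (zr a b)) = \<Sigma> (zr a b)"
    using shift_add[of "zr a b" "zr a b"] neg(6)[of "zr a b"] assms by simp
  then have "mns (add (\<Sigma> (zr a b)) (\<Sigma> (zr a b))) (\<Sigma> (zr a b)) = zr (\<Sigma>\<^sub>o a) (\<Sigma>\<^sub>o b)"
    using assms by (simp add: mns_def)
  then show ?thesis
    using assms neg(7)[of "\<Sigma> (zr a b)"] by (simp add: mns_def add_assoc)
qed

lemma shift_zero_iff:
  assumes "f \<in> hom a b" "\<Sigma> f = zr (\<Sigma>\<^sub>o a) (\<Sigma>\<^sub>o b)"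
  shows "f = zr a b"
  by (rule shift_inj) (use assms in \<open>auto simp: hom_iff\<close>)

text \<open>Turns the universal property of a zero object into one equation between arrows, which
  the shift visibly preserves.\<close>

lemma zero_obj_iff: "zero_obj T z \<longleftrightarrow> z \<in> Obj T \<and> Idn T z = zr z z"
proof
  assume z: "zero_obj T z"
  then show "z \<in> Obj T \<and> Idn T z = zr z z" using zero_objD[OF z] by simp
next
  assume z: "z \<in> Obj T \<and> Idn T z = zr z z"
  have "f = zr a z" if "f \<in> hom a z" for f a
    using that z comp_idn(2)[of f z] by (auto simp: hom_iff)
  moreover have "f = zr z a" if "f \<in> hom z a" for f a
    using that z comp_idn(1)[of f z] by (auto simp: hom_iff)
  ultimately show "zero_obj T z" unfolding zero_obj_def using z
    by (metis zr_zero_arr)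
qed

lemma zero_obj_shift: "zero_obj T z \<Longrightarrow> zero_obj T (\<Sigma>\<^sub>o z)"
  unfolding zero_obj_iff by (metis shift_idn shift_obj shift_zr)

section \<open>Distinguished triangles and exactness of Hom\<close>

lemma distE:
  assumes "(f, g, h) \<in> Dist T"
  obtains x y z where "f \<in> hom x y" "g \<in> hom y z" "h \<in> hom z (\<Sigma>\<^sub>o x)" "x \<in> Obj T" "y \<in> Obj T" "z \<in> Obj T"
  using dist_triangle[OF assms] that[of "Dom T f" "Dom T g" "Dom T h"]
  by (auto simp: is_triangle_def hom_iff)

lemma dist_rotate: "(f, g, h) \<in> Dist T \<Longrightarrow> (g, h, neg (\<Sigma> f)) \<in> Dist T"
  using dist_rot dist_triangle by blast

lemma dist_fillE:
  assumes "(f, g, h) \<in> Dist T" "f \<in> hom x y" "g \<in> hom y z"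
    and "(f', g', h') \<in> Dist T" "f' \<in> hom x' y'" "g' \<in> hom y' z'"
    and "a \<in> hom x x'" "b \<in> hom y y'" "b \<cdot> f = f' \<cdot> a"
  obtains c where "c \<in> hom z z'" "c \<cdot> g = g' \<cdot> b" "\<Sigma> a \<cdot> h = h' \<cdot> c"
proof -
  have d: "Dom T h = z" "Dom T h' = z'"
    using dist_triangle[OF assms(1)] dist_triangle[OF assms(4)] assms(3,6)
    by (auto simp: is_triangle_def hom_iff)
  obtain c where "triangle_map T (Shift T) (f, g, h) (f', g', h') (a, b, c)"
    using dist_fill[OF assms(1,4), of a b] assms by (auto simp: hom_iff)
  then show ?thesis using d that by (auto simp: triangle_map_def)
qed

lemma dist_zero_right:
  assumes "n \<in> Obj T" "zero_obj T z"
  shows "(Idn T n, zr n z, zr z (\<Sigma>\<^sub>o n)) \<in> Dist T"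
  using dist_idn[OF assms] zero_objD(1)[OF assms(2)] assms(1) by (simp add: hom_iff)

text \<open>Rotating this candidate gives the identity triangle of \<open>n\<close> whose third
  vertex is the suspension of \<open>z\<close>, again a zero object. The sign produced by the
  rotation disappears because the map it affects is zero.\<close>

lemma dist_zero_left:
  assumes "n \<in> Obj T" "zero_obj T z"
  shows "(zr z n, Idn T n, zr n (\<Sigma>\<^sub>o z)) \<in> Dist T"
proof -
  have z: "z \<in> Obj T" using zero_objD(1)[OF assms(2)] .
  have "(Idn T n, zr n (\<Sigma>\<^sub>o z), zr (\<Sigma>\<^sub>o z) (\<Sigma>\<^sub>o n)) \<in> Dist T"
    by (rule dist_zero_right) (use assms zero_obj_shift in auto)
  then show ?thesis
    using dist_rot[of "zr z n" "Idn T n" "zr n (\<Sigma>\<^sub>o z)"] z assms(1) by (simp add: is_triangle_def)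
qed

text \<open>Fill in a map from the identity triangle of \<open>x\<close> to the given one. Its third
  component starts at a zero object, and \<open>g \<cdot> f\<close> factors through it.\<close>

lemma dist_comp_zero:
  assumes "(f, g, h) \<in> Dist T" "f \<in> hom x y" "g \<in> hom y z"
  shows "g \<cdot> f = zr x z"
proof -
  obtain o' where o: "zero_obj T o'" using zero_exists by blast
  have x: "x \<in> Obj T" "o' \<in> Obj T" "z \<in> Obj T" using assms(2,3) zero_objD(1)[OF o] by (auto simp: hom_iff)
  have i: "Idn T x \<in> hom x x" and z: "zr x o' \<in> hom x o'"
    using x by (simp_all add: hom_iff)
  obtain c where c: "c \<in> hom o' z" "c \<cdot> zr x o' = g \<cdot> f"
    by (rule dist_fillE[OF dist_zero_right[OF x(1) o] i z assms i assms(2) refl])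
  have "c \<cdot> zr x o' = zr x z" using comp_zr[of c x o'] c(1) x by (simp add: hom_iff)
  then show ?thesis using c(2) by simp
qed

text \<open>Exactness of Hom(-, n) at \<open>y\<close>: fill in a map to the triangle 0, n, n; its
  third component is the extension.\<close>

lemma dist_extend:
  assumes "(f, g, h) \<in> Dist T" "f \<in> hom x y" "g \<in> hom y z"
    and "k \<in> hom y n" "k \<cdot> f = zr x n"
  obtains l where "l \<in> hom z n" "l \<cdot> g = k"
proof -
  obtain o' where o: "zero_obj T o'" using zero_exists by blast
  have x: "x \<in> Obj T" "o' \<in> Obj T" "n \<in> Obj T" using assms(2,4) zero_objD(1)[OF o] by (auto simp: hom_iff)
  have z: "zr x o' \<in> hom x o'" "k \<cdot> f = zr o' n \<cdot> zr x o'" "zr o' n \<in> hom o' n" "Idn T n \<in> hom n n"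
    using x assms(5) by (simp_all add: hom_iff)
  obtain c where c: "c \<in> hom z n" "c \<cdot> g = Idn T n \<cdot> k"
    by (rule dist_fillE[OF assms(1-3) dist_zero_left[OF x(3) o] z(3,4,1) assms(4) z(2)])
  then show ?thesis using that assms(4) by (simp add: hom_iff)
qed

lemma dist_extend':
  assumes "(f, g, h) \<in> Dist T" "g \<in> hom y z" "h \<in> hom z w"
    and "k \<in> hom z n" "k \<cdot> g = zr y n"
  obtains l where "l \<in> hom w n" "l \<cdot> h = k"
  using dist_extend[OF dist_rotate[OF assms(1)] assms(2-5)] .

text \<open>Two rotations reach this place of the long exact sequence, at the price of the map
  \<open>neg (\<Sigma> f)\<close>; the sign is moved to the extension.\<close>

lemma dist_extend'':
  assumes "(f, g, h) \<in> Dist T" "f \<in> hom x y" "h \<in> hom z (\<Sigma>\<^sub>o x)"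
    and "k \<in> hom (\<Sigma>\<^sub>o x) n" "k \<cdot> h = zr z n"
  obtains l where "l \<in> hom (\<Sigma>\<^sub>o y) n" "l \<cdot> \<Sigma> f = k"
proof -
  have "neg (\<Sigma> f) \<in> hom (\<Sigma>\<^sub>o x) (\<Sigma>\<^sub>o y)" using assms(2) by (simp add: hom_iff)
  from dist_extend'[OF dist_rotate[OF assms(1)] assms(3) this assms(4,5)]
  obtain l where l: "l \<in> hom (\<Sigma>\<^sub>o y) n" "l \<cdot> neg (\<Sigma> f) = k" .
  have "neg l \<in> hom (\<Sigma>\<^sub>o y) n" "neg l \<cdot> \<Sigma> f = k"
    using l assms(2) by (auto simp: hom_iff comp_neg neg_comp)
  then show ?thesis using that by blast
qed

text \<open>Exactness of Hom(w, -) at \<open>y\<close>. The fill-in axiom produces third components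
  only, whereas the lift is a first component. Hence both triangles are rotated, the suspended lift
  is filled in, and it is desuspended because \<open>\<Sigma>\<close> is fully faithful; the signs
  of the two rotations cancel.\<close>

lemma dist_lift:
  assumes "(f, g, h) \<in> Dist T" "f \<in> hom x y" "g \<in> hom y z"
    and "k \<in> hom w y" "g \<cdot> k = zr w z"
  obtains l where "l \<in> hom w x" "f \<cdot> l = k"
proof -
  obtain o' where o: "zero_obj T o'" using zero_exists by blast
  have x: "w \<in> Obj T" "o' \<in> Obj T" "x \<in> Obj T" "z \<in> Obj T"
    using assms(2,3,4) zero_objD(1)[OF o] by (auto simp: hom_iff)
  have h: "h \<in> hom z (\<Sigma>\<^sub>o x)"
    using dist_triangle[OF assms(1)] assms(2,3) by (simp add: is_triangle_def hom_iff)
  have z: "zr w o' \<in> hom w o'" "zr o' (\<Sigma>\<^sub>o w) \<in> hom o' (\<Sigma>\<^sub>o w)" "zr o' z \<in> hom o' z"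
    "zr o' z \<cdot> zr w o' = g \<cdot> k"
    using x assms(5) by (simp_all add: hom_iff)
  obtain c where c: "c \<in> hom (\<Sigma>\<^sub>o w) (\<Sigma>\<^sub>o x)"
      "\<Sigma> k \<cdot> neg (\<Sigma> (Idn T w)) = neg (\<Sigma> f) \<cdot> c"
    by (rule dist_fillE[OF dist_rotate[OF dist_zero_right[OF x(1) o]] z(1,2) dist_rotate[OF assms(1)] assms(3) h assms(4) z(3,4)])
  obtain l where l: "l \<in> hom w x" "c = \<Sigma> l" using shift_surj[of c w x] c(1) x by (auto simp: hom_iff)
  have "neg (\<Sigma> k) = neg (\<Sigma> (f \<cdot> l))"
    using c(2) l x assms(2,4) by (simp add: hom_iff comp_neg neg_comp shift_comp)
  then have "\<Sigma> k = \<Sigma> (f \<cdot> l)"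
    using neg(8)[of "\<Sigma> k"] neg(8)[of "\<Sigma> (f \<cdot> l)"] l(1) assms(2,4) by (simp add: hom_iff)
  then have "f \<cdot> l = k" using shift_inj[of k "f \<cdot> l"] l(1) assms(2,4) by (simp add: hom_iff)
  then show ?thesis using that l(1) by blast
qed

lemma dist_lift':
  assumes "(f, g, h) \<in> Dist T" "g \<in> hom y z" "h \<in> hom z w"
    and "k \<in> hom v z" "h \<cdot> k = zr v w"
  obtains l where "l \<in> hom v y" "g \<cdot> l = k"
  using dist_lift[OF dist_rotate[OF assms(1)] assms(2-5)] .

subsection \<open>Orthogonal objects\<close>

definition orth :: "'o set \<Rightarrow> 'o set" where
  "orth S = {n \<in> Obj T. \<forall>a\<in>S. \<forall>k\<in>hom a n. k = zr a n}"

text \<open>In the language of Bousfield localization these are the \<open>S\<close>-local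
  equivalences, and the members of \<open>orth S\<close> are the local objects.\<close>

definition orth_equiv :: "'o set \<Rightarrow> 'm \<Rightarrow> bool" where
  "orth_equiv S u \<longleftrightarrow> u \<in> Arr T \<and>
     (\<forall>n\<in>orth S. \<forall>k\<in>hom (Dom T u) n. \<exists>!l. l \<in> hom (Cod T u) n \<and> l \<cdot> u = k)"

lemma orth_obj: "n \<in> orth S \<Longrightarrow> n \<in> Obj T"
  by (simp add: orth_def)

lemma orthD: "\<lbrakk>n \<in> orth S; k \<in> hom a n; a \<in> S\<rbrakk> \<Longrightarrow> k = zr a n"
  by (simp add: orth_def)

lemma orth_equiv_ex1:
  assumes "orth_equiv S u" "u \<in> hom x y" "n \<in> orth S" "k \<in> hom x n"
  shows "\<exists>!l. l \<in> hom y n \<and> l \<cdot> u = k"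
proof -
  have "Dom T u = x" "Cod T u = y" using assms(2) by (simp_all add: hom_iff)
  then show ?thesis using assms(1,3,4) unfolding orth_equiv_def by blast
qed

lemma orth_equiv_extend:
  assumes "orth_equiv S u" "u \<in> hom x y" "n \<in> orth S" "k \<in> hom x n"
  obtains l where "l \<in> hom y n" "l \<cdot> u = k"
  using orth_equiv_ex1[OF assms] by blast

lemma orth_equiv_cancel:
  assumes "orth_equiv S u" "u \<in> hom x y" "n \<in> orth S" "k \<in> hom y n" "l \<in> hom y n" "k \<cdot> u = l \<cdot> u"
  shows "k = l"
proof -
  have "k \<cdot> u \<in> hom x n" using assms(2,4) by (simp add: hom_iff)
  from orth_equiv_ex1[OF assms(1-3) this] show ?thesis using assms(4-6) by auto
qed

text \<open>Since homs are groups, uniqueness of extensions amounts to a trivial kernel; it is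
  applied to the difference of two extensions.\<close>

lemma orth_equivI:
  assumes "u \<in> hom x y"
    and "\<And>n k. n \<in> orth S \<Longrightarrow> k \<in> hom x n \<Longrightarrow> \<exists>l\<in>hom y n. l \<cdot> u = k"
    and "\<And>n l. n \<in> orth S \<Longrightarrow> l \<in> hom y n \<Longrightarrow> l \<cdot> u = zr x n \<Longrightarrow> l = zr y n"
  shows "orth_equiv S u"
proof -
  have "\<exists>!l. l \<in> hom y n \<and> l \<cdot> u = k" if n: "n \<in> orth S" and k: "k \<in> hom x n" for n k
  proof (rule ex_ex1I)
    show "\<exists>l. l \<in> hom y n \<and> l \<cdot> u = k" using assms(2)[OF n k] by blast
    fix l l' assume l: "l \<in> hom y n \<and> l \<cdot> u = k" "l' \<in> hom y n \<and> l' \<cdot> u = k"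
    then have m: "mns l l' \<in> hom y n" by (simp add: hom_iff)
    have "mns l l' \<cdot> u = mns k k" using l assms(1) by (simp add: hom_iff mns_comp)
    also have "\<dots> = zr x n" using mns_zr_iff[of k k] k by (simp add: hom_iff)
    finally have "mns l l' = zr y n" by (rule assms(3)[OF n m])
    then show "l = l'" using mns_zr_iff[of l l'] l by (simp add: hom_iff)
  qed
  moreover have "u \<in> Arr T" "Dom T u = x" "Cod T u = y" using assms(1) by (simp_all add: hom_iff)
  ultimately show ?thesis unfolding orth_equiv_def by simp
qed

text \<open>A Yoneda argument among orthogonal objects: the inverse is the extension of the identity
  of \<open>x\<close> along \<open>u\<close>. This is how every isomorphism below arises.\<close>

lemma orth_equiv_iso:
  assumes "orth_equiv S u" "u \<in> hom x y" "x \<in> orth S" "y \<in> orth S"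
  shows "is_iso T u"
proof -
  have x: "x \<in> Obj T" "y \<in> Obj T" using assms orth_obj by auto
  obtain v where v: "v \<in> hom y x" "v \<cdot> u = Idn T x"
    using orth_equiv_extend[OF assms(1-3), of "Idn T x"] x by (auto simp: hom_iff)
  have "u \<cdot> v = Idn T y"
    by (rule orth_equiv_cancel[OF assms(1,2,4)]) (use v x assms(2) in \<open>auto simp: hom_iff assoc\<close>)
  then show ?thesis using isoI[OF assms(2) v(1)] v(2) by simp
qed

lemma iso_cancel_right:
  assumes "is_iso T j" "j \<in> hom b a" "k \<in> hom a n" "k \<cdot> j = zr b n"
  shows "k = zr a n"
proof -
  obtain i where i: "i \<in> hom a b" "j \<cdot> i = Idn T a"
    using isoE[OF assms(1)] assms(2) by (auto simp: hom_iff)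
  have "k = k \<cdot> j \<cdot> i" using i assms(2,3) by (simp add: hom_iff assoc)
  also have "\<dots> = zr a n" unfolding assms(4) using zr_comp[of i n b] i(1) assms(3) by (auto simp: hom_iff)
  finally show ?thesis .
qed

lemma iso_cancel_left:
  assumes "is_iso T j" "j \<in> hom n m" "k \<in> hom a n" "j \<cdot> k = zr a m"
  shows "k = zr a n"
proof -
  obtain i where i: "i \<in> hom m n" "i \<cdot> j = Idn T n"
    using isoE[OF assms(1)] assms(2) by (auto simp: hom_iff)
  have "k = i \<cdot> j \<cdot> k" using i assms(2,3) by (simp add: hom_iff)
  also have "\<dots> = i \<cdot> zr a m" using i(1) assms(2-4) by (simp add: hom_iff assoc)
  also have "\<dots> = zr a n" using comp_zr[of i a m] i(1) assms(3) by (auto simp: hom_iff)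
  finally show ?thesis .
qed

lemma iso_inverse:
  assumes "is_iso T j" "j \<in> hom a b"
  obtains i where "is_iso T i" "i \<in> hom b a" "i \<cdot> j = Idn T a" "j \<cdot> i = Idn T b"
proof -
  obtain i where i: "i \<in> hom b a" "i \<cdot> j = Idn T a" "j \<cdot> i = Idn T b"
    using isoE[OF assms(1)] assms(2) by (auto simp: hom_iff)
  show ?thesis by (rule that[OF isoI[OF i(1) assms(2) i(3,2)] i])
qed

lemma orth_iso:
  assumes "n \<in> orth S" "is_iso T j" "j \<in> hom n m"
  shows "m \<in> orth S"
proof -
  obtain i where i: "is_iso T i" "i \<in> hom m n" using iso_inverse[OF assms(2,3)] by metis
  have "k = zr a m" if "a \<in> S" "k \<in> hom a m" for a k
  proof (rule iso_cancel_left[OF i that(2)])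
    show "i \<cdot> k = zr a n"
      by (rule orthD[OF assms(1) _ that(1)]) (use i(2) that(2) in \<open>simp add: hom_iff\<close>)
  qed
  moreover have "m \<in> Obj T" using assms(3) by (auto simp: hom_iff)
  ultimately show ?thesis by (simp add: orth_def)
qed

lemma iso_orth_equiv:
  assumes "is_iso T u" "u \<in> hom x y"
  shows "orth_equiv S u"
proof -
  obtain i where i: "i \<in> hom y x" "i \<cdot> u = Idn T x" using iso_inverse[OF assms] by metis
  show ?thesis
  proof (rule orth_equivI[OF assms(2)])
    fix n k assume "k \<in> hom x n"
    then show "\<exists>l\<in>hom y n. l \<cdot> u = k" using i assms(2)
      by (intro bexI[of _ "k \<cdot> i"]) (simp_all add: hom_iff assoc)
  next
    fix n l assume "l \<in> hom y n" "l \<cdot> u = zr x n"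
    then show "l = zr y n" using iso_cancel_right[OF assms] by blast
  qed
qed

lemma orth_equiv_comp:
  assumes "orth_equiv S u" "orth_equiv S v" "u \<in> hom x y" "v \<in> hom y z"
  shows "orth_equiv S (v \<cdot> u)"
proof (rule orth_equivI)
  show "v \<cdot> u \<in> hom x z" using assms by (simp add: hom_iff)
  fix n k assume n: "n \<in> orth S"
  show "\<exists>l\<in>hom z n. l \<cdot> (v \<cdot> u) = k" if k: "k \<in> hom x n"
  proof -
    obtain m where m: "m \<in> hom y n" "m \<cdot> u = k" by (rule orth_equiv_extend[OF assms(1,3) n k])
    obtain l where l: "l \<in> hom z n" "l \<cdot> v = m" by (rule orth_equiv_extend[OF assms(2,4) n m(1)])
    have "l \<cdot> (v \<cdot> u) = k" using assoc[of u v l] m l assms(3,4) by (simp add: hom_iff)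
    then show ?thesis using l(1) by blast
  qed
  show "k = zr z n" if k: "k \<in> hom z n" "k \<cdot> (v \<cdot> u) = zr x n"
  proof (rule orth_equiv_cancel[OF assms(2,4) n k(1)])
    have o: "n \<in> Obj T" "y \<in> Obj T" "z \<in> Obj T" using orth_obj[OF n] assms(4) by (auto simp: hom_iff)
    show "zr z n \<in> hom z n" using o by (simp add: hom_iff)
    have "k \<cdot> v = zr y n"
      by (rule orth_equiv_cancel[OF assms(1,3) n]) (use k o assms(3,4) in \<open>simp_all add: hom_iff assoc\<close>)
    then show "k \<cdot> v = zr z n \<cdot> v" using o assms(4) by (simp add: hom_iff)
  qed
qed

text \<open>The half of two-out-of-three that recognizes comparison maps: \<open>v\<close> is
  defined by prescribing \<open>v \<cdot> u\<close>, and both \<open>u\<close> and the prescribed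
  map are known to be local equivalences.\<close>

lemma orth_equiv_cancel_right:
  assumes "orth_equiv S u" "orth_equiv S (v \<cdot> u)" "u \<in> hom x y" "v \<in> hom y z"
  shows "orth_equiv S v"
proof (rule orth_equivI[OF assms(4)])
  have vu: "v \<cdot> u \<in> hom x z" using assms by (simp add: hom_iff)
  fix n k assume n: "n \<in> orth S"
  show "\<exists>l\<in>hom z n. l \<cdot> v = k" if k: "k \<in> hom y n"
  proof -
    have "k \<cdot> u \<in> hom x n" using assms k by (simp add: hom_iff)
    then obtain l where l: "l \<in> hom z n" "l \<cdot> (v \<cdot> u) = k \<cdot> u"
      by (rule orth_equiv_extend[OF assms(2) vu n])
    have "l \<cdot> v = k"
      by (rule orth_equiv_cancel[OF assms(1,3) n]) (use k l assms(3,4) in \<open>simp_all add: hom_iff assoc\<close>)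
    then show ?thesis using l(1) by blast
  qed
  show "k = zr z n" if k: "k \<in> hom z n" "k \<cdot> v = zr y n"
  proof (rule orth_equiv_cancel[OF assms(2) vu n k(1)])
    have o: "n \<in> Obj T" "z \<in> Obj T" "y \<in> Obj T" using orth_obj[OF n] assms(4) by (auto simp: hom_iff)
    show "zr z n \<in> hom z n" using o by (simp add: hom_iff)
    have "k \<cdot> (v \<cdot> u) = zr y n \<cdot> u" using assoc[of u v k] k assms(3,4) by (simp add: hom_iff)
    then show "k \<cdot> (v \<cdot> u) = zr z n \<cdot> (v \<cdot> u)" using o assms(3,4) by (simp add: hom_iff)
  qed
qed

end

section \<open>Orthogonality to a triangulated subcategory\<close>

locale tri_sub = tri_cat T for T :: "('o, 'm) tcat" +
  fixes S :: "'o set"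
  assumes sub: "triangulated_subcat T S"
begin

lemma sub_obj: "a \<in> S \<Longrightarrow> a \<in> Obj T"
  and sub_iso: "\<lbrakk>is_iso T f; f \<in> hom a b; a \<in> S\<rbrakk> \<Longrightarrow> b \<in> S"
  and sub_shift: "a \<in> Obj T \<Longrightarrow> a \<in> S \<longleftrightarrow> \<Sigma>\<^sub>o a \<in> S"
  and sub_cone: "\<lbrakk>(f, g, h) \<in> Dist T; f \<in> hom a b; g \<in> hom b c; a \<in> S; b \<in> S\<rbrakk> \<Longrightarrow> c \<in> S"
  using sub unfolding triangulated_subcat_def hom_iff by blast+

text \<open>The shift is essentially surjective but not bijective on objects, so a desuspension
  exists only up to the isomorphism \<open>j\<close>.\<close>

lemma sub_desuspend:
  assumes "a \<in> S"
  obtains b j where "b \<in> S" "j \<in> hom (\<Sigma>\<^sub>o b) a" "is_iso T j"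
proof -
  obtain b j where j: "b \<in> Obj T" "j \<in> hom (\<Sigma>\<^sub>o b) a" "is_iso T j"
    using shift_ess[OF sub_obj[OF assms]] by blast
  obtain i where i: "is_iso T i" "i \<in> hom a (\<Sigma>\<^sub>o b)" by (rule iso_inverse[OF j(3,2)])
  have "b \<in> S" using sub_iso[OF i assms] sub_shift[OF j(1)] by simp
  then show ?thesis using that j by blast
qed

text \<open>\<open>S\<close> is closed under desuspension up to isomorphism, so a map from
  \<open>S\<close> to a suspension is, up to isomorphism, the suspension of a map from
  \<open>S\<close> to \<open>n\<close>.\<close>

lemma shift_orth:
  assumes "n \<in> orth S"
  shows "\<Sigma>\<^sub>o n \<in> orth S"
proof -
  have n: "n \<in> Obj T" using orth_obj[OF assms] .
  have "k = zr a (\<Sigma>\<^sub>o n)" if a: "a \<in> S" and k: "k \<in> hom a (\<Sigma>\<^sub>o n)" for a k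
  proof -
    obtain b j where j: "b \<in> S" "j \<in> hom (\<Sigma>\<^sub>o b) a" "is_iso T j" by (rule sub_desuspend[OF a])
    have b: "b \<in> Obj T" using sub_obj[OF j(1)] .
    obtain y where y: "y \<in> hom b n" "k \<cdot> j = \<Sigma> y"
      using shift_surj[of "k \<cdot> j" b n] k j(2) b n by (auto simp: hom_iff)
    have "k \<cdot> j = zr (\<Sigma>\<^sub>o b) (\<Sigma>\<^sub>o n)" using y orthD[OF assms y(1) j(1)] b n by simp
    then show ?thesis by (rule iso_cancel_right[OF j(3,2) k])
  qed
  then show ?thesis using n by (simp add: orth_def)
qed

lemma unshift_orth:
  assumes "\<Sigma>\<^sub>o n \<in> orth S" "n \<in> Obj T"
  shows "n \<in> orth S"
proof -
  have "k = zr a n" if a: "a \<in> S" and k: "k \<in> hom a n" for a k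
  proof (rule shift_zero_iff[OF k])
    show "\<Sigma> k = zr (\<Sigma>\<^sub>o a) (\<Sigma>\<^sub>o n)"
      by (rule orthD[OF assms(1)]) (use a k sub_shift[OF sub_obj] in \<open>auto simp: hom_iff\<close>)
  qed
  then show ?thesis using assms(2) by (simp add: orth_def)
qed

text \<open>For \<open>a\<close> in \<open>S\<close>, Hom(a, z) sits between Hom(a, y) and Hom from
  \<open>a\<close> to the suspension of \<open>x\<close>, both of which vanish.\<close>

lemma orth_cone:
  assumes "(f, g, h) \<in> Dist T" "f \<in> hom x y" "g \<in> hom y z" "x \<in> orth S" "y \<in> orth S"
  shows "z \<in> orth S"
proof -
  have h: "h \<in> hom z (\<Sigma>\<^sub>o x)"
    using dist_triangle[OF assms(1)] assms(2,3) by (simp add: is_triangle_def hom_iff)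
  have z: "z \<in> Obj T" using h by (auto simp: hom_iff)
  have "k = zr a z" if a: "a \<in> S" and k: "k \<in> hom a z" for a k
  proof -
    have "h \<cdot> k = zr a (\<Sigma>\<^sub>o x)"
      by (rule orthD[OF shift_orth[OF assms(4)] _ a]) (use h k in \<open>simp add: hom_iff\<close>)
    then obtain l where l: "l \<in> hom a y" "g \<cdot> l = k" by (rule dist_lift'[OF assms(1,3) h k])
    have "l = zr a y" by (rule orthD[OF assms(5) l(1) a])
    then show ?thesis using l(2) comp_zr[of g a y] assms(3) sub_obj[OF a] by (simp add: hom_iff)
  qed
  then show ?thesis using z by (simp add: orth_def)
qed

text \<open>In the exact sequence of Hom(-, n), restriction along \<open>g\<close> is flanked by the
  maps out of \<open>x\<close> and out of its suspension. Both sources lie in \<open>S\<close>, so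
  both groups vanish for orthogonal \<open>n\<close>.\<close>

lemma cone_orth_equiv:
  assumes "(f, g, h) \<in> Dist T" "f \<in> hom x y" "g \<in> hom y z" "x \<in> S"
  shows "orth_equiv S g"
proof (rule orth_equivI[OF assms(3)])
  have h: "h \<in> hom z (\<Sigma>\<^sub>o x)"
    using dist_triangle[OF assms(1)] assms(2,3) by (simp add: is_triangle_def hom_iff)
  have x: "x \<in> Obj T" using sub_obj[OF assms(4)] .
  fix n k assume n: "n \<in> orth S"
  show "\<exists>l\<in>hom z n. l \<cdot> g = k" if k: "k \<in> hom y n"
  proof -
    have "k \<cdot> f = zr x n"
      by (rule orthD[OF n _ assms(4)]) (use assms(2) k in \<open>simp add: hom_iff\<close>)
    then show ?thesis using dist_extend[OF assms(1-3) k] by metis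
  qed
  show "k = zr z n" if k: "k \<in> hom z n" "k \<cdot> g = zr y n"
  proof -
    obtain m where m: "m \<in> hom (\<Sigma>\<^sub>o x) n" "m \<cdot> h = k" by (rule dist_extend'[OF assms(1,3) h k])
    have "m = zr (\<Sigma>\<^sub>o x) n" by (rule orthD[OF n m(1)]) (use sub_shift[OF x] assms(4) in simp)
    then show ?thesis using m(2) h orth_obj[OF n] by (simp add: hom_iff)
  qed
qed

text \<open>A general target \<open>n\<close> is replaced by an isomorphic suspension of some
  \<open>m\<close>. Then \<open>m\<close> is again orthogonal and the extension problem along
  \<open>\<Sigma> u\<close> desuspends to one along \<open>u\<close>.\<close>

lemma shift_orth_equiv:
  assumes "orth_equiv S u" "u \<in> hom x y"
  shows "orth_equiv S (\<Sigma> u)"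
proof (rule orth_equivI)
  show "\<Sigma> u \<in> hom (\<Sigma>\<^sub>o x) (\<Sigma>\<^sub>o y)" using assms(2) by (simp add: hom_iff)
  have o: "x \<in> Obj T" "y \<in> Obj T" using assms(2) by (auto simp: hom_iff)
  fix n k assume n: "n \<in> orth S"
  obtain m j where j: "m \<in> Obj T" "j \<in> hom (\<Sigma>\<^sub>o m) n" "is_iso T j"
    using shift_ess[OF orth_obj[OF n]] by blast
  obtain i where i: "is_iso T i" "i \<in> hom n (\<Sigma>\<^sub>o m)" "j \<cdot> i = Idn T n" by (rule iso_inverse[OF j(3,2)])
  have m: "m \<in> orth S" by (rule unshift_orth[OF orth_iso[OF n i(1,2)] j(1)])
  show "\<exists>l\<in>hom (\<Sigma>\<^sub>o y) n. l \<cdot> \<Sigma> u = k" if k: "k \<in> hom (\<Sigma>\<^sub>o x) n"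
  proof -
    obtain k' where k': "k' \<in> hom x m" "i \<cdot> k = \<Sigma> k'"
      using shift_surj[of "i \<cdot> k" x m] k i(2) o j(1) by (auto simp: hom_iff)
    obtain l where l: "l \<in> hom y m" "l \<cdot> u = k'" by (rule orth_equiv_extend[OF assms m k'(1)])
    have "j \<cdot> \<Sigma> l \<cdot> \<Sigma> u = j \<cdot> (i \<cdot> k)"
      using l j(2) assms(2) shift_comp[of u l] k'(2) by (simp add: hom_iff assoc)
    also have "\<dots> = k" using assoc[of k i j] i(2,3) j(2) k by (simp add: hom_iff)
    finally show ?thesis using l(1) j(2) by (intro bexI[of _ "j \<cdot> \<Sigma> l"]) (simp_all add: hom_iff)
  qed
  show "k = zr (\<Sigma>\<^sub>o y) n" if k: "k \<in> hom (\<Sigma>\<^sub>o y) n" "k \<cdot> \<Sigma> u = zr (\<Sigma>\<^sub>o x) n"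
  proof (rule iso_cancel_left[OF i(1,2) k(1)])
    obtain l where l: "l \<in> hom y m" "i \<cdot> k = \<Sigma> l"
      using shift_surj[of "i \<cdot> k" y m] k(1) i(2) o j(1) by (auto simp: hom_iff)
    have "\<Sigma> (l \<cdot> u) = \<Sigma> l \<cdot> \<Sigma> u" using l(1) assms(2) by (simp add: hom_iff shift_comp)
    also have "\<dots> = i \<cdot> zr (\<Sigma>\<^sub>o x) n"
      unfolding l(2)[symmetric] k(2)[symmetric] using k(1) i(2) assms(2) by (simp add: hom_iff assoc)
    also have "\<dots> = zr (\<Sigma>\<^sub>o x) (\<Sigma>\<^sub>o m)" using i(2) o by (simp add: hom_iff)
    finally have "l \<cdot> u = zr x m"
      by (rule shift_zero_iff[rotated]) (use l(1) assms(2) in \<open>simp add: hom_iff\<close>)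
    then have "l \<cdot> u = zr y m \<cdot> u" using o j(1) assms(2) by (simp add: hom_iff)
    from orth_equiv_cancel[OF assms m l(1) _ this] have "l = zr y m"
      using o j(1) by (simp add: hom_iff)
    then show "i \<cdot> k = zr (\<Sigma>\<^sub>o y) (\<Sigma>\<^sub>o m)" using l(2) o j(1) by simp
  qed
qed

text \<open>The five lemma for the sequences obtained from Hom(-, n) with \<open>n\<close>
  orthogonal. The outer isomorphisms come from \<open>a\<close>, \<open>b\<close> and, by
  \<open>shift_orth_equiv\<close>, from their suspensions.\<close>

lemma orth_equiv_five:
  assumes D: "(f, g, h) \<in> Dist T" "f \<in> hom x y" "g \<in> hom y z" "h \<in> hom z (\<Sigma>\<^sub>o x)"
    and D': "(f', g', h') \<in> Dist T" "f' \<in> hom x' y'" "g' \<in> hom y' z'" "h' \<in> hom z' (\<Sigma>\<^sub>o x')"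
    and a: "a \<in> hom x x'" and b: "b \<in> hom y y'" and c: "c \<in> hom z z'"
    and fa: "b \<cdot> f = f' \<cdot> a" and gb: "c \<cdot> g = g' \<cdot> b" and hc: "\<Sigma> a \<cdot> h = h' \<cdot> c"
    and aS: "orth_equiv S a" and bS: "orth_equiv S b"
  shows "orth_equiv S c"
proof (rule orth_equivI[OF c])
  have o: "x \<in> Obj T" "y \<in> Obj T" "z \<in> Obj T" "x' \<in> Obj T" "y' \<in> Obj T" "z' \<in> Obj T"
    using a b c by (auto simp: hom_iff)
  have sa: "\<Sigma> a \<in> hom (\<Sigma>\<^sub>o x) (\<Sigma>\<^sub>o x')" "orth_equiv S (\<Sigma> a)"
    and sb: "\<Sigma> b \<in> hom (\<Sigma>\<^sub>o y) (\<Sigma>\<^sub>o y')" "orth_equiv S (\<Sigma> b)"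
    using a b shift_orth_equiv[OF aS a] shift_orth_equiv[OF bS b] by (simp_all add: hom_iff)
  have sf: "\<Sigma> b \<cdot> \<Sigma> f = \<Sigma> f' \<cdot> \<Sigma> a"
    using shift_comp[of f b] shift_comp[of a f'] fa D(2) D'(2) a b by (simp add: hom_iff)
  \<comment> \<open>Two rotations put \<open>h'\<close> in first place, followed by
    \<open>neg (\<Sigma> f')\<close>; the sign then has to be removed.\<close>
  have sf0: "\<Sigma> f' \<cdot> h' = zr z' (\<Sigma>\<^sub>o y')"
  proof -
    have "neg (\<Sigma> f') \<cdot> h' = zr z' (\<Sigma>\<^sub>o y')"
      by (rule dist_comp_zero[OF dist_rotate[OF dist_rotate[OF D'(1)]] D'(4)])
        (use D'(2) in \<open>simp add: hom_iff\<close>)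
    then have "neg (\<Sigma> f' \<cdot> h') = zr z' (\<Sigma>\<^sub>o y')" using D'(2,4) by (simp add: hom_iff neg_comp)
    moreover have "\<Sigma> f' \<cdot> h' = neg (neg (\<Sigma> f' \<cdot> h'))"
      by (rule neg(8)[symmetric]) (use D'(2,4) in \<open>simp add: hom_iff\<close>)
    ultimately show ?thesis using o by simp
  qed
  fix n k assume n: "n \<in> orth S"
  have no: "n \<in> Obj T" using orth_obj[OF n] .
  show "\<exists>l\<in>hom z' n. l \<cdot> c = k" if k: "k \<in> hom z n"
  proof -
    have kg: "k \<cdot> g \<in> hom y n" using k D(3) by (simp add: hom_iff)
    obtain l where l: "l \<in> hom y' n" "l \<cdot> b = k \<cdot> g" by (rule orth_equiv_extend[OF bS b n kg])
    \<comment> \<open>That \<open>l\<close> vanishes on \<open>f'\<close> is tested after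
      precomposing with \<open>a\<close>, where it becomes
      \<open>k \<cdot> g \<cdot> f\<close>.\<close>
    have "l \<cdot> f' \<cdot> a = zr x' n \<cdot> a"
    proof -
      have "l \<cdot> f' \<cdot> a = l \<cdot> b \<cdot> f" using l(1) D'(2) a b D(2) fa by (simp add: hom_iff assoc)
      also have "\<dots> = k \<cdot> (g \<cdot> f)" unfolding l(2) using k D(2,3) by (simp add: hom_iff assoc)
      also have "\<dots> = zr x n" unfolding dist_comp_zero[OF D(1-3)] using k o by (simp add: hom_iff)
      finally show ?thesis using a no by (simp add: hom_iff)
    qed
    from orth_equiv_cancel[OF aS a n _ _ this] have "l \<cdot> f' = zr x' n"
      using l(1) D'(2) o no by (simp add: hom_iff)
    then obtain m where m: "m \<in> hom z' n" "m \<cdot> g' = l" by (rule dist_extend[OF D'(1-3) l(1)])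
    have mc: "m \<cdot> c \<in> hom z n" using m(1) c by (simp add: hom_iff)
    have "m \<cdot> c \<cdot> g = m \<cdot> g' \<cdot> b" using m(1) c D(3) D'(3) b gb by (simp add: hom_iff assoc)
    then have "k \<cdot> g = m \<cdot> c \<cdot> g" unfolding m(2) l(2) by simp
    then have "mns k (m \<cdot> c) \<cdot> g = zr y n"
      using mns_comp[of g k "m \<cdot> c"] mns_zr_iff[of "k \<cdot> g" "m \<cdot> c \<cdot> g"] k mc D(3) by (simp add: hom_iff)
    moreover have d: "mns k (m \<cdot> c) \<in> hom z n" using k mc by (simp add: hom_iff)
    ultimately obtain p where p: "p \<in> hom (\<Sigma>\<^sub>o x) n" "p \<cdot> h = mns k (m \<cdot> c)"
      using dist_extend'[OF D(1,3,4)] by metis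
    obtain p' where p': "p' \<in> hom (\<Sigma>\<^sub>o x') n" "p' \<cdot> \<Sigma> a = p"
      by (rule orth_equiv_extend[OF sa(2,1) n p(1)])
    \<comment> \<open>The first approximation \<open>m\<close> agrees with \<open>k\<close> only
      after restriction along \<open>g\<close>. The error factors through \<open>h\<close>, and its
      factor \<open>p\<close> extends along \<open>\<Sigma> a\<close>; this gives the correction
      \<open>p' \<cdot> h'\<close>.\<close>
    have "add m (p' \<cdot> h') \<cdot> c = add (m \<cdot> c) (p' \<cdot> (h' \<cdot> c))"
      using add_comp[of c m "p' \<cdot> h'"] m(1) p'(1) c D'(4) by (simp add: hom_iff assoc)
    also have "p' \<cdot> (h' \<cdot> c) = mns k (m \<cdot> c)"
      unfolding hc[symmetric] p(2)[symmetric] p'(2)[symmetric] using p'(1) sa(1) D(4) by (simp add: hom_iff assoc)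
    also have "add (m \<cdot> c) (mns k (m \<cdot> c)) = k" using add_mns[of k "m \<cdot> c"] k mc by (simp add: hom_iff)
    finally show ?thesis
      using m(1) p'(1) D'(4) by (intro bexI[of _ "add m (p' \<cdot> h')"]) (simp_all add: hom_iff)
  qed
  show "k = zr z' n" if k: "k \<in> hom z' n" "k \<cdot> c = zr z n"
  proof -
    have "k \<cdot> g' = zr y' n"
    proof (rule orth_equiv_cancel[OF bS b n])
      show "k \<cdot> g' \<in> hom y' n" "zr y' n \<in> hom y' n" using k(1) D'(3) o no by (simp_all add: hom_iff)
      have "k \<cdot> g' \<cdot> b = k \<cdot> c \<cdot> g" using k(1) D'(3) b c D(3) gb by (simp add: hom_iff assoc)
      then show "k \<cdot> g' \<cdot> b = zr y' n \<cdot> b" unfolding k(2) using b D(3) no by (simp add: hom_iff)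
    qed
    then obtain m where m: "m \<in> hom (\<Sigma>\<^sub>o x') n" "m \<cdot> h' = k" by (rule dist_extend'[OF D'(1,3,4) k(1)])
    have msa: "m \<cdot> \<Sigma> a \<in> hom (\<Sigma>\<^sub>o x) n" using m(1) sa(1) by (simp add: hom_iff)
    have "m \<cdot> \<Sigma> a \<cdot> h = m \<cdot> h' \<cdot> c" using m(1) sa(1) D(4) D'(4) c hc by (simp add: hom_iff assoc)
    then have "m \<cdot> \<Sigma> a \<cdot> h = zr z n" unfolding m(2) k(2) .
    then obtain p where p: "p \<in> hom (\<Sigma>\<^sub>o y) n" "p \<cdot> \<Sigma> f = m \<cdot> \<Sigma> a"
      by (rule dist_extend''[OF D(1,2,4) msa])
    obtain p' where p': "p' \<in> hom (\<Sigma>\<^sub>o y') n" "p' \<cdot> \<Sigma> b = p"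
      by (rule orth_equiv_extend[OF sb(2,1) n p(1)])
    have sf': "\<Sigma> f \<in> hom (\<Sigma>\<^sub>o x) (\<Sigma>\<^sub>o y)" "\<Sigma> f' \<in> hom (\<Sigma>\<^sub>o x') (\<Sigma>\<^sub>o y')"
      using D(2) D'(2) by (simp_all add: hom_iff)
    \<comment> \<open>\<open>m\<close> itself need not vanish. It is shown to factor through
      \<open>\<Sigma> f'\<close>, which already kills its composite with \<open>h'\<close>.\<close>
    have "m = p' \<cdot> \<Sigma> f'"
    proof (rule orth_equiv_cancel[OF sa(2,1) n m(1)])
      show "p' \<cdot> \<Sigma> f' \<in> hom (\<Sigma>\<^sub>o x') n" using p'(1) sf' by (simp add: hom_iff)
      have "p' \<cdot> \<Sigma> f' \<cdot> \<Sigma> a = p' \<cdot> \<Sigma> b \<cdot> \<Sigma> f"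
        using p'(1) sf' sa(1) sb(1) sf assoc[of "\<Sigma> a" "\<Sigma> f'" p'] assoc[of "\<Sigma> f" "\<Sigma> b" p']
        by (simp add: hom_iff)
      then show "m \<cdot> \<Sigma> a = p' \<cdot> \<Sigma> f' \<cdot> \<Sigma> a" unfolding p'(2) p(2) by simp
    qed
    then have "k = p' \<cdot> (\<Sigma> f' \<cdot> h')" using m(2) p'(1) sf' D'(4) by (simp add: hom_iff assoc)
    also have "\<dots> = zr z' n" unfolding sf0 using p'(1) o by (simp add: hom_iff)
    finally show ?thesis .
  qed
qed

end

lemma full_sub_simps [simp]:
  "Obj (full_sub T S) = Obj T \<inter> S"
  "Arr (full_sub T S) = {f \<in> Arr T. Dom T f \<in> S \<and> Cod T f \<in> S}"
  "Dom (full_sub T S) = Dom T" "Cod (full_sub T S) = Cod T"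
  "Idn (full_sub T S) = Idn T" "Cmp (full_sub T S) = Cmp T" "Shift (full_sub T S) = Shift T"
  "Dist (full_sub T S) = {(f, g, h) \<in> Dist T. Dom T f \<in> S \<and> Cod T f \<in> S \<and> Cod T g \<in> S}"
  by (simp_all add: full_sub_def)

lemma full_sub_hom: "f \<in> Hom (full_sub T S) a b \<longleftrightarrow> f \<in> Hom T a b \<and> a \<in> S \<and> b \<in> S"
  by (auto simp: Hom_def)

subsection \<open>Coreflective subcategories\<close>

locale coreflection = tri_sub T S for T :: "('o, 'm) tcat" and S +
  fixes r :: "('o, 'm, 'o, 'm) func" and e :: "'o \<Rightarrow> 'm"
  assumes adj: "right_adjoint (full_sub T S) T incl r e"
begin

lemma r_obj: "a \<in> Obj T \<Longrightarrow> fst r a \<in> S"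
  and r_hom: "f \<in> hom a b \<Longrightarrow> snd r f \<in> hom (fst r a) (fst r b)"
  and r_idn: "a \<in> Obj T \<Longrightarrow> snd r (Idn T a) = Idn T (fst r a)"
  and r_comp: "\<lbrakk>f \<in> hom a b; g \<in> hom b c\<rbrakk> \<Longrightarrow> snd r (g \<cdot> f) = snd r g \<cdot> snd r f"
  using adj unfolding right_adjoint_def is_functor_def by (auto simp: full_sub_hom hom_iff)

lemma e_hom: "a \<in> Obj T \<Longrightarrow> e a \<in> hom (fst r a) a"
  and e_nat: "f \<in> hom a b \<Longrightarrow> e b \<cdot> snd r f = f \<cdot> e a"
  using adj unfolding right_adjoint_def nat_trans_def by (auto simp: fcomp_def incl_def hom_iff)

text \<open>The adjunction speaks of homs of \<open>full_sub T S\<close>; fullness makes them homs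
  of \<open>T\<close>, the form in which the property is used.\<close>

lemma e_ex1:
  assumes "a \<in> S" "f \<in> hom a b"
  shows "\<exists>!g. g \<in> hom a (fst r b) \<and> e b \<cdot> g = f"
proof -
  have b: "b \<in> Obj T" using assms(2) by (auto simp: hom_iff)
  have "\<forall>a\<in>Obj T \<inter> S. \<forall>b\<in>Obj T. \<forall>f\<in>hom a b. \<exists>!g. g \<in> Hom (full_sub T S) a (fst r b) \<and> e b \<cdot> g = f"
    using adj unfolding right_adjoint_def incl_def by simp
  then have "\<exists>!g. g \<in> Hom (full_sub T S) a (fst r b) \<and> e b \<cdot> g = f"
    using assms b sub_obj[OF assms(1)] by blast
  then show ?thesis using r_obj[OF b] assms(1) by (simp add: full_sub_hom)
qed

lemma e_lift:
  assumes "a \<in> S" "f \<in> hom a b"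
  obtains g where "g \<in> hom a (fst r b)" "e b \<cdot> g = f"
  using e_ex1[OF assms] by blast

lemma e_cancel:
  assumes "a \<in> S" "f \<in> hom a (fst r b)" "g \<in> hom a (fst r b)" "b \<in> Obj T" "e b \<cdot> f = e b \<cdot> g"
  shows "f = g"
proof -
  have "e b \<cdot> f \<in> hom a b" using assms(2) e_hom[OF assms(4)] by (simp add: hom_iff)
  from e_ex1[OF assms(1) this] show ?thesis using assms by auto
qed

text \<open>Additivity is derived from the universal property because the addition chosen by
  \<open>hom_plus\<close> on the full subcategory need not be literally the one of the ambient category.\<close>

lemma r_add:
  assumes "f \<in> hom a b" "g \<in> hom a b"
  shows "snd r (add f g) = add (snd r f) (snd r g)"
proof -
  have o: "a \<in> Obj T" "b \<in> Obj T" using assms(1) by (auto simp: hom_iff)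
  have fg: "add f g \<in> hom a b" using assms by (simp add: hom_iff)
  note h = e_hom[OF o(1)] e_hom[OF o(2)] r_hom[OF assms(1)] r_hom[OF assms(2)] r_hom[OF fg]
  show ?thesis
  proof (rule e_cancel[OF r_obj[OF o(1)] h(5) _ o(2)])
    show "add (snd r f) (snd r g) \<in> hom (fst r a) (fst r b)" using h by (simp add: hom_iff)
    have "e b \<cdot> snd r (add f g) = add (f \<cdot> e a) (g \<cdot> e a)"
      unfolding e_nat[OF fg] using assms h by (simp add: hom_iff add_comp)
    also have "\<dots> = e b \<cdot> add (snd r f) (snd r g)"
      unfolding e_nat[OF assms(1), symmetric] e_nat[OF assms(2), symmetric]
      using h by (simp add: hom_iff comp_add)
    finally show "e b \<cdot> snd r (add f g) = e b \<cdot> add (snd r f) (snd r g)" .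
  qed
qed

end

subsection \<open>Slices\<close>

locale slice_tower = tri_cat T + c0: coreflection T S0 r0 e0 + c1: coreflection T S1 r1 e1
  for T :: "('o, 'm) tcat" and S0 r0 e0 S1 r1 e1 +
  assumes subset: "S1 \<subseteq> S0" and exact: "exact_functor T (full_sub T S0) r0"
begin

section \<open>The comparison map of two nested coreflections and its cone\<close>

definition tau :: "'o \<Rightarrow> 'm" where
  "tau E = (THE a. a \<in> hom (fst r1 E) (fst r0 E) \<and> e0 E \<cdot> a = e1 E)"

text \<open>\<open>S1\<close> lies in \<open>S0\<close>, so the counit \<open>e1 E\<close> starts in
  \<open>S0\<close> and factors uniquely over \<open>e0 E\<close>.\<close>

lemma tau:
  assumes "E \<in> Obj T"
  shows "tau E \<in> hom (fst r1 E) (fst r0 E)" "e0 E \<cdot> tau E = e1 E"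
proof -
  have "fst r1 E \<in> S0" using c1.r_obj[OF assms] subset by blast
  from theI'[OF c0.e_ex1[OF this c1.e_hom[OF assms]]]
  show "tau E \<in> hom (fst r1 E) (fst r0 E)" "e0 E \<cdot> tau E = e1 E" unfolding tau_def by auto
qed

text \<open>Both composites start in \<open>S0\<close>, so it suffices to compare them after the
  counit \<open>e0 E'\<close>, where naturality of the two counits applies.\<close>

lemma tau_nat:
  assumes "f \<in> hom E E'"
  shows "tau E' \<cdot> snd r1 f = snd r0 f \<cdot> tau E"
proof -
  have o: "E \<in> Obj T" "E' \<in> Obj T" using assms by (auto simp: hom_iff)
  note h = tau(1)[OF o(1)] tau(1)[OF o(2)] c0.r_hom[OF assms] c1.r_hom[OF assms]
    c0.e_hom[OF o(1)] c0.e_hom[OF o(2)] c1.e_hom[OF o(1)] c1.e_hom[OF o(2)]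
  have "fst r1 E \<in> S0" using c1.r_obj[OF o(1)] subset by blast
  then show ?thesis
  proof (rule c0.e_cancel[OF _ _ _ o(2)])
    show "tau E' \<cdot> snd r1 f \<in> hom (fst r1 E) (fst r0 E')" "snd r0 f \<cdot> tau E \<in> hom (fst r1 E) (fst r0 E')"
      using h by (simp_all add: hom_iff)
    have "e0 E' \<cdot> (tau E' \<cdot> snd r1 f) = e0 E' \<cdot> tau E' \<cdot> snd r1 f" using h by (simp add: hom_iff assoc)
    also have "\<dots> = f \<cdot> e1 E" unfolding tau(2)[OF o(2)] by (rule c1.e_nat[OF assms])
    also have "\<dots> = f \<cdot> e0 E \<cdot> tau E"
      unfolding tau(2)[OF o(1), symmetric] using h assms by (simp add: hom_iff assoc)
    also have "\<dots> = e0 E' \<cdot> (snd r0 f \<cdot> tau E)"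
      unfolding c0.e_nat[OF assms, symmetric] using h by (simp add: hom_iff assoc)
    finally show "e0 E' \<cdot> (tau E' \<cdot> snd r1 f) = e0 E' \<cdot> (snd r0 f \<cdot> tau E)" .
  qed
qed

text \<open>With \<open>tau_lift\<close>: on maps from \<open>S1\<close>, composition with
  \<open>tau E\<close> is bijective, because both sides are identified with maps into
  \<open>E\<close> by the counits.\<close>

lemma tau_cancel:
  assumes "F \<in> S1" "E \<in> Obj T" "x \<in> hom F (fst r1 E)" "tau E \<cdot> x = zr F (fst r0 E)"
  shows "x = zr F (fst r1 E)"
proof -
  have o: "F \<in> Obj T" "fst r1 E \<in> Obj T"
    using c1.sub_obj[OF assms(1)] c1.sub_obj[OF c1.r_obj[OF assms(2)]] .
  note h = tau(1)[OF assms(2)] c0.e_hom[OF assms(2)] c1.e_hom[OF assms(2)]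
  show ?thesis
  proof (rule c1.e_cancel[OF assms(1,3) _ assms(2)])
    show "zr F (fst r1 E) \<in> hom F (fst r1 E)" using o by (simp add: hom_iff)
    have "e1 E \<cdot> x = e0 E \<cdot> (tau E \<cdot> x)"
      unfolding tau(2)[OF assms(2), symmetric] using h assms(3) by (simp add: hom_iff assoc)
    then show "e1 E \<cdot> x = e1 E \<cdot> zr F (fst r1 E)" unfolding assms(4) using h o by (simp add: hom_iff)
  qed
qed

lemma tau_lift:
  assumes "F \<in> S1" "E \<in> Obj T" "x \<in> hom F (fst r0 E)"
  obtains y where "y \<in> hom F (fst r1 E)" "tau E \<cdot> y = x"
proof -
  note h = tau(1)[OF assms(2)] c0.e_hom[OF assms(2)] c1.e_hom[OF assms(2)]
  have "e0 E \<cdot> x \<in> hom F E" using h assms(3) by (simp add: hom_iff)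
  then obtain y where y: "y \<in> hom F (fst r1 E)" "e1 E \<cdot> y = e0 E \<cdot> x" by (rule c1.e_lift[OF assms(1)])
  have "tau E \<cdot> y = x"
  proof (rule c0.e_cancel[OF _ _ assms(3,2)])
    show "F \<in> S0" using assms(1) subset by blast
    show "tau E \<cdot> y \<in> hom F (fst r0 E)" using y(1) h by (simp add: hom_iff)
    show "e0 E \<cdot> (tau E \<cdot> y) = e0 E \<cdot> x"
      unfolding y(2)[symmetric] tau(2)[OF assms(2), symmetric] using y(1) h by (simp add: hom_iff assoc)
  qed
  then show ?thesis using that y(1) by blast
qed

text \<open>The long exact sequence of Hom(F, -): injectivity of composition with the suspension of
  \<open>tau E\<close> kills \<open>d \<cdot> x\<close>, and surjectivity of composition with
  \<open>tau E\<close> then kills \<open>x\<close>.\<close>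

lemma tau_cone_orth:
  assumes E: "E \<in> Obj T" and D: "(tau E, p, d) \<in> Dist T" "p \<in> hom (fst r0 E) z"
  shows "z \<in> orth S1"
proof -
  note t = tau(1)[OF E]
  have d: "d \<in> hom z (\<Sigma>\<^sub>o (fst r1 E))"
    using dist_triangle[OF D(1)] D(2) t by (simp add: is_triangle_def hom_iff)
  have o: "z \<in> Obj T" "fst r1 E \<in> Obj T" "fst r0 E \<in> Obj T"
    using d c1.sub_obj[OF c1.r_obj[OF E]] c0.sub_obj[OF c0.r_obj[OF E]] by (auto simp: hom_iff)
  have td: "neg (\<Sigma> (tau E)) \<cdot> d = zr z (\<Sigma>\<^sub>o (fst r0 E))"
    by (rule dist_comp_zero[OF dist_rotate[OF dist_rotate[OF D(1)]] d]) (use t in \<open>simp add: hom_iff\<close>)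
  have "x = zr F z" if F: "F \<in> S1" and x: "x \<in> hom F z" for F x
  proof -
    \<comment> \<open>Injectivity is known for \<open>tau E\<close>, not for its suspension, so
      \<open>F\<close> is first traded for a suspension of an object of \<open>S1\<close>.\<close>
    obtain G j where j: "G \<in> S1" "j \<in> hom (\<Sigma>\<^sub>o G) F" "is_iso T j" by (rule c1.sub_desuspend[OF F])
    have oo: "F \<in> Obj T" "G \<in> Obj T" using F j(1) c1.sub_obj by auto
    obtain y where y: "y \<in> hom G (fst r1 E)" "d \<cdot> x \<cdot> j = \<Sigma> y"
      using shift_surj[of "d \<cdot> x \<cdot> j" G "fst r1 E"] d x j(2) o oo by (auto simp: hom_iff)
    have "neg (\<Sigma> (tau E)) \<cdot> (d \<cdot> x \<cdot> j) = neg (\<Sigma> (tau E)) \<cdot> d \<cdot> x \<cdot> j"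
      using t d x j(2) by (simp add: hom_iff assoc)
    also have "\<dots> = zr (\<Sigma>\<^sub>o G) (\<Sigma>\<^sub>o (fst r0 E))" unfolding td using x j(2) o oo by (simp add: hom_iff)
    finally have "neg (\<Sigma> (tau E \<cdot> y)) = zr (\<Sigma>\<^sub>o G) (\<Sigma>\<^sub>o (fst r0 E))"
      unfolding y(2) using y(1) t by (simp add: hom_iff neg_comp shift_comp)
    moreover have "\<Sigma> (tau E \<cdot> y) = neg (neg (\<Sigma> (tau E \<cdot> y)))"
      by (rule neg(8)[symmetric]) (use y(1) t in \<open>simp add: hom_iff\<close>)
    ultimately have "\<Sigma> (tau E \<cdot> y) = zr (\<Sigma>\<^sub>o G) (\<Sigma>\<^sub>o (fst r0 E))" using o oo by simp
    then have "tau E \<cdot> y = zr G (fst r0 E)"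
      by (rule shift_zero_iff[rotated]) (use y(1) t in \<open>simp add: hom_iff\<close>)
    then have "y = zr G (fst r1 E)" by (rule tau_cancel[OF j(1) E y(1)])
    then have "d \<cdot> x \<cdot> j = zr (\<Sigma>\<^sub>o G) (\<Sigma>\<^sub>o (fst r1 E))" using y(2) o oo by simp
    moreover have "d \<cdot> x \<in> hom F (\<Sigma>\<^sub>o (fst r1 E))" using d x by (simp add: hom_iff)
    ultimately have "d \<cdot> x = zr F (\<Sigma>\<^sub>o (fst r1 E))" using iso_cancel_right[OF j(3,2)] by blast
    \<comment> \<open>Now \<open>x\<close> comes from \<open>fst r0 E\<close>, hence even from
      \<open>fst r1 E\<close>, and two consecutive maps of a triangle compose to zero.\<close>
    then obtain k where k: "k \<in> hom F (fst r0 E)" "p \<cdot> k = x" by (rule dist_lift'[OF D d x])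
    obtain l where l: "l \<in> hom F (fst r1 E)" "tau E \<cdot> l = k" by (rule tau_lift[OF F E k(1)])
    have "x = p \<cdot> tau E \<cdot> l" unfolding k(2)[symmetric] l(2)[symmetric] using D(2) t l(1) by (simp add: hom_iff assoc)
    also have "\<dots> = zr F z" unfolding dist_comp_zero[OF D(1) t D(2)] using l(1) o by (simp add: hom_iff)
    finally show ?thesis .
  qed
  then show ?thesis using o(1) by (simp add: orth_def)
qed

lemma tau_cone_orth_equiv:
  assumes "E \<in> Obj T" "(tau E, p, d) \<in> Dist T" "p \<in> hom (fst r0 E) z"
  shows "orth_equiv S1 p"
  by (rule c1.cone_orth_equiv[OF assms(2) tau(1)[OF assms(1)] assms(3) c1.r_obj[OF assms(1)]])

text \<open>The axiom provides some fill-in with both squares. It agrees with \<open>c\<close> after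
  \<open>p\<close>, hence equals \<open>c\<close>, so \<open>c\<close> inherits the boundary
  square.\<close>

lemma tau_cone_fill:
  assumes f: "f \<in> hom E E'"
    and D: "(tau E, p, d) \<in> Dist T" "p \<in> hom (fst r0 E) z"
    and D': "(tau E', p', d') \<in> Dist T" "p' \<in> hom (fst r0 E') z'"
    and c: "c \<in> hom z z'" "c \<cdot> p = p' \<cdot> snd r0 f"
  shows "d' \<cdot> c = \<Sigma> (snd r1 f) \<cdot> d"
proof -
  have o: "E \<in> Obj T" "E' \<in> Obj T" using f by (auto simp: hom_iff)
  obtain b where b: "b \<in> hom z z'" "b \<cdot> p = p' \<cdot> snd r0 f" "\<Sigma> (snd r1 f) \<cdot> d = d' \<cdot> b"
    by (rule dist_fillE[OF D(1) tau(1)[OF o(1)] D(2) D'(1) tau(1)[OF o(2)] D'(2) c1.r_hom[OF f] c0.r_hom[OF f]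
        tau_nat[OF f, symmetric]])
  have "c = b"
    by (rule orth_equiv_cancel[OF tau_cone_orth_equiv[OF o(1) D] D(2) tau_cone_orth[OF o(2) D'] c(1) b(1)])
      (use b(2) c(2) in simp)
  then show ?thesis using b(3) by simp
qed

section \<open>Slice functors and their uniqueness\<close>

definition is_slice :: "('o, 'm, 'o, 'm) func \<Rightarrow> ('o \<Rightarrow> 'm) \<Rightarrow> ('o \<Rightarrow> 'm) \<Rightarrow> bool" where
  "is_slice s \<pi> \<delta> \<longleftrightarrow> exact_functor T T s \<and> nat_trans T T r0 s \<pi> \<and>
     nat_trans T T s (fcomp (Shift T) r1) \<delta> \<and>
     (\<forall>E\<in>Obj T. (tau E, \<pi> E, \<delta> E) \<in> Dist T) \<and> (\<forall>E\<in>Obj T. fst s E \<in> S0 \<and> fst s E \<in> orth S1)"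

text \<open>\<open>\<theta> E\<close> is the extension of \<open>\<pi>' E\<close> along
  \<open>\<pi> E\<close>. It is a local equivalence between orthogonal objects by two-out-of-three,
  and naturality and uniqueness are checked after restriction along \<open>\<pi> E\<close>.\<close>

lemma is_slice_unique:
  assumes s: "is_slice s \<pi> \<delta>" and s': "is_slice s' \<pi>' \<delta>'"
  shows "\<exists>\<theta>. nat_iso T T s s' \<theta> \<and>
    (\<forall>E\<in>Obj T. \<theta> E \<cdot> \<pi> E = \<pi>' E \<and> \<delta>' E \<cdot> \<theta> E = \<delta> E) \<and>
    (\<forall>\<theta>'. nat_trans T T s s' \<theta>' \<and> (\<forall>E\<in>Obj T. \<theta>' E \<cdot> \<pi> E = \<pi>' E) \<longrightarrow> (\<forall>E\<in>Obj T. \<theta>' E = \<theta> E))"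
proof -
  have p: "\<pi> E \<in> hom (fst r0 E) (fst s E)" "(tau E, \<pi> E, \<delta> E) \<in> Dist T" "fst s E \<in> orth S1"
    "\<pi>' E \<in> hom (fst r0 E) (fst s' E)" "(tau E, \<pi>' E, \<delta>' E) \<in> Dist T" "fst s' E \<in> orth S1"
    if "E \<in> Obj T" for E
    using that s s' unfolding is_slice_def nat_trans_def by auto
  have q: "orth_equiv S1 (\<pi> E)" "orth_equiv S1 (\<pi>' E)" if "E \<in> Obj T" for E
    using tau_cone_orth_equiv[OF that] p[OF that] by blast+
  have "\<exists>\<theta>. \<forall>E\<in>Obj T. \<theta> E \<in> hom (fst s E) (fst s' E) \<and> \<theta> E \<cdot> \<pi> E = \<pi>' E"
  proof (rule bchoice, rule ballI)
    fix E assume E: "E \<in> Obj T"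
    show "\<exists>t. t \<in> hom (fst s E) (fst s' E) \<and> t \<cdot> \<pi> E = \<pi>' E"
      by (rule orth_equiv_extend[OF q(1)[OF E] p(1)[OF E] p(6)[OF E] p(4)[OF E]]) blast
  qed
  then obtain \<theta> where \<theta>: "\<And>E. E \<in> Obj T \<Longrightarrow> \<theta> E \<in> hom (fst s E) (fst s' E)"
      "\<And>E. E \<in> Obj T \<Longrightarrow> \<theta> E \<cdot> \<pi> E = \<pi>' E" by blast
  have "is_iso T (\<theta> E)" if E: "E \<in> Obj T" for E
  proof (rule orth_equiv_iso[OF _ \<theta>(1)[OF E] p(3)[OF E] p(6)[OF E]])
    show "orth_equiv S1 (\<theta> E)"
      by (rule orth_equiv_cancel_right[OF q(1)[OF E] _ p(1)[OF E] \<theta>(1)[OF E]]) (simp add: \<theta>(2)[OF E] q(2)[OF E])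
  qed
  moreover have "\<delta>' E \<cdot> \<theta> E = \<delta> E" if E: "E \<in> Obj T" for E
  proof -
    \<comment> \<open>\<open>tau_cone_fill\<close> for the identity of \<open>E\<close> compares two
      cones of the same map.\<close>
    have "\<delta>' E \<cdot> \<theta> E = \<Sigma> (snd r1 (Idn T E)) \<cdot> \<delta> E"
    proof (rule tau_cone_fill[OF _ p(2,1)[OF E] p(5,4)[OF E] \<theta>(1)[OF E]])
      show "Idn T E \<in> hom E E" using E by (simp add: hom_iff)
      show "\<theta> E \<cdot> \<pi> E = \<pi>' E \<cdot> snd r0 (Idn T E)"
        using \<theta>(2)[OF E] p(4)[OF E] c0.r_idn[OF E] by (simp add: hom_iff)
    qed
    also have "\<dots> = \<delta> E"
      using dist_triangle[OF p(2)[OF E]] tau(1)[OF E] c1.sub_obj[OF c1.r_obj[OF E]] c1.r_idn[OF E]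
      by (simp add: is_triangle_def hom_iff)
    finally show ?thesis .
  qed
  moreover have "\<theta> E' \<cdot> snd s f = snd s' f \<cdot> \<theta> E" if f: "f \<in> hom E E'" for f E E'
  proof -
    have o: "E \<in> Obj T" "E' \<in> Obj T" using f by (auto simp: hom_iff)
    have sf: "snd s f \<in> hom (fst s E) (fst s E')" "snd s' f \<in> hom (fst s' E) (fst s' E')"
      using s s' f unfolding is_slice_def exact_functor_def additive_functor_def is_functor_def
      by (auto simp: hom_iff)
    have nat: "\<pi> E' \<cdot> snd r0 f = snd s f \<cdot> \<pi> E" "\<pi>' E' \<cdot> snd r0 f = snd s' f \<cdot> \<pi>' E"
      using s s' f unfolding is_slice_def nat_trans_def by (auto simp: hom_iff)
    note h = sf \<theta>(1)[OF o(1)] \<theta>(1)[OF o(2)] p(1,4)[OF o(1)] p(1,4)[OF o(2)] c0.r_hom[OF f]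
    show ?thesis
    proof (rule orth_equiv_cancel[OF q(1)[OF o(1)] p(1)[OF o(1)] p(6)[OF o(2)]])
      show "\<theta> E' \<cdot> snd s f \<in> hom (fst s E) (fst s' E')" "snd s' f \<cdot> \<theta> E \<in> hom (fst s E) (fst s' E')"
        using h by (simp_all add: hom_iff)
      have "\<theta> E' \<cdot> snd s f \<cdot> \<pi> E = \<theta> E' \<cdot> \<pi> E' \<cdot> snd r0 f" using h nat(1) by (simp add: hom_iff assoc)
      also have "\<dots> = snd s' f \<cdot> (\<theta> E \<cdot> \<pi> E)" unfolding \<theta>(2)[OF o(1)] \<theta>(2)[OF o(2)] by (rule nat(2))
      also have "\<dots> = snd s' f \<cdot> \<theta> E \<cdot> \<pi> E" using h by (simp add: hom_iff assoc)
      finally show "\<theta> E' \<cdot> snd s f \<cdot> \<pi> E = snd s' f \<cdot> \<theta> E \<cdot> \<pi> E" .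
    qed
  qed
  moreover have "\<theta>' E = \<theta> E" if \<theta>': "nat_trans T T s s' \<theta>'" "\<forall>E\<in>Obj T. \<theta>' E \<cdot> \<pi> E = \<pi>' E" and E: "E \<in> Obj T" for \<theta>' E
  proof (rule orth_equiv_cancel[OF q(1)[OF E] p(1)[OF E] p(6)[OF E] _ \<theta>(1)[OF E]])
    show "\<theta>' E \<in> hom (fst s E) (fst s' E)" using \<theta>'(1) E by (simp add: nat_trans_def)
    show "\<theta>' E \<cdot> \<pi> E = \<theta> E \<cdot> \<pi> E" using \<theta>'(2) \<theta>(2) E by simp
  qed
  ultimately show ?thesis
    using \<theta> unfolding nat_iso_def nat_trans_def by (intro exI[of _ \<theta>]) (auto simp: hom_iff)
qed

section \<open>Construction of the slice functor\<close>

definition proj :: "'o \<Rightarrow> 'm" where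
  "proj E = (SOME p. \<exists>d. (tau E, p, d) \<in> Dist T)"

text \<open>Chosen relative to \<open>proj\<close> rather than independently, so that the three maps
  belong to one triangle.\<close>

definition bdry :: "'o \<Rightarrow> 'm" where
  "bdry E = (SOME d. (tau E, proj E, d) \<in> Dist T)"

definition slice_obj :: "'o \<Rightarrow> 'o" where
  "slice_obj E = Cod T (proj E)"

text \<open>Taken from the universal property of \<open>proj\<close> instead of choosing fill-ins,
  which would leave the functor laws open.\<close>

definition slice_arr :: "'m \<Rightarrow> 'm" where
  "slice_arr f = (THE c. c \<in> hom (slice_obj (Dom T f)) (slice_obj (Cod T f)) \<and>
     c \<cdot> proj (Dom T f) = proj (Cod T f) \<cdot> snd r0 f)"

lemma slice_dist: "E \<in> Obj T \<Longrightarrow> (tau E, proj E, bdry E) \<in> Dist T"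
proof -
  assume "E \<in> Obj T"
  then have "\<exists>p d. (tau E, p, d) \<in> Dist T" using dist_ex tau(1) by (simp add: hom_iff)
  then have "\<exists>d. (tau E, proj E, d) \<in> Dist T" unfolding proj_def by (rule someI_ex)
  then show ?thesis unfolding bdry_def by (rule someI_ex)
qed

lemma proj: "E \<in> Obj T \<Longrightarrow> proj E \<in> hom (fst r0 E) (slice_obj E)"
  and bdry: "E \<in> Obj T \<Longrightarrow> bdry E \<in> hom (slice_obj E) (\<Sigma>\<^sub>o (fst r1 E))"
  using dist_triangle[OF slice_dist] tau(1) by (simp_all add: is_triangle_def hom_iff slice_obj_def)

lemma slice_orth: "E \<in> Obj T \<Longrightarrow> slice_obj E \<in> orth S1"
  by (rule tau_cone_orth[OF _ slice_dist proj])

lemma slice_obj: "E \<in> Obj T \<Longrightarrow> slice_obj E \<in> Obj T"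
  by (rule orth_obj[OF slice_orth])

text \<open>The first two vertices of the triangle lie in \<open>S0\<close>, the first one by way of
  \<open>S1\<close>, and \<open>S0\<close> is closed under cones.\<close>

lemma slice_in: "E \<in> Obj T \<Longrightarrow> slice_obj E \<in> S0"
  using c0.sub_cone[OF slice_dist tau(1) proj] c1.r_obj c0.r_obj subset by blast

lemma proj_orth_equiv: "E \<in> Obj T \<Longrightarrow> orth_equiv S1 (proj E)"
  by (rule tau_cone_orth_equiv[OF _ slice_dist proj])

lemma proj_cancel:
  assumes "E \<in> Obj T" "n \<in> orth S1" "k \<in> hom (slice_obj E) n" "l \<in> hom (slice_obj E) n"
    "k \<cdot> proj E = l \<cdot> proj E"
  shows "k = l"
  by (rule orth_equiv_cancel[OF proj_orth_equiv[OF assms(1)] proj[OF assms(1)] assms(2-5)])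

lemma slice_arr:
  assumes "f \<in> hom E E'"
  shows "slice_arr f \<in> hom (slice_obj E) (slice_obj E')" "slice_arr f \<cdot> proj E = proj E' \<cdot> snd r0 f"
proof -
  have o: "E \<in> Obj T" "E' \<in> Obj T" using assms by (auto simp: hom_iff)
  have "proj E' \<cdot> snd r0 f \<in> hom (fst r0 E) (slice_obj E')"
    using proj[OF o(2)] c0.r_hom[OF assms] by (simp add: hom_iff)
  from theI'[OF orth_equiv_ex1[OF proj_orth_equiv[OF o(1)] proj[OF o(1)] slice_orth[OF o(2)] this]]
  show "slice_arr f \<in> hom (slice_obj E) (slice_obj E')" "slice_arr f \<cdot> proj E = proj E' \<cdot> snd r0 f"
    using assms unfolding slice_arr_def by (auto simp: hom_iff)
qed

text \<open>Preservation of identities, composites and sums all reduce through this to the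
  corresponding property of \<open>r0\<close>.\<close>

lemma slice_arr_unique:
  assumes "f \<in> hom E E'" "c \<in> hom (slice_obj E) (slice_obj E')" "c \<cdot> proj E = proj E' \<cdot> snd r0 f"
  shows "slice_arr f = c"
proof -
  have o: "E \<in> Obj T" "E' \<in> Obj T" using assms(1) by (auto simp: hom_iff)
  show ?thesis
    by (rule proj_cancel[OF o(1) slice_orth[OF o(2)] slice_arr(1)[OF assms(1)] assms(2)])
      (use slice_arr(2)[OF assms(1)] assms(3) in simp)
qed

lemma bdry_nat:
  assumes "f \<in> hom E E'"
  shows "bdry E' \<cdot> slice_arr f = \<Sigma> (snd r1 f) \<cdot> bdry E"
proof -
  have o: "E \<in> Obj T" "E' \<in> Obj T" using assms by (auto simp: hom_iff)
  show ?thesis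
    by (rule tau_cone_fill[OF assms slice_dist[OF o(1)] proj[OF o(1)] slice_dist[OF o(2)] proj[OF o(2)]
        slice_arr[OF assms]])
qed

lemma slice_idn:
  assumes "E \<in> Obj T"
  shows "slice_arr (Idn T E) = Idn T (slice_obj E)"
  by (rule slice_arr_unique[of _ E E])
    (use assms slice_obj[OF assms] proj[OF assms] c0.r_idn[OF assms] in \<open>simp_all add: hom_iff\<close>)

lemma slice_comp:
  assumes f: "f \<in> hom a b" and g: "g \<in> hom b c"
  shows "slice_arr (g \<cdot> f) = slice_arr g \<cdot> slice_arr f"
proof (rule slice_arr_unique)
  have o: "a \<in> Obj T" "b \<in> Obj T" "c \<in> Obj T" using f g by (auto simp: hom_iff)
  note h = slice_arr(1)[OF f] slice_arr(1)[OF g] proj[OF o(1)] proj[OF o(2)] proj[OF o(3)]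
    c0.r_hom[OF f] c0.r_hom[OF g]
  show "g \<cdot> f \<in> hom a c" using f g by (simp add: hom_iff)
  show "slice_arr g \<cdot> slice_arr f \<in> hom (slice_obj a) (slice_obj c)" using h by (simp add: hom_iff)
  have "slice_arr g \<cdot> slice_arr f \<cdot> proj a = slice_arr g \<cdot> (slice_arr f \<cdot> proj a)"
    using h by (simp add: hom_iff assoc)
  also have "\<dots> = slice_arr g \<cdot> proj b \<cdot> snd r0 f" unfolding slice_arr(2)[OF f] using h by (simp add: hom_iff assoc)
  also have "\<dots> = proj c \<cdot> snd r0 (g \<cdot> f)"
    unfolding slice_arr(2)[OF g] c0.r_comp[OF f g] using h by (simp add: hom_iff assoc)
  finally show "slice_arr g \<cdot> slice_arr f \<cdot> proj a = proj c \<cdot> snd r0 (g \<cdot> f)" .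
qed

lemma slice_add:
  assumes f: "f \<in> hom a b" and g: "g \<in> hom a b"
  shows "slice_arr (add f g) = add (slice_arr f) (slice_arr g)"
proof (rule slice_arr_unique)
  have o: "a \<in> Obj T" "b \<in> Obj T" using f by (auto simp: hom_iff)
  note h = slice_arr(1)[OF f] slice_arr(1)[OF g] proj[OF o(1)] proj[OF o(2)] c0.r_hom[OF f] c0.r_hom[OF g]
  show "add f g \<in> hom a b" using f g by (simp add: hom_iff)
  show "add (slice_arr f) (slice_arr g) \<in> hom (slice_obj a) (slice_obj b)" using h by (simp add: hom_iff)
  have "add (slice_arr f) (slice_arr g) \<cdot> proj a = add (slice_arr f \<cdot> proj a) (slice_arr g \<cdot> proj a)"
    using h by (simp add: hom_iff add_comp)
  also have "\<dots> = proj b \<cdot> snd r0 (add f g)"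
    unfolding slice_arr(2)[OF f] slice_arr(2)[OF g] c0.r_add[OF f g] using h by (simp add: hom_iff comp_add)
  finally show "add (slice_arr f) (slice_arr g) \<cdot> proj a = proj b \<cdot> snd r0 (add f g)" .
qed

lemma slice_functor: "additive_functor T T (slice_obj, slice_arr)"
proof -
  have "slice_arr f \<in> hom (slice_obj (Dom T f)) (slice_obj (Cod T f))" if "f \<in> Arr T" for f
    by (rule slice_arr) (use that in \<open>simp add: hom_iff\<close>)
  moreover have "slice_arr (g \<cdot> f) = slice_arr g \<cdot> slice_arr f"
    if "f \<in> Arr T" "g \<in> Arr T" "Cod T f = Dom T g" for f g
    by (rule slice_comp[of _ "Dom T f" "Cod T f" _ "Cod T g"]) (use that in \<open>simp_all add: hom_iff\<close>)
  moreover have "slice_arr (add f g) = add (slice_arr f) (slice_arr g)"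
    if "f \<in> Arr T" "g \<in> Arr T" "Dom T f = Dom T g" "Cod T f = Cod T g" for f g
    by (rule slice_add[of _ "Dom T f" "Cod T f"]) (use that in \<open>simp_all add: hom_iff\<close>)
  ultimately show ?thesis
    unfolding additive_functor_def is_functor_def using cat slice_obj slice_idn by simp
qed

text \<open>A cone of \<open>s f\<close> is again orthogonal to \<open>S1\<close> and corepresents, on orthogonal objects, the same
  functor as the slice of the third vertex; this replaces the \<open>3 \<times> 3\<close> lemma.\<close>

lemma slice_exact: "exact_functor T T (slice_obj, slice_arr)"
proof -
  obtain \<phi> where "nat_iso T (full_sub T S0) (fcomp r0 (Shift T)) (fcomp (Shift (full_sub T S0)) r0) \<phi>"
    and dist: "\<And>f g h. (f, g, h) \<in> Dist T \<Longrightarrow> (snd r0 f, snd r0 g, \<phi> (Dom T f) \<cdot> snd r0 h) \<in> Dist T"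
    using exact unfolding exact_functor_def by (simp add: split_def) blast
  then have \<phi>: "\<And>E. E \<in> Obj T \<Longrightarrow> \<phi> E \<in> hom (fst r0 (\<Sigma>\<^sub>o E)) (\<Sigma>\<^sub>o (fst r0 E))"
    and \<phi>_nat: "\<And>f E E'. f \<in> hom E E' \<Longrightarrow> \<phi> E' \<cdot> snd r0 (\<Sigma> f) = \<Sigma> (snd r0 f) \<cdot> \<phi> E"
    and \<phi>_iso': "\<And>E. E \<in> Obj T \<Longrightarrow> is_iso (full_sub T S0) (\<phi> E)"
    unfolding nat_iso_def nat_trans_def by (auto simp: fcomp_def full_sub_hom hom_iff)
  have \<phi>_iso: "is_iso T (\<phi> E)" if "E \<in> Obj T" for E
    using \<phi>_iso'[OF that] by (auto simp: is_iso_def full_sub_hom)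
  \<comment> \<open>This composite is a local equivalence from
    \<open>fst r0 (\<Sigma>\<^sub>o E)\<close> to an orthogonal object, so it has the universal
    property of \<open>proj (\<Sigma>\<^sub>o E)\<close>; the comparison of the two is the shift
    isomorphism \<open>\<psi> E\<close>.\<close>
  have q: "\<Sigma> (proj E) \<cdot> \<phi> E \<in> hom (fst r0 (\<Sigma>\<^sub>o E)) (\<Sigma>\<^sub>o (slice_obj E))"
    "orth_equiv S1 (\<Sigma> (proj E) \<cdot> \<phi> E)" if E: "E \<in> Obj T" for E
  proof -
    have p: "\<Sigma> (proj E) \<in> hom (\<Sigma>\<^sub>o (fst r0 E)) (\<Sigma>\<^sub>o (slice_obj E))" using proj[OF E] by (simp add: hom_iff)
    then show "\<Sigma> (proj E) \<cdot> \<phi> E \<in> hom (fst r0 (\<Sigma>\<^sub>o E)) (\<Sigma>\<^sub>o (slice_obj E))"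
      using \<phi>[OF E] by (simp add: hom_iff)
    show "orth_equiv S1 (\<Sigma> (proj E) \<cdot> \<phi> E)"
      by (rule orth_equiv_comp[OF iso_orth_equiv[OF \<phi>_iso[OF E] \<phi>[OF E]]
            c1.shift_orth_equiv[OF proj_orth_equiv[OF E] proj[OF E]] \<phi>[OF E] p])
  qed
  have "\<exists>\<psi>. \<forall>E\<in>Obj T. \<psi> E \<in> hom (slice_obj (\<Sigma>\<^sub>o E)) (\<Sigma>\<^sub>o (slice_obj E)) \<and>
      \<psi> E \<cdot> proj (\<Sigma>\<^sub>o E) = \<Sigma> (proj E) \<cdot> \<phi> E"
  proof (rule bchoice, rule ballI)
    fix E assume E: "E \<in> Obj T"
    show "\<exists>p. p \<in> hom (slice_obj (\<Sigma>\<^sub>o E)) (\<Sigma>\<^sub>o (slice_obj E)) \<and> p \<cdot> proj (\<Sigma>\<^sub>o E) = \<Sigma> (proj E) \<cdot> \<phi> E"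
      by (rule orth_equiv_extend[OF proj_orth_equiv[OF shift_obj[OF E]] proj[OF shift_obj[OF E]]
            c1.shift_orth[OF slice_orth[OF E]] q(1)[OF E]]) blast
  qed
  then obtain \<psi> where \<psi>: "\<And>E. E \<in> Obj T \<Longrightarrow> \<psi> E \<in> hom (slice_obj (\<Sigma>\<^sub>o E)) (\<Sigma>\<^sub>o (slice_obj E))"
    and \<psi>_proj: "\<And>E. E \<in> Obj T \<Longrightarrow> \<psi> E \<cdot> proj (\<Sigma>\<^sub>o E) = \<Sigma> (proj E) \<cdot> \<phi> E" by blast
  have \<psi>_iso: "is_iso T (\<psi> E)" if E: "E \<in> Obj T" for E
  proof (rule orth_equiv_iso[OF _ \<psi>[OF E] slice_orth[OF shift_obj[OF E]] c1.shift_orth[OF slice_orth[OF E]]])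
    show "orth_equiv S1 (\<psi> E)"
      by (rule orth_equiv_cancel_right[OF proj_orth_equiv[OF shift_obj[OF E]] _ proj[OF shift_obj[OF E]] \<psi>[OF E]])
        (simp add: \<psi>_proj[OF E] q(2)[OF E])
  qed
  have \<psi>_nat: "\<psi> E' \<cdot> slice_arr (\<Sigma> f) = \<Sigma> (slice_arr f) \<cdot> \<psi> E" if f: "f \<in> hom E E'" for f E E'
  proof -
    have o: "E \<in> Obj T" "E' \<in> Obj T" using f by (auto simp: hom_iff)
    have sf: "\<Sigma> f \<in> hom (\<Sigma>\<^sub>o E) (\<Sigma>\<^sub>o E')" using f by (simp add: hom_iff)
    note h = \<phi>[OF o(1)] \<phi>[OF o(2)] \<psi>[OF o(1)] \<psi>[OF o(2)] proj[OF o(1)] proj[OF o(2)]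
      proj[OF shift_obj[OF o(1)]] proj[OF shift_obj[OF o(2)]]
      slice_arr(1)[OF f] slice_arr(1)[OF sf] c0.r_hom[OF f] c0.r_hom[OF sf]
    show ?thesis
    proof (rule proj_cancel[OF shift_obj[OF o(1)] c1.shift_orth[OF slice_orth[OF o(2)]]])
      show "\<psi> E' \<cdot> slice_arr (\<Sigma> f) \<in> hom (slice_obj (\<Sigma>\<^sub>o E)) (\<Sigma>\<^sub>o (slice_obj E'))"
        "\<Sigma> (slice_arr f) \<cdot> \<psi> E \<in> hom (slice_obj (\<Sigma>\<^sub>o E)) (\<Sigma>\<^sub>o (slice_obj E'))"
        using h by (simp_all add: hom_iff)
      have "\<psi> E' \<cdot> slice_arr (\<Sigma> f) \<cdot> proj (\<Sigma>\<^sub>o E) = \<psi> E' \<cdot> (slice_arr (\<Sigma> f) \<cdot> proj (\<Sigma>\<^sub>o E))"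
        using h by (simp add: hom_iff assoc)
      also have "\<dots> = \<psi> E' \<cdot> proj (\<Sigma>\<^sub>o E') \<cdot> snd r0 (\<Sigma> f)"
        unfolding slice_arr(2)[OF sf] using h by (simp add: hom_iff assoc)
      also have "\<dots> = \<Sigma> (proj E') \<cdot> (\<phi> E' \<cdot> snd r0 (\<Sigma> f))"
        unfolding \<psi>_proj[OF o(2)] using h by (simp add: hom_iff assoc)
      also have "\<dots> = \<Sigma> (proj E' \<cdot> snd r0 f) \<cdot> \<phi> E"
        unfolding \<phi>_nat[OF f] using h by (simp add: hom_iff assoc shift_comp)
      also have "\<dots> = \<Sigma> (slice_arr f) \<cdot> (\<Sigma> (proj E) \<cdot> \<phi> E)"
        unfolding slice_arr(2)[OF f, symmetric] using h by (simp add: hom_iff assoc shift_comp)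
      also have "\<dots> = \<Sigma> (slice_arr f) \<cdot> \<psi> E \<cdot> proj (\<Sigma>\<^sub>o E)"
        unfolding \<psi>_proj[OF o(1), symmetric] using h by (simp add: hom_iff assoc)
      finally show "\<psi> E' \<cdot> slice_arr (\<Sigma> f) \<cdot> proj (\<Sigma>\<^sub>o E) = \<Sigma> (slice_arr f) \<cdot> \<psi> E \<cdot> proj (\<Sigma>\<^sub>o E)" .
    qed
  qed
  have "(slice_arr f, slice_arr g, \<psi> (Dom T f) \<cdot> slice_arr h) \<in> Dist T" if D: "(f, g, h) \<in> Dist T" for f g h
  proof -
    obtain x y z where fgh: "f \<in> hom x y" "g \<in> hom y z" "h \<in> hom z (\<Sigma>\<^sub>o x)"
      and o: "x \<in> Obj T" "y \<in> Obj T" "z \<in> Obj T" by (rule distE[OF D])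
    note sf = slice_arr(1)[OF fgh(1)] and sg = slice_arr(1)[OF fgh(2)] and sh = slice_arr(1)[OF fgh(3)]
    note rf = c0.r_hom[OF fgh(1)] and rg = c0.r_hom[OF fgh(2)] and rh = c0.r_hom[OF fgh(3)]
    have Dr: "(snd r0 f, snd r0 g, \<phi> x \<cdot> snd r0 h) \<in> Dist T" using dist[OF D] fgh(1) by (simp add: hom_iff)
    have ph: "\<phi> x \<cdot> snd r0 h \<in> hom (fst r0 z) (\<Sigma>\<^sub>o (fst r0 x))" using \<phi>[OF o(1)] rh by (simp add: hom_iff)
    obtain j k where Dj: "(slice_arr f, j, k) \<in> Dist T" using dist_ex[of "slice_arr f"] sf unfolding hom_iff by blast
    obtain w where j: "j \<in> hom (slice_obj y) w" and k: "k \<in> hom w (\<Sigma>\<^sub>o (slice_obj x))"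
      using dist_triangle[OF Dj] sf by (auto simp: is_triangle_def hom_iff)
    have w: "w \<in> orth S1" by (rule c1.orth_cone[OF Dj sf j slice_orth[OF o(1)] slice_orth[OF o(2)]])
    \<comment> \<open>A map of triangles from the image under \<open>r0\<close> to the cone of
      \<open>slice_arr f\<close>, with the slice projections over the first two vertices. The five
      lemma then makes \<open>c\<close> a local equivalence.\<close>
    obtain c where c: "c \<in> hom (fst r0 z) w" "c \<cdot> snd r0 g = j \<cdot> proj y" "\<Sigma> (proj x) \<cdot> (\<phi> x \<cdot> snd r0 h) = k \<cdot> c"
      by (rule dist_fillE[OF Dr rf rg Dj sf j proj[OF o(1)] proj[OF o(2)] slice_arr(2)[OF fgh(1), symmetric]])
    have ceq: "orth_equiv S1 c"
      by (rule c1.orth_equiv_five[OF Dr rf rg ph Dj sf j k proj[OF o(1)] proj[OF o(2)] c(1)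
            slice_arr(2)[OF fgh(1), symmetric] c(2,3) proj_orth_equiv[OF o(1)] proj_orth_equiv[OF o(2)]])
    obtain v where v: "v \<in> hom w (slice_obj z)" "v \<cdot> c = proj z"
      by (rule orth_equiv_extend[OF ceq c(1) slice_orth[OF o(3)] proj[OF o(3)]])
    have v_iso: "is_iso T v"
    proof (rule orth_equiv_iso[OF _ v(1) w slice_orth[OF o(3)]])
      show "orth_equiv S1 v"
        by (rule orth_equiv_cancel_right[OF ceq _ c(1) v(1)]) (simp add: v(2) proj_orth_equiv[OF o(3)])
    qed
    \<comment> \<open>It remains to see that \<open>v\<close> carries the maps of the cone to those
      of the candidate triangle; both equations are tested on local equivalences, here
      \<open>proj y\<close> and below \<open>c\<close>.\<close>
    have vj: "v \<cdot> j = slice_arr g"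
    proof (rule proj_cancel[OF o(2) slice_orth[OF o(3)] _ sg])
      show "v \<cdot> j \<in> hom (slice_obj y) (slice_obj z)" using v(1) j by (simp add: hom_iff)
      have "v \<cdot> j \<cdot> proj y = v \<cdot> c \<cdot> snd r0 g"
        using v(1) j c(1,2) proj[OF o(2)] rg by (simp add: hom_iff assoc)
      then show "v \<cdot> j \<cdot> proj y = slice_arr g \<cdot> proj y" unfolding v(2) slice_arr(2)[OF fgh(2)] .
    qed
    have kv: "\<psi> x \<cdot> slice_arr h \<cdot> v = k"
    proof (rule orth_equiv_cancel[OF ceq c(1) c1.shift_orth[OF slice_orth[OF o(1)]] _ k])
      show "\<psi> x \<cdot> slice_arr h \<cdot> v \<in> hom w (\<Sigma>\<^sub>o (slice_obj x))"
        using \<psi>[OF o(1)] sh v(1) by (simp add: hom_iff)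
      have "\<psi> x \<cdot> slice_arr h \<cdot> v \<cdot> c = \<psi> x \<cdot> (slice_arr h \<cdot> (v \<cdot> c))"
        using \<psi>[OF o(1)] sh v(1) c(1) by (simp add: hom_iff assoc)
      also have "\<dots> = \<psi> x \<cdot> proj (\<Sigma>\<^sub>o x) \<cdot> snd r0 h"
        unfolding v(2) slice_arr(2)[OF fgh(3)]
        using \<psi>[OF o(1)] rh proj[OF shift_obj[OF o(1)]] by (simp add: hom_iff assoc)
      also have "\<dots> = k \<cdot> c"
        unfolding \<psi>_proj[OF o(1)] c(3)[symmetric] using \<phi>[OF o(1)] rh proj[OF o(1)] by (simp add: hom_iff assoc)
      finally show "\<psi> x \<cdot> slice_arr h \<cdot> v \<cdot> c = k \<cdot> c" .
    qed
    have so: "slice_obj x \<in> Obj T" "slice_obj y \<in> Obj T" using slice_obj o by auto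
    have "triangle_map T (Shift T) (slice_arr f, j, k) (slice_arr f, slice_arr g, \<psi> x \<cdot> slice_arr h)
        (Idn T (slice_obj x), Idn T (slice_obj y), v)"
      using sf sg sh j k v(1) vj kv so \<psi>[OF o(1)] by (simp add: triangle_map_def hom_iff)
    moreover have "is_iso T (Idn T a)" if "a \<in> Obj T" for a
      by (rule isoI[of _ a a "Idn T a"]) (use that in \<open>simp_all add: hom_iff\<close>)
    ultimately have "triangle_isomorphic T (Shift T) (slice_arr f, j, k)
        (slice_arr f, slice_arr g, \<psi> x \<cdot> slice_arr h)"
      unfolding triangle_isomorphic_def using v_iso so by blast
    moreover have "is_triangle T (Shift T) (slice_arr f, slice_arr g, \<psi> x \<cdot> slice_arr h)"
      using sf sg sh \<psi>[OF o(1)] by (simp add: is_triangle_def hom_iff)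
    moreover have "Dom T f = x" using fgh(1) by (simp add: hom_iff)
    ultimately show ?thesis using dist_iso[OF Dj] by simp
  qed
  moreover have "nat_iso T T (fcomp (slice_obj, slice_arr) (Shift T)) (fcomp (Shift T) (slice_obj, slice_arr)) \<psi>"
    unfolding nat_iso_def nat_trans_def using \<psi> \<psi>_iso \<psi>_nat by (simp add: fcomp_def hom_iff)
  ultimately show ?thesis
    unfolding exact_functor_def using slice_functor by auto
qed

lemma is_slice_exists: "is_slice (slice_obj, slice_arr) proj bdry"
proof -
  have "nat_trans T T r0 (slice_obj, slice_arr) proj"
    unfolding nat_trans_def using proj slice_arr(2) by (simp add: hom_iff)
  moreover have "nat_trans T T (slice_obj, slice_arr) (fcomp (Shift T) r1) bdry"
    unfolding nat_trans_def using bdry bdry_nat by (simp add: fcomp_def hom_iff)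
  ultimately show ?thesis
    unfolding is_slice_def using slice_exact slice_dist slice_in slice_orth by simp
qed

end

subsection \<open>The effective filtration\<close>

lemma triangulated_imp_Obj_subcat:
  assumes "triangulated T"
  shows "triangulated_subcat T (Obj T)"
proof -
  interpret tri_cat T by (rule tri_cat.intro) (rule assms)
  show ?thesis
    unfolding triangulated_subcat_def
    by (auto simp: is_iso_def is_triangle_def dest!: dist_triangle zero_objD(1))
qed

text \<open>Non-emptiness matters: the empty intersection would be the whole type, which need not
  consist of objects of \<open>T\<close>. For the effective subcategories it is provided by
  \<open>triangulated_imp_Obj_subcat\<close>.\<close>

lemma triangulated_subcat_Inter:
  assumes "F \<noteq> {}" and F: "\<And>S. S \<in> F \<Longrightarrow> triangulated_subcat T S"
  shows "triangulated_subcat T (\<Inter> F)"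
  unfolding triangulated_subcat_def
proof (intro conjI allI ballI impI)
  note sub = F[unfolded triangulated_subcat_def]
  show "\<Inter> F \<subseteq> Obj T" using assms(1) sub by blast
  show "z \<in> \<Inter> F" if "zero_obj T z" for z
    using sub that by simp
  show "Cod T f \<in> \<Inter> F" if "is_iso T f \<and> Dom T f \<in> \<Inter> F" for f
    using sub that by simp
  show "a \<in> \<Inter> F \<longleftrightarrow> fst (Shift T) a \<in> \<Inter> F" if "a \<in> Obj T" for a
    using sub that by simp
  show "Cod T g \<in> \<Inter> F" if D: "(f, g, h) \<in> Dist T \<and> Dom T f \<in> \<Inter> F \<and> Cod T f \<in> \<Inter> F" for f g h
  proof
    fix S assume S: "S \<in> F"
    then have "Dom T f \<in> S" "Cod T f \<in> S" using D by auto
    then show "Cod T g \<in> S" using sub[OF S] D by blast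
  qed
qed

lemma eff_generators_antimono: "p \<le> q \<Longrightarrow> eff_generators kd U q \<subseteq> eff_generators kd U p"
  unfolding eff_generators_def by (rule Collect_mono) (meson order_trans)

text \<open>Fewer generators impose fewer conditions on the members of the intersected family, so
  the family grows and its intersection shrinks.\<close>

lemma eff_objects_antimono: "p \<le> q \<Longrightarrow> eff_objects kd U q \<subseteq> eff_objects kd U p"
  unfolding eff_objects_def using eff_generators_antimono[of p q kd U] by blast

lemma Obj_SH: "Obj (SH kd U) = {E. spectrum kd U E}"
  by (simp add: SH_def cat.extend_def localization_def Spt_def)

text \<open>The full collection of objects belongs to the intersected family, since the generators
  are spectra and coproducts are objects.\<close>

lemma triangulated_subcat_eff_objects:
  assumes "triangulated (SH kd U)"
  shows "triangulated_subcat (SH kd U) (eff_objects kd U q)"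
proof -
  let ?F = "{S. triangulated_subcat (SH kd U) S \<and> closed_under_sums U (SH kd U) S \<and> eff_generators kd U q \<subseteq> S}"
  have "eff_generators kd U q \<subseteq> Obj (SH kd U)"
    unfolding Obj_SH eff_generators_def is_free_spec_def by blast
  moreover have "closed_under_sums U (SH kd U) (Obj (SH kd U))"
    unfolding closed_under_sums_def is_coproduct_def by blast
  ultimately have "Obj (SH kd U) \<in> ?F" using triangulated_imp_Obj_subcat[OF assms] by blast
  then have "triangulated_subcat (SH kd U) (\<Inter> ?F)"
    by (intro triangulated_subcat_Inter) auto
  then show ?thesis by (simp add: eff_objects_def)
qed

text \<open>The canonical isomorphism of claim (4) is pinned down among natural transformations by
  compatibility with the maps from f_q alone; it respects the boundary maps as well.\<close>

theorem theorem6p5: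
  fixes kd :: tensor_kind
    and U :: "'u set set"
    and r :: "int \<Rightarrow> 'u hfunc"
    and \<epsilon> :: "int \<Rightarrow> 'u spec \<Rightarrow> 'u harr"
  assumes "set_universe U"
    and "triangulated (SH kd U)"
    and "\<And>q. right_adjoint (SH_eff kd U q) (SH kd U) incl (r q) (\<epsilon> q)"
    and "\<And>q. exact_functor (SH kd U) (SH_eff kd U q) (r q)"
  shows "\<forall>q. (\<exists>s \<pi> \<delta>. slice_data kd U r \<epsilon> q s \<pi> \<delta>) \<and>
    (\<forall>s \<pi> \<delta> s' \<pi>' \<delta>'. slice_data kd U r \<epsilon> q s \<pi> \<delta> \<and> slice_data kd U r \<epsilon> q s' \<pi>' \<delta>' \<longrightarrow>
      (\<exists>\<theta>. nat_iso (SH kd U) (SH kd U) s s' \<theta> \<and>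
        (\<forall>E\<in>Obj (SH kd U). Cmp (SH kd U) (\<theta> E) (\<pi> E) = \<pi>' E \<and> Cmp (SH kd U) (\<delta>' E) (\<theta> E) = \<delta> E) \<and>
        (\<forall>\<theta>'. nat_trans (SH kd U) (SH kd U) s s' \<theta>' \<and>
           (\<forall>E\<in>Obj (SH kd U). Cmp (SH kd U) (\<theta>' E) (\<pi> E) = \<pi>' E) \<longrightarrow>
           (\<forall>E\<in>Obj (SH kd U). \<theta>' E = \<theta> E))))"
proof
  fix q
  interpret slice_tower "SH kd U" "eff_objects kd U q" "r q" "\<epsilon> q"
    "eff_objects kd U (q + 1)" "r (q + 1)" "\<epsilon> (q + 1)"
    using assms(2) triangulated_subcat_eff_objects[OF assms(2)] assms(3)[of q] assms(3)[of "q + 1"]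
      assms(4)[of q] eff_objects_antimono[of q "q + 1" kd U]
    by unfold_locales (simp_all add: SH_eff_def)
  \<comment> \<open>\<open>full_sub\<close> intersects with the ambient objects, among which the
    effective ones already lie.\<close>
  have obj: "Obj (SH_eff kd U p) = eff_objects kd U p" for p
    using triangulated_subcat_eff_objects[OF assms(2), of p]
    by (auto simp: SH_eff_def triangulated_subcat_def)
  \<comment> \<open>The abstract notions specialize by unfolding, because the inclusion is literally
    the identity on objects and arrows.\<close>
  have "eff_transition kd U r \<epsilon> q = tau"
    by (simp add: fun_eq_iff eff_transition_def tau_def eff_cover_def fcomp_def incl_def)
  moreover have "eff_cover r p = r p" for p
    by (simp add: eff_cover_def fcomp_def incl_def comp_def)
  moreover have "zero_arr (SH kd U) a \<longleftrightarrow> a = zr F E" if "a \<in> hom F E" for a F E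
    using that by (auto simp: zero_arr_iff hom_iff)
  ultimately have slice: "slice_data kd U r \<epsilon> q s \<pi> \<delta> \<longleftrightarrow> is_slice s \<pi> \<delta>" for s \<pi> \<delta>
    unfolding slice_data_def is_slice_def obj orth_def by (auto intro: c0.sub_obj)
  show "(\<exists>s \<pi> \<delta>. slice_data kd U r \<epsilon> q s \<pi> \<delta>) \<and>
    (\<forall>s \<pi> \<delta> s' \<pi>' \<delta>'. slice_data kd U r \<epsilon> q s \<pi> \<delta> \<and> slice_data kd U r \<epsilon> q s' \<pi>' \<delta>' \<longrightarrow>
      (\<exists>\<theta>. nat_iso (SH kd U) (SH kd U) s s' \<theta> \<and>
        (\<forall>E\<in>Obj (SH kd U). Cmp (SH kd U) (\<theta> E) (\<pi> E) = \<pi>' E \<and> Cmp (SH kd U) (\<delta>' E) (\<theta> E) = \<delta> E) \<and>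
        (\<forall>\<theta>'. nat_trans (SH kd U) (SH kd U) s s' \<theta>' \<and>
           (\<forall>E\<in>Obj (SH kd U). Cmp (SH kd U) (\<theta>' E) (\<pi> E) = \<pi>' E) \<longrightarrow>
           (\<forall>E\<in>Obj (SH kd U). \<theta>' E = \<theta> E))))"
    unfolding slice using is_slice_exists is_slice_unique by blast
qed

end
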